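(* Let $X$ be a locally compact $\sigma$-compact metric space with a positive Radon measure $\mu$ such that $\operatorname{supp}\mu=X$, and let $\Omega\subseteq X$ be open. Let $\mathcal{E}$ be a Dirichlet form on $L_2(X)$ which is regular and strongly local. Let $S^D$ be the semigroup associated with $\mathcal{E}_D$ and $S^N$ the semigroup associated with the relaxation $\widehat{\mathcal{E}_N}$ of $\mathcal{E}_N$. The following conditions are equivalent. I. $\operatorname{cap}_\Omega(\partial\Omega)=0$. II. $S^D_t\varphi=S^N_t\varphi$ for all $\varphi\in L_2(\Omega)$ and all $t>0$.
   Context: Functions are real-valued and $L_p(X)=L_p(X,\mu)$. $C_c(X)$ is the space of continuous functions with compact support and $C_0(X)$ the space of continuous functions vanishing at infinity. $L_2(\Omega)$ is identified with $\{\mathbf{1}_\Omega\varphi:\varphi\in L_2(X)\}\subseteq L_2(X)$. The support of an $L_2$-function is its measure-theoretic (essential, closed) support. A Dirichlet form $\mathcal{E}$ on $L_2(X)$ is a densely defined, closed, positive symmetric form with domain $D(\mathcal{E})$ such that $0\vee\varphi\wedge\mathbf{1}\in D(\mathcal{E})$ and $\mathcal{E}(0\vee\varphi\wedge\mathbf{1})\le\mathcal{E}(\varphi)$ for all $\varphi\in D(\mathcal{E})$; here $\mathcal{E}(\varphi)=\mathcal{E}(\varphi,\varphi)$. The graph norm is $\|\varphi\|_{D(\mathcal{E})}=(\mathcal{E}(\varphi)+\|\varphi\|_2^2)^{1/2}$. The form is regular if $D(\mathcal{E})\cap C_c(X)$ is dense both in $D(\mathcal{E})$ with the graph norm and in $C_0(X)$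 with the supremum norm. It is strongly local if $\mathcal{E}(\varphi,\psi)=0$ for all $\varphi,\psi\in D(\mathcal{E})$ and $a\in\mathbb{R}$ such that $(\varphi+a\mathbf{1})\psi=0$. The semigroup associated with a closed positive form is $e^{-tH}$, with $H$ the associated positive self-adjoint operator. Dirichlet form $\mathcal{E}_D$: let $D_\Omega=\{\varphi\in D(\mathcal{E}):\operatorname{supp}\varphi\text{ is a compact subset of }\Omega\}$, and let $\overline{D_\Omega}$ be its closure in $D(\mathcal{E})$ for the graph norm (so $\overline{D_\Omega}\subseteq L_2(\Omega)$). Then $\mathcal{E}_D=\mathcal{E}|_{\overline{D_\Omega}}$ is a Dirichlet form on $L_2(\Omega)$ with domain $\overline{D_\Omega}$; $S^D$ is its semigroup on $L_2(\Omega)$. Neumann form $\mathcal{E}_N$: for $\chi\in D(\mathcal{E})\cap L_\infty(X)$ with $\chi\ge0$, the truncated form is $\mathcal{E}_\chi(\varphi)=\mathcal{E}(\chi\varphi,\varphi)-2^{-1}\mathcal{E}(\chi,\varphi^2)$ for $\varphi\in D(\mathcal{E})\cap L_\infty(X)$. It satisfies $0\le\mathcal{E}_\chi(\varphi)\le\|\chi\|_\infty\mathcal{E}(\varphi)$ and is extended by continuity to $D(\mathcal{E})$. With $\mathcal{C}_\Omega=\{\chi\in D(\mathcal{E})\cap L_\infty(X):0\le\chi\le\mathbf{1}_\Omega\}$ (a directed set on which $\chi\mapsto\mathcal{E}_\chi$ is increasing), $\mathcal{E}_N$ is the quadratic form on $L_2(X)$ with $D(\mathcal{E}_N)=D(\mathcal{E})$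 and $\mathcal{E}_N(\varphi)=\sup\{\mathcal{E}_\chi(\varphi):\chi\in\mathcal{C}_\Omega\}$. The relaxation $\hat t$ of a positive quadratic form $t$ is the closure of the largest closable form which is less than or equal to $t$ (where $t_1\le t_2$ means $D(t_2)\subseteq D(t_1)$ and $t_1(\varphi)\le t_2(\varphi)$ for $\varphi\in D(t_2)$). $\widehat{\mathcal{E}_N}$ is a Dirichlet form on $L_2(X)$ and $S^N$ is its semigroup on $L_2(X)$. For $A\subseteq\overline\Omega$ the relative capacity $\operatorname{cap}_\Omega(A)\in[0,\infty]$ is the infimum of $\|\varphi\|_{D(\mathcal{E})}^2$ over all $\varphi\in D(\mathcal{E})$ for which there exists an open $V\subseteq X$ with $A\subseteq V$ and $\varphi\ge\mathbf{1}$ a.e. on $V\cap\Omega$. *)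

theory Defs
  imports "HOL-Analysis.Analysis"
begin

text \<open>
  Elements of \<open>L\<^sub>2(X, \<mu>)\<close> are represented by square-integrable functions. Classes modulo null sets
  are not formed: sets of functions that stand for subspaces of \<open>L\<^sub>2\<close> are saturated under a.e.
  equality, forms are invariant under it, and identities between elements of \<open>L\<^sub>2\<close> are
  stated a.e.
\<close>

section \<open>The measure space\<close>

definition sigma_compact :: "'a::topological_space set \<Rightarrow> bool" where
  "sigma_compact A \<longleftrightarrow> (\<exists>K :: nat \<Rightarrow> 'a set. (\<forall>n. compact (K n)) \<and> (\<Union>n. K n) = A)"

definition radon_measure :: "'a::topological_space measure \<Rightarrow> bool" where
  "radon_measure M \<longleftrightarrow> sets M = sets borel
     \<and> (\<forall>K. compact K \<longrightarrow> emeasure M K < \<infinity>)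
     \<and> (\<forall>A\<in>sets M. emeasure M A = (SUP K\<in>{K. compact K \<and> K \<subseteq> A}. emeasure M K))"

definition measure_supp :: "'a::topological_space measure \<Rightarrow> 'a set" where
  "measure_supp M = {x. \<forall>U. open U \<longrightarrow> x \<in> U \<longrightarrow> 0 < emeasure M U}"

definition ess_supp :: "'a::topological_space measure \<Rightarrow> ('a \<Rightarrow> real) \<Rightarrow> 'a set" where
  "ess_supp M f = {x. \<forall>U. open U \<longrightarrow> x \<in> U \<longrightarrow> \<not> (AE y in M. y \<in> U \<longrightarrow> f y = 0)}"

section \<open>Function spaces\<close>

definition L2 :: "'a measure \<Rightarrow> ('a \<Rightarrow> real) set" where
  "L2 M = {f \<in> borel_measurable M. integrable M (\<lambda>x. (f x)\<^sup>2)}"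

text \<open>The closed subspace of \<open>L\<^sub>2(X)\<close> with which \<open>L\<^sub>2(\<Omega>)\<close> is identified.\<close>

definition L2_on :: "'a measure \<Rightarrow> 'a set \<Rightarrow> ('a \<Rightarrow> real) set" where
  "L2_on M \<Omega> = {f \<in> L2 M. AE x in M. f x = indicator \<Omega> x * f x}"

definition l2_inner :: "'a measure \<Rightarrow> ('a \<Rightarrow> real) \<Rightarrow> ('a \<Rightarrow> real) \<Rightarrow> real" where
  "l2_inner M f g = (\<integral>x. f x * g x \<partial>M)"

definition l2_norm :: "'a measure \<Rightarrow> ('a \<Rightarrow> real) \<Rightarrow> real" where
  "l2_norm M f = sqrt (l2_inner M f f)"

definition Linf :: "'a measure \<Rightarrow> ('a \<Rightarrow> real) set" where
  "Linf M = {f \<in> borel_measurable M. \<exists>C. AE x in M. \<bar>f x\<bar> \<le> C}"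

definition Cc :: "('a::topological_space \<Rightarrow> real) set" where
  "Cc = {f. continuous_on UNIV f \<and> compact (closure {x. f x \<noteq> 0})}"

definition C0 :: "('a::topological_space \<Rightarrow> real) set" where
  "C0 = {f. continuous_on UNIV f \<and> (\<forall>e>0. compact {x. e \<le> \<bar>f x\<bar>})}"

section \<open>Forms\<close>

text \<open>The values of \<open>fval\<close> are meaningful on \<open>fdom\<close> only.\<close>

record 'a form =
  fdom :: "('a \<Rightarrow> real) set"
  fval :: "('a \<Rightarrow> real) \<Rightarrow> ('a \<Rightarrow> real) \<Rightarrow> real"

definition graph_norm :: "'a measure \<Rightarrow> 'a form \<Rightarrow> ('a \<Rightarrow> real) \<Rightarrow> real" where
  "graph_norm M a f = sqrt (fval a f f + (l2_norm M f)\<^sup>2)"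

text \<open>Throughout, \<open>H\<close> is the subspace of \<open>L\<^sub>2(X)\<close> playing the role of the Hilbert space.\<close>

definition positive_form :: "'a measure \<Rightarrow> ('a \<Rightarrow> real) set \<Rightarrow> 'a form \<Rightarrow> bool" where
  "positive_form M H a \<longleftrightarrow>
     fdom a \<subseteq> H
   \<and> (\<lambda>_. 0) \<in> fdom a
   \<and> (\<forall>f\<in>fdom a. \<forall>g\<in>fdom a. (\<lambda>x. f x + g x) \<in> fdom a)
   \<and> (\<forall>c. \<forall>f\<in>fdom a. (\<lambda>x. c * f x) \<in> fdom a)
   \<and> (\<forall>f\<in>fdom a. \<forall>g\<in>borel_measurable M. (AE x in M. f x = g x) \<longrightarrow>
        g \<in> fdom a \<and> (\<forall>h\<in>fdom a. fval a f h = fval a g h))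
   \<and> (\<forall>f\<in>fdom a. \<forall>g\<in>fdom a. \<forall>h\<in>fdom a.
        fval a (\<lambda>x. f x + g x) h = fval a f h + fval a g h)
   \<and> (\<forall>c. \<forall>f\<in>fdom a. \<forall>g\<in>fdom a. fval a (\<lambda>x. c * f x) g = c * fval a f g)
   \<and> (\<forall>f\<in>fdom a. \<forall>g\<in>fdom a. fval a f g = fval a g f)
   \<and> (\<forall>f\<in>fdom a. 0 \<le> fval a f f)"

definition densely_defined :: "'a measure \<Rightarrow> ('a \<Rightarrow> real) set \<Rightarrow> 'a form \<Rightarrow> bool" where
  "densely_defined M H a \<longleftrightarrow>
     (\<forall>f\<in>H. \<forall>e>0. \<exists>g\<in>fdom a. l2_norm M (\<lambda>x. f x - g x) < e)"

definition closed_form :: "'a measure \<Rightarrow> ('a \<Rightarrow> real) set \<Rightarrow> 'a form \<Rightarrow> bool" where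
  "closed_form M H a \<longleftrightarrow> positive_form M H a
   \<and> (\<forall>u :: nat \<Rightarrow> 'a \<Rightarrow> real.
        (\<forall>n. u n \<in> fdom a)
        \<and> (\<forall>e>0. \<exists>N. \<forall>m\<ge>N. \<forall>n\<ge>N. graph_norm M a (\<lambda>x. u m x - u n x) < e)
        \<longrightarrow> (\<exists>f\<in>fdom a. (\<lambda>n. graph_norm M a (\<lambda>x. u n x - f x)) \<longlonglongrightarrow> 0))"

definition form_extends :: "'a form \<Rightarrow> 'a form \<Rightarrow> bool" where
  "form_extends b a \<longleftrightarrow>
     fdom a \<subseteq> fdom b \<and> (\<forall>f\<in>fdom a. \<forall>g\<in>fdom a. fval b f g = fval a f g)"

definition closable_form :: "'a measure \<Rightarrow> ('a \<Rightarrow> real) set \<Rightarrow> 'a form \<Rightarrow> bool" where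
  "closable_form M H a \<longleftrightarrow>
     positive_form M H a \<and> (\<exists>b. closed_form M H b \<and> form_extends b a)"

text \<open>\<open>b\<close> is the smallest closed extension of \<open>a\<close>.\<close>

definition is_closure :: "'a measure \<Rightarrow> ('a \<Rightarrow> real) set \<Rightarrow> 'a form \<Rightarrow> 'a form \<Rightarrow> bool" where
  "is_closure M H a b \<longleftrightarrow> closed_form M H b \<and> form_extends b a
   \<and> (\<forall>c. closed_form M H c \<and> form_extends c a \<longrightarrow> form_extends c b)"

definition form_le :: "'a form \<Rightarrow> 'a form \<Rightarrow> bool" where
  "form_le s t \<longleftrightarrow> fdom t \<subseteq> fdom s \<and> (\<forall>f\<in>fdom t. fval s f f \<le> fval t f f)"

definition is_largest_closable ::
    "'a measure \<Rightarrow> ('a \<Rightarrow> real) set \<Rightarrow> 'a form \<Rightarrow> 'a form \<Rightarrow> bool" where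
  "is_largest_closable M H t s \<longleftrightarrow> closable_form M H s \<and> form_le s t
   \<and> (\<forall>r. closable_form M H r \<and> form_le r t \<longrightarrow> form_le r s)"

text \<open>
  The relaxation \<open>b\<close> of \<open>t\<close>. It is a relation, because a form is determined by the mathematics
  only up to the values of \<open>fval\<close> off the domain.
\<close>

definition is_relaxation :: "'a measure \<Rightarrow> ('a \<Rightarrow> real) set \<Rightarrow> 'a form \<Rightarrow> 'a form \<Rightarrow> bool" where
  "is_relaxation M H t b \<longleftrightarrow> (\<exists>s. is_largest_closable M H t s \<and> is_closure M H s b)"

section \<open>Dirichlet forms\<close>

definition dirichlet_form :: "'a measure \<Rightarrow> ('a \<Rightarrow> real) set \<Rightarrow> 'a form \<Rightarrow> bool" where
  "dirichlet_form M H a \<longleftrightarrow> densely_defined M H a \<and> closed_form M H a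
   \<and> (\<forall>f\<in>fdom a. (\<lambda>x. min (max 0 (f x)) 1) \<in> fdom a
        \<and> fval a (\<lambda>x. min (max 0 (f x)) 1) (\<lambda>x. min (max 0 (f x)) 1) \<le> fval a f f)"

definition regular_form :: "'a::topological_space measure \<Rightarrow> 'a form \<Rightarrow> bool" where
  "regular_form M a \<longleftrightarrow>
     (\<forall>f\<in>fdom a. \<forall>e>0. \<exists>g\<in>fdom a \<inter> Cc. graph_norm M a (\<lambda>x. f x - g x) < e)
   \<and> (\<forall>f\<in>C0. \<forall>e>0. \<exists>g\<in>fdom a \<inter> Cc. \<forall>x. \<bar>f x - g x\<bar> \<le> e)"

definition strongly_local :: "'a measure \<Rightarrow> 'a form \<Rightarrow> bool" where
  "strongly_local M a \<longleftrightarrow> (\<forall>f\<in>fdom a. \<forall>g\<in>fdom a. \<forall>c.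
     (AE x in M. (f x + c) * g x = 0) \<longrightarrow> fval a f g = 0)"

section \<open>The semigroup associated with a form\<close>

text \<open>The graph of the operator associated with a form.\<close>

definition form_operator ::
    "'a measure \<Rightarrow> ('a \<Rightarrow> real) set \<Rightarrow> 'a form \<Rightarrow> (('a \<Rightarrow> real) \<times> ('a \<Rightarrow> real)) set" where
  "form_operator M H a =
     {(f, g). f \<in> fdom a \<and> g \<in> H \<and> (\<forall>h\<in>fdom a. fval a f h = l2_inner M g h)}"

definition C0_semigroup ::
    "'a measure \<Rightarrow> ('a \<Rightarrow> real) set \<Rightarrow> (real \<Rightarrow> ('a \<Rightarrow> real) \<Rightarrow> ('a \<Rightarrow> real)) \<Rightarrow> bool" where
  "C0_semigroup M H S \<longleftrightarrow>
     (\<forall>t\<ge>0. \<forall>f\<in>H. S t f \<in> H)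
   \<and> (\<forall>t\<ge>0. \<forall>f\<in>H. \<forall>g\<in>H. AE x in M. S t (\<lambda>y. f y + g y) x = S t f x + S t g x)
   \<and> (\<forall>t\<ge>0. \<forall>c. \<forall>f\<in>H. AE x in M. S t (\<lambda>y. c * f y) x = c * S t f x)
   \<and> (\<forall>t\<ge>0. \<exists>C. \<forall>f\<in>H. l2_norm M (S t f) \<le> C * l2_norm M f)
   \<and> (\<forall>f\<in>H. AE x in M. S 0 f x = f x)
   \<and> (\<forall>s\<ge>0. \<forall>t\<ge>0. \<forall>f\<in>H. AE x in M. S (s + t) f x = S s (S t f) x)
   \<and> (\<forall>f\<in>H. ((\<lambda>t. l2_norm M (\<lambda>x. S t f x - f x)) \<longlongrightarrow> 0) (at_right 0))"

text \<open>The graph of the negative of the infinitesimal generator.\<close>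

definition neg_generator ::
    "'a measure \<Rightarrow> ('a \<Rightarrow> real) set \<Rightarrow> (real \<Rightarrow> ('a \<Rightarrow> real) \<Rightarrow> ('a \<Rightarrow> real))
      \<Rightarrow> (('a \<Rightarrow> real) \<times> ('a \<Rightarrow> real)) set" where
  "neg_generator M H S = {(f, g). f \<in> H \<and> g \<in> H
     \<and> ((\<lambda>t. l2_norm M (\<lambda>x. (f x - S t f x) / t - g x)) \<longlongrightarrow> 0) (at_right 0)}"

text \<open>
  If \<open>A\<close> is the positive self-adjoint operator associated with \<open>a\<close>, then \<open>(e\<^sup>-\<^sup>t\<^sup>A)\<close> is the strongly
  continuous semigroup generated by \<open>-A\<close>. It is unique up to a.e. equality.
\<close>

definition form_semigroup ::
    "'a measure \<Rightarrow> ('a \<Rightarrow> real) set \<Rightarrow> 'a form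
      \<Rightarrow> (real \<Rightarrow> ('a \<Rightarrow> real) \<Rightarrow> ('a \<Rightarrow> real)) \<Rightarrow> bool" where
  "form_semigroup M H a S \<longleftrightarrow>
     C0_semigroup M H S \<and> neg_generator M H S = form_operator M H a"

section \<open>The Dirichlet and Neumann forms and the relative capacity\<close>

definition D_compact :: "'a::topological_space measure \<Rightarrow> 'a form \<Rightarrow> 'a set \<Rightarrow> ('a \<Rightarrow> real) set"
  where "D_compact M a \<Omega> = {f \<in> fdom a. compact (ess_supp M f) \<and> ess_supp M f \<subseteq> \<Omega>}"

definition form_D :: "'a::topological_space measure \<Rightarrow> 'a form \<Rightarrow> 'a set \<Rightarrow> 'a form" where
  "form_D M a \<Omega> =
     \<lparr>fdom = {f \<in> fdom a. \<forall>e>0. \<exists>g\<in>D_compact M a \<Omega>. graph_norm M a (\<lambda>x. f x - g x) < e},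
      fval = fval a\<rparr>"

definition truncated_form :: "'a form \<Rightarrow> ('a \<Rightarrow> real) \<Rightarrow> ('a \<Rightarrow> real) \<Rightarrow> real" where
  "truncated_form a w f = fval a (\<lambda>x. w x * f x) f - fval a w (\<lambda>x. (f x)\<^sup>2) / 2"

text \<open>Extension by continuity from \<open>D(a) \<inter> L\<^sub>\<infinity>\<close> to \<open>D(a)\<close> with its graph norm.\<close>

definition truncated_form_ext ::
    "'a measure \<Rightarrow> 'a form \<Rightarrow> ('a \<Rightarrow> real) \<Rightarrow> ('a \<Rightarrow> real) \<Rightarrow> real" where
  "truncated_form_ext M a w f = (THE c. \<forall>u :: nat \<Rightarrow> 'a \<Rightarrow> real.
     (\<forall>n. u n \<in> fdom a \<inter> Linf M) \<and> (\<lambda>n. graph_norm M a (\<lambda>x. u n x - f x)) \<longlonglongrightarrow> 0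
     \<longrightarrow> (\<lambda>n. truncated_form a w (u n)) \<longlonglongrightarrow> c)"

definition cutoffs :: "'a measure \<Rightarrow> 'a form \<Rightarrow> 'a set \<Rightarrow> ('a \<Rightarrow> real) set" where
  "cutoffs M a \<Omega> =
     {w \<in> fdom a \<inter> Linf M. AE x in M. 0 \<le> w x \<and> w x \<le> indicator \<Omega> x}"

definition neumann_quad :: "'a measure \<Rightarrow> 'a form \<Rightarrow> 'a set \<Rightarrow> ('a \<Rightarrow> real) \<Rightarrow> real" where
  "neumann_quad M a \<Omega> f = (SUP w\<in>cutoffs M a \<Omega>. truncated_form_ext M a w f)"

text \<open>The quadratic form is turned into a bilinear one by polarization.\<close>

definition form_N :: "'a measure \<Rightarrow> 'a form \<Rightarrow> 'a set \<Rightarrow> 'a form" where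
  "form_N M a \<Omega> =
     \<lparr>fdom = fdom a,
      fval = (\<lambda>f g. (neumann_quad M a \<Omega> (\<lambda>x. f x + g x)
                     - neumann_quad M a \<Omega> (\<lambda>x. f x - g x)) / 4)\<rparr>"

definition rel_cap :: "'a::topological_space measure \<Rightarrow> 'a form \<Rightarrow> 'a set \<Rightarrow> 'a set \<Rightarrow> ennreal" where
  "rel_cap M a \<Omega> A =
     (INF f\<in>{f \<in> fdom a. \<exists>V. open V \<and> A \<subseteq> V \<and> (AE x in M. x \<in> V \<inter> \<Omega> \<longrightarrow> 1 \<le> f x)}.
        ennreal ((graph_norm M a f)\<^sup>2))"

end

theory Submission
  imports Defs
begin

text \<open>
  Let \<open>A\<^sub>D\<close> and \<open>A\<^sub>N\<close> be the operators of the Dirichlet form and of the relaxed Neumann form, and let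
  \<open>P\<close> be multiplication by the indicator of \<open>\<Omega>\<close>. Both conditions are compared with the inclusion
  \<open>A\<^sub>D \<subseteq> A\<^sub>N\<close>. Equality of the semigroups on \<open>L\<^sub>2(\<Omega>)\<close> gives it by differentiation at \<open>0\<close>.
  Conversely, if \<open>A\<^sub>D \<subseteq> A\<^sub>N\<close> and \<open>f\<close> is in the domain of \<open>A\<^sub>D\<close>, then the square norm of
  \<open>S\<^sup>D\<^sub>t f - S\<^sup>N\<^sub>t f\<close> has a nonpositive right derivative, and the domain of \<open>A\<^sub>D\<close> is dense.

  From the inclusion to capacity zero: the resolvents of \<open>A\<^sub>D\<close> applied to \<open>P \<psi>\<close> have energy at most that
  of \<open>\<psi>\<close> in the relaxed form, so \<open>P \<psi>\<close> is in the domain of the Dirichlet form whenever \<open>\<psi>\<close> is in the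
  domain of the given form. If \<open>\<psi> = 2\<close> near a compact part of the boundary and \<open>g\<close> has compact support in
  \<open>\<Omega>\<close> and approximates \<open>P \<psi>\<close>, then \<open>P \<psi> - g\<close> is small in the graph norm and at least \<open>1\<close> on
  \<open>V \<inter> \<Omega>\<close> for a neighbourhood \<open>V\<close> of that part of the boundary.

  From capacity zero to the inclusion: let \<open>\<phi>\<^sub>n\<close> be \<open>1\<close> on \<open>\<Omega>\<close> near the boundary with graph norms
  tending to zero. The functions \<open>P (1 - \<phi>\<^sub>n) \<psi>\<close> have compact support in \<open>\<Omega>\<close>, and by strong locality
  their energy is their Neumann energy. Since \<open>\<phi>\<^sub>n \<psi>\<close> is bounded in energy and tends to zero in
  \<open>L\<^sub>2\<close>, passing to convex combinations shows that \<open>P \<psi>\<close> is in the Dirichlet domain with energy equal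
  to the Neumann energy of \<open>\<psi>\<close>. Hence the relaxed Neumann form is the Dirichlet form composed with \<open>P\<close>.

  The calculus of products and truncated forms is obtained from the forms
  \<open>\<lambda> \<langle>f - \<lambda> (\<lambda> + A)\<inverse> f, g\<rangle>\<close>, which on simple functions are sums over pairs of points with nonnegative
  weights.
\<close>

section \<open>Spaces of functions with a semi-inner product\<close>

text \<open>Functions are not gathered into classes, so the Hilbert space arguments run over sets of
  functions with a semi-inner product, and a change of representative is always an explicit a.e.
  step. The operator of a form is reached through its resolvents, described as minimizers of a
  quadratic functional: energy bounds, convergence in norm and the Markov property all follow from
  one identity, \<open>res_variation\<close>. Weak compactness is replaced by midpoints of tails,
  because every constraint that must survive a limit (a compact support, a half-space, a ball) is
  stable under midpoints. Two obstacles shape the rest. The relaxation is given only by its extremal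
  properties, so it is identified by exhibiting a closed competitor below the Neumann form and
  showing that the competitor agrees with the largest closable form on its domain. And a strongly
  continuous semigroup comes with one operator bound for each time; continuity of an orbit from the
  left needs a bound uniform on bounded time intervals, which is the reason for the nested-ball
  argument.\<close>

definition qnorm :: "('v \<Rightarrow> 'v \<Rightarrow> real) \<Rightarrow> 'v \<Rightarrow> real" where
  "qnorm q f = sqrt (q f f)"

text \<open>The parallelogram law involves only the midpoint of two elements, so this hull serves in
  place of the full convex hull, and rule induction shows that a convex condition on
  \<open>S\<close> persists.\<close>

inductive_set midpoints :: "('a \<Rightarrow> real) set \<Rightarrow> ('a \<Rightarrow> real) set" for S where
  base: "f \<in> S \<Longrightarrow> f \<in> midpoints S"
| mid: "f \<in> midpoints S \<Longrightarrow> g \<in> midpoints S \<Longrightarrow> (\<lambda>x. f x / 2 + g x / 2) \<in> midpoints S"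

lemma midpoints_mono: "f \<in> midpoints S \<Longrightarrow> S \<subseteq> T \<Longrightarrow> f \<in> midpoints T"
  by (induction rule: midpoints.induct) (blast intro: midpoints.intros)+

text \<open>Definiteness would fail already for functions that vanish a.e., and energies may vanish
  on more than these. The instances are the \<open>L2\<close> product, forms and their graph
  products, the approximating forms \<open>approx n\<close>, and the truncated forms on bounded
  functions.\<close>

locale semi_inner =
  fixes V :: "('a \<Rightarrow> real) set" and q :: "('a \<Rightarrow> real) \<Rightarrow> ('a \<Rightarrow> real) \<Rightarrow> real"
  assumes zero: "(\<lambda>_. 0) \<in> V"
    and add: "f \<in> V \<Longrightarrow> g \<in> V \<Longrightarrow> (\<lambda>x. f x + g x) \<in> V"
    and scale: "f \<in> V \<Longrightarrow> (\<lambda>x. c * f x) \<in> V"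
    and q_add: "f \<in> V \<Longrightarrow> g \<in> V \<Longrightarrow> h \<in> V \<Longrightarrow> q (\<lambda>x. f x + g x) h = q f h + q g h"
    and q_scale: "f \<in> V \<Longrightarrow> g \<in> V \<Longrightarrow> q (\<lambda>x. c * f x) g = c * q f g"
    and q_sym: "f \<in> V \<Longrightarrow> g \<in> V \<Longrightarrow> q f g = q g f"
    and q_nonneg: "f \<in> V \<Longrightarrow> 0 \<le> q f f"
begin

lemma q_add_right: "f \<in> V \<Longrightarrow> g \<in> V \<Longrightarrow> h \<in> V \<Longrightarrow> q h (\<lambda>x. f x + g x) = q h f + q h g"
  using q_add[of f g h] q_sym add by metis

lemma q_scale_right: "f \<in> V \<Longrightarrow> g \<in> V \<Longrightarrow> q g (\<lambda>x. c * f x) = c * q g f"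
  using q_scale[of f g c] q_sym scale by metis

lemma diff: "f \<in> V \<Longrightarrow> g \<in> V \<Longrightarrow> (\<lambda>x. f x - g x) \<in> V"
  using add[of f "\<lambda>x. (-1) * g x"] scale[of g "-1"] by simp

lemma q_diff: "f \<in> V \<Longrightarrow> g \<in> V \<Longrightarrow> h \<in> V \<Longrightarrow> q (\<lambda>x. f x - g x) h = q f h - q g h"
  using q_add[of f "\<lambda>x. (-1) * g x" h] scale[of g "-1"] q_scale[of g h "-1"] by simp

lemma q_diff_right: "f \<in> V \<Longrightarrow> g \<in> V \<Longrightarrow> h \<in> V \<Longrightarrow> q h (\<lambda>x. f x - g x) = q h f - q h g"
  using q_diff[of f g h] q_sym diff by metis

lemma q_zero: "f \<in> V \<Longrightarrow> q (\<lambda>_. 0) f = 0"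
  using q_scale[of f f 0] by simp

lemmas q_rules = zero add scale diff q_add q_add_right q_scale q_scale_right q_diff q_diff_right

lemma half: "f \<in> V \<Longrightarrow> (\<lambda>x. f x / 2) \<in> V"
  using scale[of f "1/2"] by simp

lemma q_half: "f \<in> V \<Longrightarrow> g \<in> V \<Longrightarrow> q (\<lambda>x. f x / 2) g = q f g / 2"
  using q_scale[of f g "1/2"] by simp

lemma q_half_right: "f \<in> V \<Longrightarrow> g \<in> V \<Longrightarrow> q g (\<lambda>x. f x / 2) = q g f / 2"
  using q_scale_right[of f g "1/2"] by simp

lemma q_diff_sq:
  "f \<in> V \<Longrightarrow> g \<in> V \<Longrightarrow> q (\<lambda>x. f x - g x) (\<lambda>x. f x - g x) = q f f - 2 * q f g + q g g"
  by (simp add: q_rules q_sym[of g f])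

lemma q_add_sq:
  "f \<in> V \<Longrightarrow> g \<in> V \<Longrightarrow> q (\<lambda>x. f x + g x) (\<lambda>x. f x + g x) = q f f + 2 * q f g + q g g"
  by (simp add: q_rules q_sym[of g f])

lemma q_scale_sq: "f \<in> V \<Longrightarrow> q (\<lambda>x. c * f x) (\<lambda>x. c * f x) = c\<^sup>2 * q f f"
  by (simp add: q_rules power2_eq_square)

lemma q_polar:
  assumes "f \<in> V" "g \<in> V"
  shows "q f g = (q (\<lambda>x. f x + g x) (\<lambda>x. f x + g x) - q f f - q g g) / 2"
  using q_add_sq[OF assms] by simp

lemma parallelogram:
  assumes "f \<in> V" "g \<in> V"
  shows "q (\<lambda>x. f x - g x) (\<lambda>x. f x - g x)
    = 2 * q f f + 2 * q g g - 4 * q (\<lambda>x. f x / 2 + g x / 2) (\<lambda>x. f x / 2 + g x / 2)"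
  using q_add_sq[OF half[OF assms(1)] half[OF assms(2)]] assms
  by (simp add: q_rules q_diff_sq half q_half q_half_right q_sym[of g f])

lemma cauchy_schwarz_sq:
  assumes f: "f \<in> V" and g: "g \<in> V"
  shows "(q f g)\<^sup>2 \<le> q f f * q g g"
proof -
  have *: "0 \<le> q f f - 2 * (c * q f g) + c\<^sup>2 * q g g" for c
    using q_nonneg[OF diff[OF f scale[OF g, of c]]] q_diff_sq[OF f scale[OF g, of c]]
    by (simp add: f g q_scale_sq q_scale_right)
  show ?thesis
  proof (cases "q g g = 0")
    case True
    have "q f g = 0"
    proof (rule ccontr)
      assume "q f g \<noteq> 0"
      \<comment> \<open>With \<open>q g g = 0\<close> the expression in \<open>*\<close> is affine
        in \<open>c\<close>; this \<open>c\<close> gives it the value -1.\<close>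
      then show False
        using *[of "(q f f + 1) / (2 * q f g)"] True by simp
    qed
    then show ?thesis using True by simp
  next
    case False
    then have pos: "0 < q g g" using q_nonneg[OF g] by simp
    show ?thesis
      using *[of "q f g / q g g"] pos by (simp add: field_simps power2_eq_square)
  qed
qed

lemma qnorm_sq: "f \<in> V \<Longrightarrow> (qnorm q f)\<^sup>2 = q f f"
  by (simp add: qnorm_def q_nonneg)

lemma qnorm_nonneg: "f \<in> V \<Longrightarrow> 0 \<le> qnorm q f"
  by (simp add: qnorm_def q_nonneg)

lemma cauchy_schwarz:
  assumes "f \<in> V" "g \<in> V"
  shows "\<bar>q f g\<bar> \<le> qnorm q f * qnorm q g"
proof -
  have "\<bar>q f g\<bar> = sqrt ((q f g)\<^sup>2)" by simp
  also have "\<dots> \<le> sqrt (q f f * q g g)"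
    using cauchy_schwarz_sq[OF assms] real_sqrt_le_mono by blast
  finally show ?thesis by (simp add: qnorm_def real_sqrt_mult)
qed

lemma qnorm_triangle:
  assumes "f \<in> V" "g \<in> V"
  shows "qnorm q (\<lambda>x. f x + g x) \<le> qnorm q f + qnorm q g"
proof (rule power2_le_imp_le)
  show "(qnorm q (\<lambda>x. f x + g x))\<^sup>2 \<le> (qnorm q f + qnorm q g)\<^sup>2"
    using cauchy_schwarz[OF assms] assms
    by (simp add: qnorm_sq add q_add_sq power2_sum)
qed (simp add: assms qnorm_nonneg)

lemma qnorm_scale: "f \<in> V \<Longrightarrow> qnorm q (\<lambda>x. c * f x) = \<bar>c\<bar> * qnorm q f"
  by (simp add: qnorm_def q_scale_sq real_sqrt_mult)

lemma qnorm_minus_commute: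
  "f \<in> V \<Longrightarrow> g \<in> V \<Longrightarrow> qnorm q (\<lambda>x. f x - g x) = qnorm q (\<lambda>x. g x - f x)"
  using qnorm_scale[of "\<lambda>x. g x - f x" "-1"] by (simp add: diff)

lemma qnorm_triangle_diff:
  assumes "f \<in> V" "g \<in> V"
  shows "qnorm q (\<lambda>x. f x - g x) \<le> qnorm q f + qnorm q g"
  using qnorm_triangle[of f "\<lambda>x. (-1) * g x"] qnorm_scale[of g "-1"] scale[of g "-1"] assms
  by simp

lemma qnorm_triangle3:
  assumes "f \<in> V" "g \<in> V" "h \<in> V"
  shows "qnorm q (\<lambda>x. f x - h x) \<le> qnorm q (\<lambda>x. f x - g x) + qnorm q (\<lambda>x. g x - h x)"
  using qnorm_triangle[of "\<lambda>x. f x - g x" "\<lambda>x. g x - h x"] assms by (simp add: diff)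

lemma qnorm_le_add_diff:
  assumes "f \<in> V" "g \<in> V"
  shows "qnorm q f \<le> qnorm q g + qnorm q (\<lambda>x. f x - g x)"
  using qnorm_triangle[of g "\<lambda>x. f x - g x"] assms by (simp add: diff)

lemma sum_scaled:
  assumes "finite I" "\<And>i. i \<in> I \<Longrightarrow> f i \<in> V"
  shows "(\<lambda>x. \<Sum>i\<in>I. c i * f i x) \<in> V"
  using assms by (induction rule: finite_induct) (auto simp: zero add scale)

lemma q_sum_scaled:
  assumes "finite I" "\<And>i. i \<in> I \<Longrightarrow> f i \<in> V" and g: "g \<in> V"
  shows "q (\<lambda>x. \<Sum>i\<in>I. c i * f i x) g = (\<Sum>i\<in>I. c i * q (f i) g)"
  using assms(1,2)
proof (induction rule: finite_induct)
  case (insert i I)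
  then show ?case
    by (simp add: q_add scale sum_scaled g q_scale)
qed (simp add: q_zero g)

lemma q_sum_scaled2:
  assumes "finite I" "\<And>i. i \<in> I \<Longrightarrow> f i \<in> V"
  shows "q (\<lambda>x. \<Sum>i\<in>I. c i * f i x) (\<lambda>x. \<Sum>i\<in>I. d i * f i x)
    = (\<Sum>i\<in>I. \<Sum>j\<in>I. c i * d j * q (f i) (f j))"
proof -
  have "q (f i) (\<lambda>x. \<Sum>j\<in>I. d j * f j x) = (\<Sum>j\<in>I. d j * q (f i) (f j))" if "i \<in> I" for i
  proof -
    have "q (f i) (\<lambda>x. \<Sum>j\<in>I. d j * f j x) = q (\<lambda>x. \<Sum>j\<in>I. d j * f j x) (f i)"
      by (intro q_sym sum_scaled assms that)
    also have "\<dots> = (\<Sum>j\<in>I. d j * q (f j) (f i))"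
      by (rule q_sum_scaled[OF assms assms(2)[OF that]])
    also have "\<dots> = (\<Sum>j\<in>I. d j * q (f i) (f j))"
      by (intro sum.cong refl arg_cong2[where f = times] q_sym assms that)
    finally show ?thesis .
  qed
  moreover have "q (\<lambda>x. \<Sum>i\<in>I. c i * f i x) (\<lambda>x. \<Sum>i\<in>I. d i * f i x)
      = (\<Sum>i\<in>I. c i * q (f i) (\<lambda>x. \<Sum>i\<in>I. d i * f i x))"
    by (rule q_sum_scaled[OF assms sum_scaled[OF assms]])
  ultimately show ?thesis by (simp add: sum_distrib_left mult.assoc)
qed

lemma tendsto_q:
  assumes u: "\<And>n. u n \<in> V" and v: "\<And>n. v n \<in> V" and f: "f \<in> V" and g: "g \<in> V"
    and lu: "((\<lambda>n. qnorm q (\<lambda>x. u n x - f x)) \<longlongrightarrow> 0) F"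
    and lv: "((\<lambda>n. qnorm q (\<lambda>x. v n x - g x)) \<longlongrightarrow> 0) F"
  shows "((\<lambda>n. q (u n) (v n)) \<longlongrightarrow> q f g) F"
proof (rule Lim_transform2)
  define a where "a = (\<lambda>n. qnorm q (\<lambda>x. u n x - f x))"
  define b where "b = (\<lambda>n. qnorm q (\<lambda>x. v n x - g x))"
  show "((\<lambda>_. q f g) \<longlongrightarrow> q f g) F" by simp
  have bd: "norm (q f g - q (u n) (v n)) \<le> a n * b n + a n * qnorm q g + qnorm q f * b n" for n
  proof -
    have "q (u n) (v n) - q f g = q (\<lambda>x. u n x - f x) (\<lambda>x. v n x - g x)
        + q (\<lambda>x. u n x - f x) g + q f (\<lambda>x. v n x - g x)"
      by (simp add: u v f g q_rules)
    moreover have "\<bar>q (\<lambda>x. u n x - f x) (\<lambda>x. v n x - g x)\<bar> \<le> a n * b n"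
      unfolding a_def b_def by (intro cauchy_schwarz diff u v f g)
    moreover have "\<bar>q (\<lambda>x. u n x - f x) g\<bar> \<le> a n * qnorm q g"
      unfolding a_def by (intro cauchy_schwarz diff u f g)
    moreover have "\<bar>q f (\<lambda>x. v n x - g x)\<bar> \<le> qnorm q f * b n"
      unfolding b_def by (intro cauchy_schwarz diff v f g)
    ultimately show ?thesis by simp
  qed
  have "((\<lambda>n. a n * b n + a n * qnorm q g + qnorm q f * b n)
      \<longlongrightarrow> 0 * 0 + 0 * qnorm q g + qnorm q f * 0) F"
    using lu lv unfolding a_def b_def by (intro tendsto_intros)
  then show "((\<lambda>n. q f g - q (u n) (v n)) \<longlongrightarrow> 0) F"
    by (intro Lim_null_comparison[OF always_eventually[OF allI[OF bd]]]) simp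
qed

lemma tendsto_q_left:
  assumes "\<And>n. u n \<in> V" "f \<in> V" "g \<in> V" "((\<lambda>n. qnorm q (\<lambda>x. u n x - f x)) \<longlongrightarrow> 0) F"
  shows "((\<lambda>n. q (u n) g) \<longlongrightarrow> q f g) F"
  by (intro tendsto_q assms) (simp add: qnorm_def q_zero zero)

lemma tendsto_qnorm:
  assumes "\<And>n. u n \<in> V" "f \<in> V" "((\<lambda>n. qnorm q (\<lambda>x. u n x - f x)) \<longlongrightarrow> 0) F"
  shows "((\<lambda>n. qnorm q (u n)) \<longlongrightarrow> qnorm q f) F"
  unfolding qnorm_def[of q "u _"] qnorm_def[of q f]
  by (intro tendsto_real_sqrt tendsto_q assms)

section \<open>Cauchy sequences, almost minimal sequences and the Riesz representation
  theorem\<close>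

definition Cauchyq :: "(nat \<Rightarrow> 'a \<Rightarrow> real) \<Rightarrow> bool" where
  "Cauchyq u \<longleftrightarrow> (\<forall>e>0. \<exists>N. \<forall>m\<ge>N. \<forall>n\<ge>N. qnorm q (\<lambda>x. u m x - u n x) < e)"

lemma CauchyqI:
  assumes u: "\<And>n. u n \<in> V" and c: "c \<longlonglongrightarrow> 0"
    and le: "\<And>m n. n \<le> m \<Longrightarrow> q (\<lambda>x. u m x - u n x) (\<lambda>x. u m x - u n x) \<le> c n"
  shows "Cauchyq u"
  unfolding Cauchyq_def
proof (intro allI impI)
  fix e :: real assume e: "0 < e"
  then have "eventually (\<lambda>n. c n < e\<^sup>2) sequentially"
    using c order_tendstoD(2)[of c 0] by simp
  then obtain N where N: "\<And>n. n \<ge> N \<Longrightarrow> c n < e\<^sup>2" unfolding eventually_sequentially by blast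
  have *: "qnorm q (\<lambda>x. u m x - u n x) < e" if "n \<ge> N" "n \<le> m" for m n
    using le[OF that(2)] N[OF that(1)] e unfolding qnorm_def
    by (metis le_less_trans less_eq_real_def real_sqrt_abs real_sqrt_less_iff abs_of_pos)
  show "\<exists>N. \<forall>m\<ge>N. \<forall>n\<ge>N. qnorm q (\<lambda>x. u m x - u n x) < e"
  proof (intro exI allI impI)
    fix m n assume "N \<le> m" "N \<le> n"
    then show "qnorm q (\<lambda>x. u m x - u n x) < e"
      using *[of n m] *[of m n] qnorm_minus_commute[OF u[of m] u[of n]] by (cases "n \<le> m") auto
  qed
qed

lemma Cauchyq_dominated:
  assumes "Cauchyq u" "\<And>m n. qnorm q (\<lambda>x. v m x - v n x) \<le> qnorm q (\<lambda>x. u m x - u n x)"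
  shows "Cauchyq v"
  using assms unfolding Cauchyq_def by (meson order_le_less_trans)

lemma limit_Cauchyq:
  assumes u: "\<And>n. u n \<in> V" and f: "f \<in> V" and lim: "(\<lambda>n. qnorm q (\<lambda>x. u n x - f x)) \<longlonglongrightarrow> 0"
  shows "Cauchyq u"
  unfolding Cauchyq_def
proof (intro allI impI)
  fix e :: real assume e: "0 < e"
  obtain N where N: "\<And>n. N \<le> n \<Longrightarrow> norm (qnorm q (\<lambda>x. u n x - f x) - 0) < e / 2"
    using LIMSEQ_D[OF lim, of "e/2"] e by auto
  have "qnorm q (\<lambda>x. u m x - u n x) < e" if "N \<le> m" "N \<le> n" for m n
    using qnorm_triangle3[OF u[of m] f u[of n]] qnorm_minus_commute[OF f u[of n]] N[OF that(1)]
      N[OF that(2)] by simp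
  then show "\<exists>N. \<forall>m\<ge>N. \<forall>n\<ge>N. qnorm q (\<lambda>x. u m x - u n x) < e" by blast
qed

lemma approximating_sequence:
  assumes "\<And>e. 0 < e \<Longrightarrow> \<exists>g\<in>A. qnorm q (\<lambda>x. f x - g x) < e" and A: "A \<subseteq> V" and f: "f \<in> V"
  obtains u where "\<And>n. u n \<in> A" "(\<lambda>n. qnorm q (\<lambda>x. u n x - f x)) \<longlonglongrightarrow> 0"
proof -
  have "\<exists>g\<in>A. qnorm q (\<lambda>x. f x - g x) < 1 / Suc n" for n by (intro assms) simp
  then obtain u where u: "\<And>n. u n \<in> A" "\<And>n. qnorm q (\<lambda>x. f x - u n x) < 1 / Suc n" by metis
  have uV: "u n \<in> V" for n using u A by blast
  have "norm (qnorm q (\<lambda>x. u n x - f x)) \<le> 1 / Suc n" for n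
    using u(2)[of n] qnorm_minus_commute[OF f uV, of n] qnorm_nonneg[OF diff[OF uV f], of n] by simp
  then have "(\<lambda>n. qnorm q (\<lambda>x. u n x - f x)) \<longlonglongrightarrow> 0"
    by (intro Lim_null_comparison[OF _ LIMSEQ_Suc[OF lim_1_over_n]]) auto
  then show thesis using that u by blast
qed

lemma midpoints_subset: "S \<subseteq> V \<Longrightarrow> midpoints S \<subseteq> V"
proof
  fix f assume S: "S \<subseteq> V" and "f \<in> midpoints S"
  from this(2) show "f \<in> V"
    using S by (induction rule: midpoints.induct) (auto intro: add half)
qed

text \<open>Balls are convex, so a bound valid on a tail of a sequence is inherited by the midpoint
  hull of that tail. With \<open>h\<close> zero it bounds norms, with a limit as \<open>h\<close> it
  preserves convergence.\<close>

lemma qnorm_midpoints_le: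
  assumes "f \<in> midpoints S" "S \<subseteq> V" "h \<in> V" "\<And>g. g \<in> S \<Longrightarrow> qnorm q (\<lambda>x. g x - h x) \<le> e"
  shows "qnorm q (\<lambda>x. f x - h x) \<le> e"
  using assms
proof (induction rule: midpoints.induct)
  case (mid f g)
  have V: "f \<in> V" "g \<in> V" using mid midpoints_subset by auto
  have "qnorm q (\<lambda>x. (f x - h x) / 2 + (g x - h x) / 2)
      \<le> qnorm q (\<lambda>x. f x - h x) / 2 + qnorm q (\<lambda>x. g x - h x) / 2"
    using qnorm_triangle[of "\<lambda>x. (f x - h x) / 2" "\<lambda>x. (g x - h x) / 2"] V mid.prems(2)
      qnorm_scale[of "\<lambda>x. f x - h x" "1/2"] qnorm_scale[of "\<lambda>x. g x - h x" "1/2"]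
      half[of "\<lambda>x. f x - h x"] half[of "\<lambda>x. g x - h x"] diff by simp
  also have "\<dots> \<le> e" using mid by fastforce
  also have "(\<lambda>x. (f x - h x) / 2 + (g x - h x) / 2) = (\<lambda>x. f x / 2 + g x / 2 - h x)"
    by (auto simp: field_simps)
  finally show ?case .
qed blast

text \<open>
  Mazur's lemma without weak topologies: elements of almost minimal norm in the midpoint hulls of
  the tails form a Cauchy sequence by the parallelogram law.
\<close>

lemma Mazur:
  assumes u: "\<And>n. u n \<in> V" and bd: "\<And>n. q (u n) (u n) \<le> C"
  obtains v where "\<And>n. v n \<in> midpoints (u ` {n..})" "Cauchyq v"
proof -
  define K where "K n = midpoints (u ` {n..})" for n
  define d where "d n = (INF v\<in>K n. q v v)" for n
  have KV: "K n \<subseteq> V" for n unfolding K_def using u by (intro midpoints_subset) auto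
  have uK: "u n \<in> K n" for n unfolding K_def by (auto intro: midpoints.base)
  have bb: "bdd_below ((\<lambda>v. q v v) ` K n)" for n
    using KV q_nonneg by (intro bdd_belowI[of _ 0]) auto
  have dle: "d n \<le> q v v" if "v \<in> K n" for n v
    unfolding d_def by (rule cINF_lower[OF bb that])
  have Kmono: "K m \<subseteq> K n" if "n \<le> m" for n m
    unfolding K_def using that by (auto elim!: midpoints_mono)
  have dmono: "incseq d"
    unfolding incseq_def d_def
    by (intro allI impI cINF_superset_mono bb Kmono) (use uK in auto)
  have dC: "d n \<le> C" for n using dle[OF uK] bd order_trans by blast
  obtain D where D: "d \<longlonglongrightarrow> D" "\<And>i. d i \<le> D"
    using incseq_convergent[OF dmono] dC by blast
  have "\<exists>v\<in>K n. q v v < d n + 1 / Suc n" for n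
  proof -
    have ne: "K n \<noteq> {}" using uK by auto
    have "(INF v\<in>K n. q v v) < d n + 1 / Suc n" unfolding d_def by simp
    then show ?thesis by (simp only: cINF_less_iff[OF ne bb])
  qed
  then obtain v where v: "\<And>n. v n \<in> K n" "\<And>n. q (v n) (v n) < d n + 1 / Suc n"
    by metis
  have vV: "v n \<in> V" for n using v KV by blast
  \<comment> \<open>The midpoint of \<open>v m\<close> and \<open>v n\<close> lies in
    \<open>K n\<close>, so its \<open>q\<close>-value is at least \<open>d n\<close>. As
    \<open>d\<close> increases to \<open>D\<close>, the parallelogram law leaves the gap
    \<open>D - d n\<close> and the slack of the two choices.\<close>
  have "Cauchyq v"
  proof (rule CauchyqI[OF vV, of "\<lambda>n. 2 * (D - d n) + 4 / Suc n"])
    have "(\<lambda>n. 2 * (D - d n) + 4 * (1 / Suc n)) \<longlonglongrightarrow> 2 * (D - D) + 4 * 0"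
      by (intro tendsto_intros D LIMSEQ_Suc[OF lim_1_over_n])
    then show "(\<lambda>n. 2 * (D - d n) + 4 / Suc n) \<longlonglongrightarrow> 0" by simp
    fix m n :: nat assume nm: "n \<le> m"
    have "(\<lambda>x. v m x / 2 + v n x / 2) \<in> K n"
      using v Kmono[OF nm] unfolding K_def by (intro midpoints.mid) auto
    from dle[OF this] have "q (\<lambda>x. v m x - v n x) (\<lambda>x. v m x - v n x)
        \<le> 2 * (d m + 1 / Suc m) + 2 * (d n + 1 / Suc n) - 4 * d n"
      using v(2)[of n] v(2)[of m] parallelogram[OF vV vV, of m n] by simp
    also have "\<dots> \<le> 2 * (D - d n) + 4 / Suc n"
    proof -
      have "1 / real (Suc m) \<le> 1 / real (Suc n)" using nm by (simp add: field_simps)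
      then have "2 * (d m + 1 / Suc m) + 2 * (d n + 1 / Suc n) - 4 * d n
          \<le> 2 * (D + 1 / Suc n) + 2 * (d n + 1 / Suc n) - 4 * d n"
        using D(2)[of m] by (intro diff_right_mono add_mono mult_left_mono) auto
      also have "\<dots> = 2 * (D - d n) + 4 / Suc n" by simp
      finally show ?thesis .
    qed
    finally show "q (\<lambda>x. v m x - v n x) (\<lambda>x. v m x - v n x) \<le> 2 * (D - d n) + 4 / Suc n" .
  qed
  then show thesis using that v(1) unfolding K_def by blast
qed

text \<open>The representing element minimizes \<open>q v v - 2 * l v\<close>. A minimizing sequence
  is Cauchy by the parallelogram law, the linear part dropping out at midpoints; near-minimality
  tested along \<open>h\<close> then bounds \<open>q (v n) h - l h\<close>. Completeness enters as a
  hypothesis, to be supplied by closedness of a form.\<close>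

lemma Riesz:
  assumes complete: "\<And>u. (\<And>n. u n \<in> V) \<Longrightarrow> Cauchyq u
      \<Longrightarrow> \<exists>f\<in>V. (\<lambda>n. qnorm q (\<lambda>x. u n x - f x)) \<longlonglongrightarrow> 0"
    and l_add: "\<And>f g. f \<in> V \<Longrightarrow> g \<in> V \<Longrightarrow> l (\<lambda>x. f x + g x) = l f + l g"
    and l_scale: "\<And>c f. f \<in> V \<Longrightarrow> l (\<lambda>x. c * f x) = c * l f"
    and l_bd: "\<And>f. f \<in> V \<Longrightarrow> \<bar>l f\<bar> \<le> C * qnorm q f"
  shows "\<exists>u\<in>V. \<forall>h\<in>V. q u h = l h"
proof -
  define J where "J v = q v v - 2 * l v" for v
  define I where "I = (INF v\<in>V. J v)"
  have bb: "bdd_below (J ` V)"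
  proof (rule bdd_belowI[of _ "- C\<^sup>2"])
    fix y assume "y \<in> J ` V"
    then obtain v where v: "v \<in> V" "y = J v" by blast
    have "0 \<le> (qnorm q v - C)\<^sup>2" by simp
    then show "- C\<^sup>2 \<le> y"
      using l_bd[OF v(1)] v(2) qnorm_sq[OF v(1)] abs_le_D1
      by (fastforce simp: J_def power2_diff algebra_simps)
  qed
  have Ile: "I \<le> J v" if "v \<in> V" for v unfolding I_def by (rule cINF_lower[OF bb that])
  have "\<exists>v\<in>V. J v < I + 1 / Suc n" for n
  proof -
    have "(INF v\<in>V. J v) < I + 1 / Suc n" unfolding I_def by simp
    moreover have ne: "V \<noteq> {}" using zero by auto
    ultimately show ?thesis by (simp only: cINF_less_iff[OF ne bb])
  qed
  then obtain v where v: "\<And>n. v n \<in> V" "\<And>n. J (v n) < I + 1 / Suc n" by metis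
  have "Cauchyq v"
  proof (rule CauchyqI[OF v(1), of "\<lambda>n. 4 * (1 / Suc n)"])
    have "(\<lambda>n. 4 * (1 / Suc n)) \<longlonglongrightarrow> 4 * 0"
      by (intro tendsto_intros LIMSEQ_Suc[OF lim_1_over_n])
    then show "(\<lambda>n. 4 * (1 / real (Suc n))) \<longlonglongrightarrow> 0" by simp
    fix m n :: nat assume nm: "n \<le> m"
    let ?w = "\<lambda>x. v m x / 2 + v n x / 2"
    have "I \<le> J ?w" by (intro Ile add half v)
    moreover have "l ?w = l (v m) / 2 + l (v n) / 2"
      using l_add[OF half[OF v(1)] half[OF v(1)], of m n] l_scale[OF v(1)[of m], of "1/2"]
        l_scale[OF v(1)[of n], of "1/2"] by simp
    moreover have "1 / real (Suc m) \<le> 1 / real (Suc n)" using nm by (simp add: field_simps)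
    ultimately show "q (\<lambda>x. v m x - v n x) (\<lambda>x. v m x - v n x) \<le> 4 * (1 / Suc n)"
      using v(2)[of n] v(2)[of m] parallelogram[OF v(1) v(1), of m n] by (simp add: J_def)
  qed
  then obtain u where u: "u \<in> V" "(\<lambda>n. qnorm q (\<lambda>x. v n x - u x)) \<longlonglongrightarrow> 0"
    using complete[of v] v(1) by blast
  have "q u h = l h" if h: "h \<in> V" for h
  proof -
    have *: "(q (v n) h - l h)\<^sup>2 \<le> (1 / Suc n) * (q h h + 1)" for n
    proof -
      define b where "b = q (v n) h - l h"
      \<comment> \<open>Minimizer in \<open>t\<close> of the quadratic majorant with
        \<open>q h h + 1\<close> in place of \<open>q h h\<close>; the added 1 keeps the denominator
        positive when \<open>q h h = 0\<close>.\<close>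
      define t where "t = - b / (q h h + 1)"
      have pos: "q h h + 1 > 0" using q_nonneg[OF h] by simp
      have "I \<le> J (\<lambda>x. v n x + t * h x)" by (intro Ile add scale v h)
      also have "\<dots> = J (v n) + 2 * t * b + t\<^sup>2 * q h h"
        using l_add[OF v(1) scale[OF h]] l_scale[OF h]
        by (simp add: J_def b_def q_add_sq v(1) scale h q_scale q_scale_right power2_eq_square
              algebra_simps)
      also have "\<dots> \<le> J (v n) + 2 * t * b + t\<^sup>2 * (q h h + 1)" by (simp add: mult_left_mono)
      also have "\<dots> = J (v n) - b\<^sup>2 / (q h h + 1)"
      proof -
        have "2 * (- b / c) * b + (- b / c)\<^sup>2 * c = - (b\<^sup>2 / c)" if "c > 0" for c
          using that by (simp add: field_simps power2_eq_square)
        from this[OF pos] show ?thesis unfolding t_def by simp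
      qed
      finally have "b\<^sup>2 / (q h h + 1) \<le> 1 / Suc n" using v(2)[of n] by simp
      then show ?thesis using pos unfolding b_def by (simp add: field_simps)
    qed
    have "(\<lambda>n. (q (v n) h - l h)\<^sup>2) \<longlonglongrightarrow> (q u h - l h)\<^sup>2"
      by (intro tendsto_intros tendsto_q v u h) (simp add: qnorm_def q_zero zero)
    moreover have "(\<lambda>n. (1 / Suc n) * (q h h + 1)) \<longlonglongrightarrow> 0 * (q h h + 1)"
      by (intro tendsto_intros LIMSEQ_Suc[OF lim_1_over_n])
    ultimately have "(q u h - l h)\<^sup>2 \<le> 0 * (q h h + 1)"
      using * by (intro LIMSEQ_le) auto
    then show ?thesis by simp
  qed
  then show ?thesis using u by blast
qed

end

section \<open>The space of square-integrable functions\<close>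

lemma L2_measurable [measurable_dest]: "f \<in> L2 M \<Longrightarrow> f \<in> borel_measurable M"
  by (simp add: L2_def)

lemma L2_integrable_sq: "f \<in> L2 M \<Longrightarrow> integrable M (\<lambda>x. (f x)\<^sup>2)"
  by (simp add: L2_def)

lemma L2_dominated:
  assumes g: "g \<in> L2 M" and f[measurable]: "f \<in> borel_measurable M"
    and le: "AE x in M. \<bar>f x\<bar> \<le> C * \<bar>g x\<bar>"
  shows "f \<in> L2 M" "l2_inner M f f \<le> C\<^sup>2 * l2_inner M g g"
proof -
  have le2: "AE x in M. (f x)\<^sup>2 \<le> C\<^sup>2 * (g x)\<^sup>2"
    using le
  proof eventually_elim
    case (elim x)
    then have "\<bar>f x\<bar>\<^sup>2 \<le> (C * \<bar>g x\<bar>)\<^sup>2" by (intro power_mono) auto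
    then show ?case by (simp add: power_mult_distrib)
  qed
  have ig: "integrable M (\<lambda>x. C\<^sup>2 * (g x)\<^sup>2)" using L2_integrable_sq[OF g] by simp
  have i: "integrable M (\<lambda>x. (f x)\<^sup>2)"
    by (rule Bochner_Integration.integrable_bound[OF ig]) (use le2 in auto)
  then show "f \<in> L2 M" by (simp add: L2_def)
  have "(\<integral>x. (f x)\<^sup>2 \<partial>M) \<le> (\<integral>x. C\<^sup>2 * (g x)\<^sup>2 \<partial>M)"
    by (rule integral_mono_AE[OF i ig le2])
  then show "l2_inner M f f \<le> C\<^sup>2 * l2_inner M g g"
    by (simp add: l2_inner_def power2_eq_square[symmetric])
qed

lemma L2_mult_integrable:
  assumes "f \<in> L2 M" "g \<in> L2 M"
  shows "integrable M (\<lambda>x. f x * g x)"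
proof (rule Bochner_Integration.integrable_bound)
  show "integrable M (\<lambda>x. (f x)\<^sup>2 + (g x)\<^sup>2)" using assms by (auto simp: L2_def)
  show "(\<lambda>x. f x * g x) \<in> borel_measurable M" using assms by (auto simp: L2_def)
  show "AE x in M. norm (f x * g x) \<le> norm ((f x)\<^sup>2 + (g x)\<^sup>2)"
  proof (intro AE_I2)
    fix x
    have "2 * (\<bar>f x\<bar> * \<bar>g x\<bar>) \<le> \<bar>f x\<bar>\<^sup>2 + \<bar>g x\<bar>\<^sup>2" using sum_squares_bound[of "\<bar>f x\<bar>" "\<bar>g x\<bar>"] by simp
    moreover have "0 \<le> \<bar>f x\<bar> * \<bar>g x\<bar>" by simp
    ultimately have "\<bar>f x\<bar> * \<bar>g x\<bar> \<le> \<bar>f x\<bar>\<^sup>2 + \<bar>g x\<bar>\<^sup>2" by linarith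
    then show "norm (f x * g x) \<le> norm ((f x)\<^sup>2 + (g x)\<^sup>2)" by (simp add: abs_mult)
  qed
qed

lemma L2_add:
  assumes "f \<in> L2 M" "g \<in> L2 M"
  shows "(\<lambda>x. f x + g x) \<in> L2 M"
  using assms L2_mult_integrable[OF assms] by (auto simp: L2_def power2_sum mult.assoc)

lemma L2_scale: "f \<in> L2 M \<Longrightarrow> (\<lambda>x. c * f x) \<in> L2 M"
  by (auto simp: L2_def power_mult_distrib)

interpretation L2: semi_inner "L2 M" "l2_inner M" for M
proof unfold_locales
  fix f g h :: "'a \<Rightarrow> real" and c :: real
  show "(\<lambda>_. 0) \<in> L2 M" by (simp add: L2_def)
  assume f: "f \<in> L2 M"
  then show "(\<lambda>x. c * f x) \<in> L2 M" by (rule L2_scale)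
  show "0 \<le> l2_inner M f f" by (simp add: l2_inner_def)
  assume g: "g \<in> L2 M"
  show "(\<lambda>x. f x + g x) \<in> L2 M" by (rule L2_add[OF f g])
  show "l2_inner M (\<lambda>x. c * f x) g = c * l2_inner M f g" by (simp add: l2_inner_def mult.assoc)
  show "l2_inner M f g = l2_inner M g f" by (simp add: l2_inner_def mult.commute)
  assume h: "h \<in> L2 M"
  show "l2_inner M (\<lambda>x. f x + g x) h = l2_inner M f h + l2_inner M g h"
    using L2_mult_integrable[OF f h] L2_mult_integrable[OF g h]
    by (simp add: l2_inner_def distrib_right)
qed

lemma l2_norm_qnorm: "l2_norm M = qnorm (l2_inner M)"
  by (auto simp: l2_norm_def qnorm_def)

lemma l2_norm_sq: "(l2_norm M f)\<^sup>2 = l2_inner M f f"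
  by (simp add: l2_norm_def l2_inner_def)

lemma l2_norm_nonneg: "0 \<le> l2_norm M f"
  by (simp add: l2_norm_def l2_inner_def)

lemma l2_inner_cong_AE:
  assumes "f \<in> borel_measurable M" "f' \<in> borel_measurable M"
    "g \<in> borel_measurable M" "g' \<in> borel_measurable M"
    "AE x in M. f x = f' x" "AE x in M. g x = g' x"
  shows "l2_inner M f g = l2_inner M f' g'"
  unfolding l2_inner_def using assms by (intro integral_cong_AE) auto

lemma l2_norm_cong_AE:
  assumes "f \<in> borel_measurable M" "f' \<in> borel_measurable M" "AE x in M. f x = f' x"
  shows "l2_norm M f = l2_norm M f'"
  unfolding l2_norm_def using l2_inner_cong_AE[OF assms(1,2,1,2,3,3)] by simp

lemma l2_norm_mono_AE:
  assumes g: "g \<in> L2 M" and f: "f \<in> borel_measurable M" and le: "AE x in M. \<bar>f x\<bar> \<le> \<bar>g x\<bar>"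
  shows "l2_norm M f \<le> l2_norm M g"
  using L2_dominated(2)[OF g f, of 1] le by (simp add: l2_norm_def)

lemma l2_inner_eq_0_AE:
  assumes f: "f \<in> L2 M" and 0: "l2_inner M f f = 0"
  shows "AE x in M. f x = 0"
proof -
  have "AE x in M. f x * f x = 0"
    using 0 integral_nonneg_eq_0_iff_AE[OF L2_mult_integrable[OF f f]] by (simp add: l2_inner_def)
  then show ?thesis by auto
qed

lemma L2_limit_unique:
  assumes u: "\<And>n. u n \<in> L2 M" and f: "f \<in> L2 M" and g: "g \<in> L2 M"
    and lf: "(\<lambda>n. l2_norm M (\<lambda>x. u n x - f x)) \<longlonglongrightarrow> 0"
    and lg: "(\<lambda>n. l2_norm M (\<lambda>x. u n x - g x)) \<longlonglongrightarrow> 0"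
  shows "AE x in M. f x = g x"
proof -
  have "l2_norm M (\<lambda>x. f x - g x)
      \<le> l2_norm M (\<lambda>x. u n x - f x) + l2_norm M (\<lambda>x. u n x - g x)" for n
    using L2.qnorm_triangle3[OF f u g, of n] L2.qnorm_minus_commute[OF f u, of n]
    by (simp add: l2_norm_qnorm)
  then have "l2_norm M (\<lambda>x. f x - g x) \<le> 0 + 0"
    by (intro LIMSEQ_le_const[OF tendsto_add[OF lf lg]]) auto
  then have "l2_norm M (\<lambda>x. f x - g x) = 0" using l2_norm_nonneg[of M] by (metis add_0 antisym)
  then have "l2_inner M (\<lambda>x. f x - g x) (\<lambda>x. f x - g x) = 0" by (simp add: l2_norm_def)
  from l2_inner_eq_0_AE[OF L2.diff[OF f g] this] show ?thesis by simp
qed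

text \<open>The positive part of \<open>g - f\<close> is dominated by the absolute value of
  \<open>u n - f\<close>, which puts it into \<open>L2\<close> even if \<open>g\<close> is merely
  measurable, and shows that its norm is zero.\<close>

lemma L2_limit_ge:
  assumes u: "\<And>n. u n \<in> L2 M" and f: "f \<in> L2 M" and g: "g \<in> borel_measurable M"
    and lf: "(\<lambda>n. l2_norm M (\<lambda>x. u n x - f x)) \<longlonglongrightarrow> 0"
    and ge: "\<And>n. N \<le> n \<Longrightarrow> AE x in M. g x \<le> u n x"
  shows "AE x in M. g x \<le> f x"
proof -
  note [measurable] = g L2_measurable[OF f] L2_measurable[OF u]
  define w where "w x = max 0 (g x - f x)" for x
  have wm: "w \<in> borel_measurable M" unfolding w_def by measurable
  have wle: "AE x in M. \<bar>w x\<bar> \<le> \<bar>u n x - f x\<bar>" if "N \<le> n" for n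
    using ge[OF that] by eventually_elim (auto simp: w_def)
  have wL: "w \<in> L2 M"
    by (rule L2_dominated(1)[OF L2.diff[OF u[of N] f] wm, of 1]) (use wle[of N] in simp)
  have "l2_norm M w \<le> l2_norm M (\<lambda>x. u n x - f x)" if "N \<le> n" for n
    by (rule l2_norm_mono_AE[OF L2.diff[OF u f] wm wle[OF that]])
  then have "l2_norm M w \<le> 0" by (intro LIMSEQ_le_const[OF lf]) auto
  then have "l2_inner M w w = 0" using l2_norm_nonneg[of M w] by (simp add: l2_norm_def)
  from l2_inner_eq_0_AE[OF wL this] show ?thesis
    by eventually_elim (auto simp: w_def max_def split: if_splits)
qed

lemma L2_dominated_convergence:
  assumes f: "f \<in> borel_measurable M" and u: "\<And>n. u n \<in> borel_measurable M" and w: "w \<in> L2 M"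
    and le: "\<And>n x. \<bar>u n x - f x\<bar> \<le> \<bar>w x\<bar>" and lim: "\<And>x. (\<lambda>n. u n x) \<longlonglongrightarrow> f x"
  shows "(\<lambda>n. l2_norm M (\<lambda>x. u n x - f x)) \<longlonglongrightarrow> 0"
proof -
  note [measurable] = f u
  have "(\<lambda>n. \<integral>x. (u n x - f x) * (u n x - f x) \<partial>M) \<longlonglongrightarrow> (\<integral>x. 0 \<partial>M)"
  proof (rule integral_dominated_convergence[where w = "\<lambda>x. (w x)\<^sup>2"])
    show "integrable M (\<lambda>x. (w x)\<^sup>2)" by (rule L2_integrable_sq[OF w])
    show "AE x in M. (\<lambda>n. (u n x - f x) * (u n x - f x)) \<longlonglongrightarrow> 0"
    proof (intro AE_I2)
      fix x
      have "(\<lambda>n. (u n x - f x) * (u n x - f x)) \<longlonglongrightarrow> (f x - f x) * (f x - f x)"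
        by (intro tendsto_intros lim)
      then show "(\<lambda>n. (u n x - f x) * (u n x - f x)) \<longlonglongrightarrow> 0" by simp
    qed
    fix n
    have "\<bar>u n x - f x\<bar> * \<bar>u n x - f x\<bar> \<le> \<bar>w x\<bar> * \<bar>w x\<bar>" for x
      using le[of n x] by (intro mult_mono) auto
    then show "AE x in M. norm ((u n x - f x) * (u n x - f x)) \<le> (w x)\<^sup>2"
      by (auto simp: abs_mult power2_eq_square)
  qed auto
  then have "(\<lambda>n. sqrt (\<integral>x. (u n x - f x) * (u n x - f x) \<partial>M)) \<longlonglongrightarrow> sqrt 0"
    by (intro tendsto_real_sqrt) simp
  then show ?thesis by (simp add: l2_norm_def l2_inner_def)
qed

lemma nn_integral_L2: "f \<in> L2 M \<Longrightarrow> (\<integral>\<^sup>+x. ennreal ((f x)\<^sup>2) \<partial>M) = ennreal ((l2_norm M f)\<^sup>2)"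
  unfolding l2_norm_sq l2_inner_def power2_eq_square[symmetric]
  by (intro nn_integral_eq_integral L2_integrable_sq) auto

text \<open>A subsequence with geometrically small increments converges a.e.; Fatou's lemma turns
  the pointwise limit into a norm limit of the subsequence, and the Cauchy property carries this to
  the whole sequence.\<close>

lemma Riesz_Fischer:
  assumes u: "\<And>n. u n \<in> L2 M" and cau: "L2.Cauchyq M u"
  obtains f where "f \<in> L2 M" "(\<lambda>n. l2_norm M (\<lambda>x. u n x - f x)) \<longlonglongrightarrow> 0"
proof -
  have "\<exists>N. \<forall>m\<ge>N. \<forall>n\<ge>N. l2_norm M (\<lambda>x. u m x - u n x) < (1/4) ^ k" for k :: nat
    using cau unfolding L2.Cauchyq_def l2_norm_qnorm by simp
  then obtain N where N: "\<And>k m n. N k \<le> m \<Longrightarrow> N k \<le> n \<Longrightarrow> l2_norm M (\<lambda>x. u m x - u n x) < (1/4) ^ k"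
    by metis
  \<comment> \<open>\<open>N\<close> need not be monotone; its partial sums are, and they dominate
    every earlier \<open>N\<close>.\<close>
  define r where "r k = (\<Sum>j\<le>k. N j)" for k
  have rN: "N k \<le> r j" if "k \<le> j" for k j
    unfolding r_def using that by (intro member_le_sum) auto
  define v where "v k = u (r k)" for k
  have vL: "v k \<in> L2 M" for k by (simp add: v_def u)
  note [measurable] = L2_measurable[OF vL]
  have vd: "l2_norm M (\<lambda>x. v i x - v j x) < (1/4) ^ k" if "k \<le> i" "k \<le> j" for i j k
    unfolding v_def by (intro N rN that)
  have "(\<integral>\<^sup>+x. (\<Sum>k. ennreal (4 ^ k * (v (Suc k) x - v k x)\<^sup>2)) \<partial>M)
      = (\<Sum>k. \<integral>\<^sup>+x. ennreal (4 ^ k * (v (Suc k) x - v k x)\<^sup>2) \<partial>M)"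
    by (intro nn_integral_suminf) measurable
  \<comment> \<open>The weight \<open>4 ^ k\<close> balances two needs: the squared increments,
    below \<open>(1/4) ^ (2 * k)\<close>, stay summable, and boundedness of the weighted squares
    bounds the increments by a multiple of \<open>(1/2) ^ k\<close>.\<close>
  also have "\<dots> \<le> (\<Sum>k. ennreal ((1/4) ^ k))"
  proof (intro suminf_le)
    fix k :: nat
    have "(\<integral>\<^sup>+x. ennreal (4 ^ k * (v (Suc k) x - v k x)\<^sup>2) \<partial>M)
        = ennreal (4 ^ k) * (\<integral>\<^sup>+x. ennreal ((v (Suc k) x - v k x)\<^sup>2) \<partial>M)"
      by (simp add: ennreal_mult nn_integral_cmult)
    also have "\<dots> = ennreal (4 ^ k * (l2_norm M (\<lambda>x. v (Suc k) x - v k x))\<^sup>2)"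
      using nn_integral_L2[OF L2.diff[OF vL vL]] by (simp add: ennreal_mult)
    also have "\<dots> \<le> ennreal (4 ^ k * ((1/4) ^ k)\<^sup>2)"
      using vd[of k "Suc k" k] l2_norm_nonneg[of M]
      by (intro ennreal_leI mult_left_mono power_mono) (auto intro: less_imp_le)
    also have "4 ^ k * ((1/4) ^ k)\<^sup>2 = ((1/4) ^ k :: real)"
      by (simp add: power2_eq_square power_divide)
    finally show "(\<integral>\<^sup>+x. ennreal (4 ^ k * (v (Suc k) x - v k x)\<^sup>2) \<partial>M) \<le> ennreal ((1/4) ^ k)" .
  qed auto
  also have "\<dots> < \<infinity>"
    by (subst suminf_ennreal2) (auto simp: summable_geometric)
  finally have "AE x in M. (\<Sum>k. ennreal (4 ^ k * (v (Suc k) x - v k x)\<^sup>2)) \<noteq> \<infinity>"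
    by (intro nn_integral_noteq_infinite) auto
  then have conv: "AE x in M. convergent (\<lambda>k. v k x)"
  proof eventually_elim
    case (elim x)
    then have "summable (\<lambda>k. 4 ^ k * (v (Suc k) x - v k x)\<^sup>2)"
      by (intro summable_suminf_not_top) (auto simp: top_unique)
    then obtain C where "\<And>k. \<bar>4 ^ k * (v (Suc k) x - v k x)\<^sup>2\<bar> \<le> C"
      using summable_imp_bounded[of "\<lambda>k. 4 ^ k * (v (Suc k) x - v k x)\<^sup>2"]
      by (auto simp: bounded_iff)
    then have C: "4 ^ k * (v (Suc k) x - v k x)\<^sup>2 \<le> C" for k by fastforce
    have "norm (v (Suc k) x - v k x) \<le> sqrt C * (1/2) ^ k" for k
    proof -
      have "sqrt (4 ^ k * (v (Suc k) x - v k x)\<^sup>2) \<le> sqrt C" by (intro real_sqrt_le_mono C)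
      moreover have "sqrt (4 ^ k) = (2::real) ^ k"
        by (metis real_sqrt_four real_sqrt_power)
      ultimately show ?thesis by (simp add: real_sqrt_mult field_simps)
    qed
    then have "summable (\<lambda>k. v (Suc k) x - v k x)"
      by (rule summable_comparison_test'[rotated])
        (auto intro: summable_mult summable_geometric)
    then have "convergent (\<lambda>n. \<Sum>k<n. v (Suc k) x - v k x)" by (simp add: summable_iff_convergent)
    then have "convergent (\<lambda>n. v n x - v 0 x)"
      by (simp add: sum_lessThan_telescope[of "\<lambda>k. v k x"])
    then have "convergent (\<lambda>n. v n x - v 0 x + v 0 x)" by (intro convergent_add convergent_const)
    then show ?case by simp
  qed
  define f where "f x = lim (\<lambda>k. v k x)" for x
  have fm[measurable]: "f \<in> borel_measurable M"
    unfolding f_def by (rule borel_measurable_lim_metric) simp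
  have lim: "AE x in M. (\<lambda>k. v k x) \<longlonglongrightarrow> f x"
    using conv by eventually_elim (simp add: f_def convergent_LIMSEQ_iff)
  have fat: "(\<integral>\<^sup>+x. ennreal ((f x - v k x)\<^sup>2) \<partial>M) \<le> ennreal (((1/4) ^ k)\<^sup>2)" for k
  proof -
    have "(\<integral>\<^sup>+x. ennreal ((f x - v k x)\<^sup>2) \<partial>M)
        = (\<integral>\<^sup>+x. liminf (\<lambda>j. ennreal ((v j x - v k x)\<^sup>2)) \<partial>M)"
    proof (intro nn_integral_cong_AE)
      show "AE x in M. ennreal ((f x - v k x)\<^sup>2) = liminf (\<lambda>j. ennreal ((v j x - v k x)\<^sup>2))"
        using lim
      proof eventually_elim
        case (elim x)
        have "(\<lambda>j. ennreal ((v j x - v k x)\<^sup>2)) \<longlonglongrightarrow> ennreal ((f x - v k x)\<^sup>2)"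
          by (intro tendsto_ennrealI tendsto_intros elim)
        then show ?case using lim_imp_Liminf[OF sequentially_bot] by metis
      qed
    qed
    also have "\<dots> \<le> liminf (\<lambda>j. \<integral>\<^sup>+x. ennreal ((v j x - v k x)\<^sup>2) \<partial>M)"
      by (intro nn_integral_liminf) measurable
    also have "\<dots> \<le> ennreal (((1/4) ^ k)\<^sup>2)"
    proof (intro Liminf_le)
      show "\<forall>\<^sub>F j in sequentially. (\<integral>\<^sup>+x. ennreal ((v j x - v k x)\<^sup>2) \<partial>M) \<le> ennreal (((1/4) ^ k)\<^sup>2)"
        using eventually_ge_at_top[of k]
      proof eventually_elim
        case (elim j)
        then show ?case
          using nn_integral_L2[OF L2.diff[OF vL vL], of j k] vd[of k j k] l2_norm_nonneg[of M]
          by (auto intro!: ennreal_leI power_mono intro: less_imp_le)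
      qed
    qed auto
    finally show ?thesis .
  qed
  have fvL: "(\<lambda>x. f x - v k x) \<in> L2 M" for k
  proof -
    have "(\<integral>\<^sup>+x. ennreal ((f x - v k x)\<^sup>2) \<partial>M) < \<infinity>"
      using fat[of k] le_less_trans by force
    then have "integrable M (\<lambda>x. (f x - v k x)\<^sup>2)"
      by (intro integrableI_nonneg) auto
    then show ?thesis by (simp add: L2_def)
  qed
  have fL: "f \<in> L2 M" using L2_add[OF fvL vL, of 0 0] by simp
  have fv: "l2_norm M (\<lambda>x. f x - v k x) \<le> (1/4) ^ k" for k
  proof -
    have "(l2_norm M (\<lambda>x. f x - v k x))\<^sup>2 \<le> ((1/4) ^ k)\<^sup>2"
      using fat[of k] nn_integral_L2[OF fvL, of k] by simp
    then show ?thesis by (rule power2_le_imp_le) simp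
  qed
  have "(\<lambda>n. l2_norm M (\<lambda>x. u n x - f x)) \<longlonglongrightarrow> 0"
  proof (rule LIMSEQ_I)
    fix e :: real assume "0 < e"
    then obtain k where k: "(1/4::real) ^ k < e / 2"
      using real_arch_pow_inv[of "e/2" "1/4"] by auto
    have "l2_norm M (\<lambda>x. u n x - f x) < e" if "N k \<le> n" for n
    proof -
      have "l2_norm M (\<lambda>x. u n x - f x)
          \<le> l2_norm M (\<lambda>x. u n x - v k x) + l2_norm M (\<lambda>x. f x - v k x)"
        using L2.qnorm_triangle3[OF u vL fL, of n k] L2.qnorm_minus_commute[OF vL fL, of k]
        by (simp add: l2_norm_qnorm)
      then show ?thesis using N[OF that rN[of k k]] fv[of k] k by (simp add: v_def)
    qed
    then show "\<exists>no. \<forall>n\<ge>no. norm (l2_norm M (\<lambda>x. u n x - f x) - 0) < e"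
      using l2_norm_nonneg[of M] by auto
  qed
  then show thesis using that fL by blast
qed

section \<open>Closed forms and resolvents\<close>

text \<open>The shift \<open>c\<close> is 1 for the graph norm and \<open>n + 1\<close> for the
  equation of the resolvent.\<close>

definition graph_inner ::
    "'a measure \<Rightarrow> 'a form \<Rightarrow> real \<Rightarrow> ('a \<Rightarrow> real) \<Rightarrow> ('a \<Rightarrow> real) \<Rightarrow> real" where
  "graph_inner M a c f g = fval a f g + c * l2_inner M f g"

lemma graph_norm_qnorm: "graph_norm M a = qnorm (graph_inner M a 1)"
  by (auto simp: graph_norm_def qnorm_def graph_inner_def l2_norm_sq)

text \<open>\<open>H\<close> is kept apart from \<open>L2 M\<close> because the Dirichlet form lives
  on \<open>L2_on M \<Omega>\<close>, while the given form, the relaxation and \<open>form_r\<close>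
  live on \<open>L2 M\<close>.\<close>

locale closed_L2_form =
  fixes M :: "'a measure" and H :: "('a \<Rightarrow> real) set" and a :: "'a form"
  assumes closed: "closed_form M H a" and H_L2: "H \<subseteq> L2 M"
begin

lemma positive: "positive_form M H a"
  using closed by (simp add: closed_form_def)

lemma dom_H: "f \<in> fdom a \<Longrightarrow> f \<in> H"
  using positive by (auto simp: positive_form_def)

lemma dom_L2: "f \<in> fdom a \<Longrightarrow> f \<in> L2 M"
  using dom_H H_L2 by auto

lemma dom_cong:
  assumes "f \<in> fdom a" "g \<in> borel_measurable M" "AE x in M. f x = g x"
  shows "g \<in> fdom a"
  using positive assms unfolding positive_form_def by blast

sublocale E: semi_inner "fdom a" "fval a"
  by unfold_locales (use positive in \<open>auto simp: positive_form_def\<close>)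

lemma graph_semi_inner: "0 \<le> c \<Longrightarrow> semi_inner (fdom a) (graph_inner M a c)"
  by unfold_locales
    (auto simp: graph_inner_def dom_L2 E.q_rules L2.q_rules algebra_simps E.q_nonneg L2.q_nonneg
      E.q_sym intro: L2.q_sym)

sublocale G: semi_inner "fdom a" "graph_inner M a 1"
  by (rule graph_semi_inner) simp

text \<open>\<open>positive_form\<close> states a.e. invariance for the first argument; symmetry
  carries it to the second.\<close>

lemma fval_cong:
  assumes f: "f \<in> fdom a" "f' \<in> borel_measurable M" "AE x in M. f x = f' x"
    and g: "g \<in> fdom a" "g' \<in> borel_measurable M" "AE x in M. g x = g' x"
  shows "fval a f g = fval a f' g'"
proof -
  have "fval a f g = fval a f' g"
    using positive f g unfolding positive_form_def by blast
  also have "\<dots> = fval a g f'" by (intro E.q_sym dom_cong[OF f] g)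
  also have "\<dots> = fval a g' f'"
    using positive g dom_cong[OF f] unfolding positive_form_def by blast
  also have "\<dots> = fval a f' g'" by (intro E.q_sym dom_cong[OF f] dom_cong[OF g])
  finally show ?thesis .
qed

lemma l2_le_graph: "f \<in> fdom a \<Longrightarrow> l2_norm M f \<le> graph_norm M a f"
  unfolding graph_norm_def by (rule real_le_rsqrt) (simp add: E.q_nonneg)

lemma fval_le_graph: "f \<in> fdom a \<Longrightarrow> qnorm (fval a) f \<le> graph_norm M a f"
  unfolding graph_norm_def qnorm_def by simp

lemma graph_limit_l2:
  assumes "\<And>n. u n \<in> fdom a" "f \<in> fdom a" "(\<lambda>n. graph_norm M a (\<lambda>x. u n x - f x)) \<longlonglongrightarrow> 0"
  shows "(\<lambda>n. l2_norm M (\<lambda>x. u n x - f x)) \<longlonglongrightarrow> 0"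
  using assms(3)
  by (rule Lim_null_comparison[rotated]) (auto simp: l2_norm_nonneg E.diff assms l2_le_graph)

lemma graph_limit_fval:
  assumes "\<And>n. u n \<in> fdom a" "f \<in> fdom a" "(\<lambda>n. graph_norm M a (\<lambda>x. u n x - f x)) \<longlonglongrightarrow> 0"
  shows "(\<lambda>n. qnorm (fval a) (\<lambda>x. u n x - f x)) \<longlonglongrightarrow> 0"
  using assms(3)
  by (rule Lim_null_comparison[rotated])
    (auto simp: E.qnorm_nonneg E.diff assms fval_le_graph)

lemma graph_limitI:
  assumes u: "\<And>n. u n \<in> fdom a" and f: "f \<in> fdom a"
    and e: "(\<lambda>n. qnorm (fval a) (\<lambda>x. u n x - f x)) \<longlonglongrightarrow> 0"
    and l: "(\<lambda>n. l2_norm M (\<lambda>x. u n x - f x)) \<longlonglongrightarrow> 0"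
  shows "(\<lambda>n. graph_norm M a (\<lambda>x. u n x - f x)) \<longlonglongrightarrow> 0"
proof -
  have "(\<lambda>n. sqrt ((qnorm (fval a) (\<lambda>x. u n x - f x))\<^sup>2 + (l2_norm M (\<lambda>x. u n x - f x))\<^sup>2))
      \<longlonglongrightarrow> sqrt (0\<^sup>2 + 0\<^sup>2)"
    by (intro tendsto_intros e l)
  then show ?thesis by (simp add: graph_norm_def E.qnorm_sq E.diff u f)
qed

text \<open>Closedness yields some graph limit \<open>g\<close>. It is also an \<open>L2\<close>
  limit, hence a.e. equal to the prescribed \<open>f\<close>, and both conclusions transfer to
  \<open>f\<close> by a.e. invariance.\<close>

lemma closed_limit:
  assumes u: "\<And>n. u n \<in> fdom a" and cau: "G.Cauchyq u" and f: "f \<in> L2 M"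
    and l: "(\<lambda>n. l2_norm M (\<lambda>x. u n x - f x)) \<longlonglongrightarrow> 0"
  shows "f \<in> fdom a" "(\<lambda>n. graph_norm M a (\<lambda>x. u n x - f x)) \<longlonglongrightarrow> 0"
proof -
  obtain g where g: "g \<in> fdom a" "(\<lambda>n. graph_norm M a (\<lambda>x. u n x - g x)) \<longlonglongrightarrow> 0"
    using closed u cau unfolding closed_form_def G.Cauchyq_def graph_norm_qnorm by blast
  have gf: "AE x in M. g x = f x"
    by (rule L2_limit_unique[OF dom_L2[OF u] dom_L2[OF g(1)] f graph_limit_l2[OF u g] l])
  show fd: "f \<in> fdom a" by (rule dom_cong[OF g(1) L2_measurable[OF f] gf])
  have "graph_norm M a (\<lambda>x. u n x - g x) = graph_norm M a (\<lambda>x. u n x - f x)" for n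
  proof -
    note [measurable] = L2_measurable[OF dom_L2[OF u]] L2_measurable[OF f]
      L2_measurable[OF dom_L2[OF g(1)]]
    have ae: "AE x in M. u n x - g x = u n x - f x" using gf by eventually_elim simp
    have "fval a (\<lambda>x. u n x - g x) (\<lambda>x. u n x - g x) = fval a (\<lambda>x. u n x - f x) (\<lambda>x. u n x - f x)"
      by (intro fval_cong E.diff u g ae) auto
    moreover have "l2_norm M (\<lambda>x. u n x - g x) = l2_norm M (\<lambda>x. u n x - f x)"
      by (intro l2_norm_cong_AE ae) auto
    ultimately show ?thesis by (simp add: graph_norm_def)
  qed
  then show "(\<lambda>n. graph_norm M a (\<lambda>x. u n x - f x)) \<longlonglongrightarrow> 0" using g(2) by simp
qed

text \<open>Lower semicontinuity of the energy, strengthened by a sequence from the midpoint hulls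
  that converges in the graph norm; this sequence carries side conditions on the \<open>u n\<close>
  to the limit. Energy and \<open>L2\<close> norm are both bounded, so \<open>G.Mazur\<close>
  applies to the graph product.\<close>

lemma closed_weak_limit:
  assumes u: "\<And>n. u n \<in> fdom a" and bd: "\<And>n. fval a (u n) (u n) \<le> C" and f: "f \<in> L2 M"
    and l: "(\<lambda>n. l2_norm M (\<lambda>x. u n x - f x)) \<longlonglongrightarrow> 0"
  obtains v where "\<And>n. v n \<in> midpoints (u ` {n..})"
    "f \<in> fdom a" "(\<lambda>n. graph_norm M a (\<lambda>x. v n x - f x)) \<longlonglongrightarrow> 0" "fval a f f \<le> C"
proof -
  have "convergent (\<lambda>n. l2_norm M (u n))"
    using L2.tendsto_qnorm[OF dom_L2[OF u] f, folded l2_norm_qnorm, OF l] convergentI by blast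
  then obtain B where B: "\<And>n. l2_norm M (u n) \<le> B"
    using convergent_imp_Bseq[THEN BseqD] by (metis abs_le_D1 real_norm_def)
  have "graph_inner M a 1 (u n) (u n) \<le> C + B\<^sup>2" for n
    using bd[of n] power_mono[OF B l2_norm_nonneg, of n 2]
    by (simp add: graph_inner_def l2_norm_sq)
  then obtain v where v: "\<And>n. v n \<in> midpoints (u ` {n..})" "G.Cauchyq v"
    using G.Mazur[of u, OF u] by blast
  have sub: "u ` {n..} \<subseteq> fdom a" for n using u by auto
  have vD: "v n \<in> fdom a" for n using E.midpoints_subset[OF sub] v(1) by blast
  have lv: "(\<lambda>n. l2_norm M (\<lambda>x. v n x - f x)) \<longlonglongrightarrow> 0"
  proof (rule LIMSEQ_I)
    fix e :: real assume e: "0 < e"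
    obtain N where N: "\<And>n. N \<le> n \<Longrightarrow> l2_norm M (\<lambda>x. u n x - f x) \<le> e / 2"
      using LIMSEQ_D[OF l, of "e/2"] e by (force simp: l2_norm_nonneg intro: less_imp_le)
    have "l2_norm M (\<lambda>x. v n x - f x) \<le> e / 2" if "N \<le> n" for n
      unfolding l2_norm_qnorm
      by (rule L2.qnorm_midpoints_le[OF v(1)]) (use u dom_L2 f N that in \<open>auto simp: l2_norm_qnorm\<close>)
    then show "\<exists>no. \<forall>n\<ge>no. norm (l2_norm M (\<lambda>x. v n x - f x) - 0) < e"
      using e l2_norm_nonneg[of M] by (intro exI[of _ N]) (fastforce)
  qed
  note fd = closed_limit[OF vD v(2) f lv]
  have C: "0 \<le> C" using E.q_nonneg[OF u[of 0]] bd[of 0] by simp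
  have "qnorm (fval a) (v n) \<le> sqrt C" for n
    using E.qnorm_midpoints_le[OF v(1) sub E.zero, of n "sqrt C"] bd by (auto simp: qnorm_def)
  moreover have "(\<lambda>n. qnorm (fval a) (v n)) \<longlonglongrightarrow> qnorm (fval a) f"
    by (intro E.tendsto_qnorm vD fd graph_limit_fval)
  ultimately have "qnorm (fval a) f \<le> sqrt C" by (intro LIMSEQ_le_const2) auto
  then have "fval a f f \<le> C" by (simp add: qnorm_def)
  then show thesis using that v(1) fd by blast
qed

section \<open>Resolvents of a closed form\<close>

lemma resolvent_exists:
  assumes f: "f \<in> L2 M" and c: "1 \<le> c"
  shows "\<exists>u\<in>fdom a. \<forall>h\<in>fdom a. fval a u h + c * l2_inner M u h = c * l2_inner M f h"
proof -
  \<comment> \<open>Since \<open>c\<close> is at least 1, this norm dominates the graph norm. Its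
    Cauchy sequences therefore have graph limits by closedness, and these are limits for the larger
    norm too.\<close>
  interpret R: semi_inner "fdom a" "graph_inner M a c" by (rule graph_semi_inner) (use c in simp)
  have le: "qnorm (graph_inner M a 1) h \<le> qnorm (graph_inner M a c) h" if "h \<in> fdom a" for h
    using c L2.q_nonneg[OF dom_L2[OF that]] mult_right_mono[of 1 c "l2_inner M h h"]
    by (simp add: qnorm_def graph_inner_def)
  have "\<exists>u\<in>fdom a. \<forall>h\<in>fdom a. graph_inner M a c u h = c * l2_inner M f h"
  proof (rule R.Riesz)
    fix u assume u: "\<And>n. u n \<in> fdom a" and "R.Cauchyq u"
    then have "G.Cauchyq u"
      unfolding G.Cauchyq_def R.Cauchyq_def using le[OF E.diff[OF u u]]
      by (meson order_le_less_trans)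
    then obtain g where g: "g \<in> fdom a" "(\<lambda>n. graph_norm M a (\<lambda>x. u n x - g x)) \<longlonglongrightarrow> 0"
      using closed u unfolding closed_form_def G.Cauchyq_def graph_norm_qnorm by blast
    have "(\<lambda>n. sqrt ((qnorm (fval a) (\<lambda>x. u n x - g x))\<^sup>2 + c * (l2_norm M (\<lambda>x. u n x - g x))\<^sup>2))
      \<longlonglongrightarrow> sqrt (0\<^sup>2 + c * 0\<^sup>2)"
      by (intro tendsto_intros graph_limit_fval graph_limit_l2 u g)
    then have "(\<lambda>n. qnorm (graph_inner M a c) (\<lambda>x. u n x - g x)) \<longlonglongrightarrow> 0"
      by (simp add: qnorm_def graph_inner_def E.q_nonneg E.diff u g l2_norm_sq)
    then show "\<exists>f\<in>fdom a. (\<lambda>n. qnorm (graph_inner M a c) (\<lambda>x. u n x - f x)) \<longlonglongrightarrow> 0"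
      using g by blast
  next
    fix h assume h: "h \<in> fdom a"
    have "\<bar>c * l2_inner M f h\<bar> \<le> c * (l2_norm M f * l2_norm M h)"
      using L2.cauchy_schwarz[OF f dom_L2[OF h]] c by (simp add: abs_mult l2_norm_qnorm)
    also have "\<dots> \<le> c * (l2_norm M f * qnorm (graph_inner M a c) h)"
      using c l2_le_graph[OF h] le[OF h]
      by (intro mult_left_mono) (auto simp: l2_norm_nonneg graph_norm_qnorm)
    finally show "\<bar>c * l2_inner M f h\<bar> \<le> c * l2_norm M f * qnorm (graph_inner M a c) h"
      by (simp add: mult.assoc)
  qed (simp_all add: dom_L2 f L2.q_rules algebra_simps)
  then show ?thesis by (simp add: graph_inner_def)
qed

text \<open>If \<open>A\<close> is the operator of \<open>a\<close>, then \<open>res n\<close> is \<open>m (m + A)\<inverse>\<close> for \<open>m = n + 1\<close>.\<close>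

definition res :: "nat \<Rightarrow> ('a \<Rightarrow> real) \<Rightarrow> ('a \<Rightarrow> real)" where
  "res n f = (SOME u. u \<in> fdom a \<and> (\<forall>h\<in>fdom a.
     fval a u h + real (Suc n) * l2_inner M u h = real (Suc n) * l2_inner M f h))"

lemma res:
  assumes "f \<in> L2 M"
  shows res_dom: "res n f \<in> fdom a"
    and res_eq: "h \<in> fdom a \<Longrightarrow> fval a (res n f) h
      = real (Suc n) * (l2_inner M f h - l2_inner M (res n f) h)"
proof -
  have "\<exists>u. u \<in> fdom a \<and> (\<forall>h\<in>fdom a.
     fval a u h + real (Suc n) * l2_inner M u h = real (Suc n) * l2_inner M f h)"
    using resolvent_exists[OF assms, of "real (Suc n)"] by auto
  from someI_ex[OF this] show "res n f \<in> fdom a"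
    "h \<in> fdom a \<Longrightarrow> fval a (res n f) h = real (Suc n) * (l2_inner M f h - l2_inner M (res n f) h)"
    unfolding res_def[symmetric] by (auto simp: algebra_simps)
qed

lemma res_L2: "f \<in> L2 M \<Longrightarrow> res n f \<in> L2 M"
  by (rule dom_L2[OF res_dom])

lemma res_sym:
  assumes f: "f \<in> L2 M" and g: "g \<in> L2 M"
  shows "l2_inner M (res n f) g = l2_inner M f (res n g)"
proof -
  have "l2_inner M f (res n g) - l2_inner M (res n f) (res n g)
      = l2_inner M g (res n f) - l2_inner M (res n g) (res n f)"
    using res_eq[OF f res_dom[OF g], of n n] res_eq[OF g res_dom[OF f], of n n]
      E.q_sym[OF res_dom[OF f] res_dom[OF g], of n n] by simp
  then show ?thesis
    using L2.q_sym[OF res_L2[OF f] res_L2[OF g], of n n] L2.q_sym[OF g res_L2[OF f], of n] by simp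
qed

text \<open>Completing the square: \<open>res n f\<close> minimizes the right-hand side over
  \<open>g\<close>, and the last two terms on the left measure exactly how much a competitor
  \<open>g\<close> loses. The choice \<open>g = f\<close> gives the contraction bounds, an
  approximation of \<open>f\<close> gives convergence, and a clipped resolvent gives the Markov
  property.\<close>

lemma res_variation:
  assumes f: "f \<in> L2 M" and g: "g \<in> fdom a"
  shows "fval a (res n f) (res n f)
      + real (Suc n) * l2_inner M (\<lambda>x. res n f x - f x) (\<lambda>x. res n f x - f x)
      + fval a (\<lambda>x. g x - res n f x) (\<lambda>x. g x - res n f x)
      + real (Suc n) * l2_inner M (\<lambda>x. g x - res n f x) (\<lambda>x. g x - res n f x)
    = fval a g g + real (Suc n) * l2_inner M (\<lambda>x. g x - f x) (\<lambda>x. g x - f x)"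
proof -
  note u = res_dom[OF f, of n]
  show ?thesis
    using res_eq[OF f g, of n] res_eq[OF f u, of n] E.q_sym[OF g u]
      L2.q_sym[OF f dom_L2[OF g]] L2.q_sym[OF f dom_L2[OF u]] L2.q_sym[OF dom_L2[OF u] dom_L2[OF g]]
    by (simp add: E.q_diff_sq L2.q_diff_sq dom_L2 u f g algebra_simps)
qed

lemma res_fval_le: "f \<in> fdom a \<Longrightarrow> fval a (res n f) (res n f) \<le> fval a f f"
  and res_l2_le: "f \<in> fdom a \<Longrightarrow>
    real (Suc n) * l2_inner M (\<lambda>x. res n f x - f x) (\<lambda>x. res n f x - f x) \<le> fval a f f"
proof -
  assume f: "f \<in> fdom a"
  note u = res_dom[OF dom_L2[OF f], of n]
  have 1: "0 \<le> l2_inner M (\<lambda>x. res n f x - f x) (\<lambda>x. res n f x - f x)"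
    "0 \<le> l2_inner M (\<lambda>x. f x - res n f x) (\<lambda>x. f x - res n f x)"
    by (auto simp: l2_inner_def)
  have 2: "0 \<le> fval a (\<lambda>x. f x - res n f x) (\<lambda>x. f x - res n f x)" "0 \<le> fval a (res n f) (res n f)"
    by (intro E.q_nonneg E.diff u f)+
  have 3: "l2_inner M (\<lambda>x. f x - f x) (\<lambda>x. f x - f x) = 0" by (simp add: l2_inner_def)
  have 4: "0 \<le> real (Suc n) * l2_inner M (\<lambda>x. res n f x - f x) (\<lambda>x. res n f x - f x)"
    "0 \<le> real (Suc n) * l2_inner M (\<lambda>x. f x - res n f x) (\<lambda>x. f x - res n f x)"
    using 1 by (intro mult_nonneg_nonneg; simp)+
  show "fval a (res n f) (res n f) \<le> fval a f f"
    "real (Suc n) * l2_inner M (\<lambda>x. res n f x - f x) (\<lambda>x. res n f x - f x) \<le> fval a f f"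
    using res_variation[OF dom_L2[OF f] f, of n] 2 3 4 by simp_all
qed

lemma res_limit:
  assumes dense: "densely_defined M H a" and f: "f \<in> H"
  shows "(\<lambda>n. l2_norm M (\<lambda>x. res n f x - f x)) \<longlonglongrightarrow> 0"
proof (rule LIMSEQ_I)
  fix e :: real assume e: "0 < e"
  have fL: "f \<in> L2 M" using f H_L2 by auto
  obtain g where g: "g \<in> fdom a" "l2_norm M (\<lambda>x. f x - g x) < e / 2"
    using dense f e unfolding densely_defined_def by (metis half_gt_zero)
  \<comment> \<open>From \<open>N\<close> on the energy of \<open>g\<close> divided by
    \<open>n + 1\<close> is below e^2/4; the distance of \<open>g\<close> to \<open>f\<close>
    contributes at most another e^2/4.\<close>
  obtain N :: nat where N: "4 * fval a g g / e\<^sup>2 < real N" using reals_Archimedean2 by blast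
  have "l2_norm M (\<lambda>x. res n f x - f x) < e" if "N \<le> n" for n
  proof -
    note u = res_dom[OF fL, of n]
    let ?c = "real (Suc n)"
    have c: "?c > 0" by simp
    have "?c * (l2_norm M (\<lambda>x. res n f x - f x))\<^sup>2 \<le> fval a g g + ?c * (l2_norm M (\<lambda>x. g x - f x))\<^sup>2"
    proof -
      have "0 \<le> fval a (res n f) (res n f)"
        "0 \<le> fval a (\<lambda>x. g x - res n f x) (\<lambda>x. g x - res n f x)"
        by (intro E.q_nonneg E.diff u g)+
      moreover have "0 \<le> ?c * l2_inner M (\<lambda>x. g x - res n f x) (\<lambda>x. g x - res n f x)"
        by (simp add: l2_inner_def)
      ultimately show ?thesis
        using res_variation[OF fL g(1), of n] unfolding l2_norm_sq by linarith
    qed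
    also have "(l2_norm M (\<lambda>x. g x - f x))\<^sup>2 \<le> (e / 2)\<^sup>2"
      using g(2) L2.qnorm_minus_commute[OF fL dom_L2[OF g(1)]]
      by (intro power_mono) (auto simp: l2_norm_qnorm L2.qnorm_nonneg L2.diff fL dom_L2 g)
    also have "fval a g g < ?c * (e\<^sup>2 / 4)"
    proof -
      have "4 * fval a g g / e\<^sup>2 < ?c" using N that by simp
      then show ?thesis using e by (simp add: field_simps)
    qed
    also have "?c * (e\<^sup>2 / 4) + ?c * (e / 2)\<^sup>2 \<le> ?c * e\<^sup>2"
      by (simp add: power_divide field_simps)
    finally have "(l2_norm M (\<lambda>x. res n f x - f x))\<^sup>2 < e\<^sup>2"
      by simp
    then show ?thesis by (rule power2_less_imp_less) (use e in simp)
  qed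
  then show "\<exists>no. \<forall>n\<ge>no. norm (l2_norm M (\<lambda>x. res n f x - f x) - 0) < e"
    by (auto simp: l2_norm_nonneg)
qed

text \<open>Source of elements of the operator domain; together with \<open>res_limit\<close> it
  makes that domain dense in \<open>H\<close>. The second hypothesis stands for the subspace
  property of \<open>H\<close>.\<close>

lemma res_operator:
  assumes f: "f \<in> H" and H: "\<And>g. g \<in> fdom a \<Longrightarrow> (\<lambda>x. real (Suc n) * (f x - g x)) \<in> H"
  shows "(res n f, \<lambda>x. real (Suc n) * (f x - res n f x)) \<in> form_operator M H a"
proof -
  have fL: "f \<in> L2 M" using f H_L2 by auto
  note u = res_dom[OF fL, of n]
  have "fval a (res n f) h = l2_inner M (\<lambda>x. real (Suc n) * (f x - res n f x)) h"
    if h: "h \<in> fdom a" for h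
    using res_eq[OF fL h, of n] L2.q_scale[OF L2.diff[OF fL dom_L2[OF u]] dom_L2[OF h]]
      L2.q_diff[OF fL dom_L2[OF u] dom_L2[OF h]] by simp
  then show ?thesis
    using u H[OF u] by (simp add: form_operator_def)
qed

lemma res_limit_l2_dom:
  assumes f: "f \<in> fdom a"
  shows "(\<lambda>n. l2_norm M (\<lambda>x. res n f x - f x)) \<longlonglongrightarrow> 0"
proof -
  have "(\<lambda>n. sqrt (fval a f f * (1 / real (Suc n)))) \<longlonglongrightarrow> sqrt (fval a f f * 0)"
    by (intro tendsto_intros LIMSEQ_Suc[OF lim_1_over_n])
  then have lim: "(\<lambda>n. sqrt (fval a f f * (1 / real (Suc n)))) \<longlonglongrightarrow> 0" by simp
  have "norm (l2_norm M (\<lambda>x. res n f x - f x)) \<le> sqrt (fval a f f * (1 / real (Suc n)))" for n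
  proof -
    have "(l2_norm M (\<lambda>x. res n f x - f x))\<^sup>2 \<le> fval a f f * (1 / real (Suc n))"
      using res_l2_le[OF f, of n] by (simp add: l2_norm_sq pos_le_divide_eq mult.commute del: of_nat_Suc)
    then show ?thesis by (simp add: real_le_rsqrt l2_norm_nonneg)
  qed
  then show ?thesis by (intro Lim_null_comparison[OF _ lim]) auto
qed

text \<open>
  The resolvents of \<open>f\<close> converge weakly and with \<open>a(res n f) \<le> a(f)\<close>, hence strongly.
\<close>

lemma res_limit_graph:
  assumes f: "f \<in> fdom a"
  shows "(\<lambda>n. graph_norm M a (\<lambda>x. res n f x - f x)) \<longlonglongrightarrow> 0"
proof -
  note fL = dom_L2[OF f]
  note u = res_dom[OF fL]
  \<comment> \<open>If the bound failed along a subsequence, the condition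
    \<open>fval a w f \<le> fval a f f - e\<close> would pass to midpoints and then, by
    \<open>closed_weak_limit\<close>, to \<open>f\<close> itself.\<close>
  have ev: "eventually (\<lambda>n. fval a f f - e < fval a (res n f) f) sequentially" if e: "0 < e" for e
  proof (rule ccontr)
    assume "\<not> ?thesis"
    then have "frequently (\<lambda>n. fval a (res n f) f \<le> fval a f f - e) sequentially"
      by (simp add: frequently_def not_le)
    then have "infinite {n. fval a (res n f) f \<le> fval a f f - e}"
      by (simp add: INFM_iff_infinite flip: cofinite_eq_sequentially)
    then obtain r :: "nat \<Rightarrow> nat" where r: "strict_mono r"
      "\<And>k. fval a (res (r k) f) f \<le> fval a f f - e"
      using infinite_enumerate by blast
    have rl: "(\<lambda>k. l2_norm M (\<lambda>x. res (r k) f x - f x)) \<longlonglongrightarrow> 0"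
      using LIMSEQ_subseq_LIMSEQ[OF res_limit_l2_dom[OF f] r(1)] by (simp add: o_def)
    obtain v where v: "\<And>n. v n \<in> midpoints ((\<lambda>k. res (r k) f) ` {n..})"
      "(\<lambda>n. graph_norm M a (\<lambda>x. v n x - f x)) \<longlonglongrightarrow> 0"
      by (rule closed_weak_limit[of "\<lambda>k. res (r k) f", OF u res_fval_le[OF f] fL rl]) blast
    have le: "w \<in> fdom a \<and> fval a w f \<le> fval a f f - e"
      if "w \<in> midpoints ((\<lambda>k. res (r k) f) ` {n..})" for w n
      using that
      by (induction rule: midpoints.induct)
        (use u r f in \<open>auto simp: E.q_rules E.half E.q_half\<close>)
    have "(\<lambda>n. fval a (v n) f) \<longlonglongrightarrow> fval a f f"
      by (intro E.tendsto_q_left graph_limit_fval f v(2)) (use le[OF v(1)] in auto)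
    then have "fval a f f \<le> fval a f f - e"
      by (rule LIMSEQ_le_const2) (use le[OF v(1)] in auto)
    then show False using e by simp
  qed
  have "(\<lambda>n. qnorm (fval a) (\<lambda>x. res n f x - f x)) \<longlonglongrightarrow> 0"
  proof (rule LIMSEQ_I)
    fix e :: real assume e: "0 < e"
    \<comment> \<open>As \<open>res n f\<close> has at most the energy of \<open>f\<close>, the
      energy of the difference is at most twice \<open>fval a f f - fval a (res n f) f\<close>;
      hence the half.\<close>
    have "eventually (\<lambda>n. fval a f f - e\<^sup>2 / 2 < fval a (res n f) f) sequentially"
      using e by (intro ev) simp
    then obtain N where N: "\<And>n. N \<le> n \<Longrightarrow> fval a f f - e\<^sup>2 / 2 < fval a (res n f) f"
      unfolding eventually_sequentially by blast
    have "qnorm (fval a) (\<lambda>x. res n f x - f x) < e" if "N \<le> n" for n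
    proof (rule power2_less_imp_less)
      show "(qnorm (fval a) (\<lambda>x. res n f x - f x))\<^sup>2 < e\<^sup>2"
        using N[OF that] res_fval_le[OF f, of n]
        by (simp add: E.qnorm_sq E.q_diff_sq E.diff u f)
    qed (use e in simp)
    then show "\<exists>no. \<forall>n\<ge>no. norm (qnorm (fval a) (\<lambda>x. res n f x - f x) - 0) < e"
      by (auto simp: E.qnorm_nonneg E.diff u f)
  qed
  then show ?thesis by (rule graph_limitI[OF u f _ res_limit_l2_dom[OF f]])
qed

text \<open>The factor \<open>n + 1\<close> of the approximating form is left out of \<open>approx n\<close>.\<close>

definition approx :: "nat \<Rightarrow> ('a \<Rightarrow> real) \<Rightarrow> ('a \<Rightarrow> real) \<Rightarrow> real" where
  "approx n f g = l2_inner M f g - l2_inner M (res n f) g"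

lemma approx_limit:
  assumes f: "f \<in> fdom a" and g: "g \<in> fdom a"
  shows "(\<lambda>n. real (Suc n) * approx n f g) \<longlonglongrightarrow> fval a f g"
proof -
  have "(\<lambda>n. fval a (res n f) g) \<longlonglongrightarrow> fval a f g"
    by (intro E.tendsto_q_left graph_limit_fval res_limit_graph f g res_dom dom_L2)
  then show ?thesis using res_eq[OF dom_L2[OF f] g] by (simp add: approx_def)
qed

lemma approx_le_fval: "f \<in> fdom a \<Longrightarrow> real (Suc n) * approx n f f \<le> fval a f f"
proof -
  assume f: "f \<in> fdom a"
  note u = res_dom[OF dom_L2[OF f], of n]
  have "real (Suc n) * approx n f f = fval a (res n f) f"
    using res_eq[OF dom_L2[OF f] f] by (simp add: approx_def)
  also have "\<dots> \<le> qnorm (fval a) (res n f) * qnorm (fval a) f"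
    using E.cauchy_schwarz[OF u f] by simp
  also have "\<dots> \<le> qnorm (fval a) f * qnorm (fval a) f"
    using res_fval_le[OF f, of n]
    by (intro mult_right_mono) (auto simp: qnorm_def E.q_nonneg f)
  finally show ?thesis using E.qnorm_sq[OF f] by (simp add: power2_eq_square)
qed

text \<open>Converse of \<open>approx_le_fval\<close>, and the way products enter the domain: the
  approximating energy dominates the energy of the resolvent, so bounded approximating energies
  allow \<open>closed_weak_limit\<close> along the resolvents.\<close>

lemma approx_bounded_dom:
  assumes dense: "densely_defined M H a" and f: "f \<in> H"
    and bd: "\<And>n. real (Suc n) * approx n f f \<le> C"
  shows "f \<in> fdom a" "fval a f f \<le> C"
proof -
  have fL: "f \<in> L2 M" using f H_L2 by auto
  note u = res_dom[OF fL]
  have "fval a (res n f) (res n f) \<le> C" for n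
  proof -
    have "fval a (res n f) (res n f) + real (Suc n) * l2_inner M (\<lambda>x. f x - res n f x) (\<lambda>x. f x - res n f x)
        = real (Suc n) * approx n f f"
      using res_eq[OF fL u, of n n] L2.q_sym[OF fL dom_L2[OF u], of n]
      by (simp add: L2.q_diff_sq fL dom_L2 u approx_def algebra_simps)
    moreover have "0 \<le> real (Suc n) * l2_inner M (\<lambda>x. f x - res n f x) (\<lambda>x. f x - res n f x)"
      by (simp add: l2_inner_def)
    ultimately show ?thesis using bd[of n] by linarith
  qed
  from closed_weak_limit[of "\<lambda>n. res n f", OF u this fL res_limit[OF dense f]]
  show "f \<in> fdom a" "fval a f f \<le> C" by blast+
qed

end

section \<open>The approximating forms as sums over pairs of points\<close>

context closed_L2_form
begin

lemma approx_sq: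
  assumes f: "f \<in> L2 M"
  shows "real (Suc n) * approx n f f = fval a (res n f) (res n f)
    + real (Suc n) * l2_inner M (\<lambda>x. f x - res n f x) (\<lambda>x. f x - res n f x)"
proof -
  note u = res_dom[OF f]
  show ?thesis
    using res_eq[OF f u, of n n] L2.q_sym[OF f dom_L2[OF u], of n]
    by (simp add: L2.q_diff_sq f dom_L2[OF u] approx_def algebra_simps)
qed

text \<open>\<open>res n\<close> is a choice and hence linear only up to null functions. Moving it
  to the second argument by \<open>res_sym\<close> gives linearity in the first argument
  directly.\<close>

lemma approx_semi_inner: "semi_inner (L2 M) (approx n)"
proof unfold_locales
  fix f g h :: "'a \<Rightarrow> real" and c :: real
  assume f: "f \<in> L2 M"
  have "0 \<le> real (Suc n) * approx n f f"
    unfolding approx_sq[OF f]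
    by (intro add_nonneg_nonneg E.q_nonneg res_dom f mult_nonneg_nonneg) (auto simp: l2_inner_def)
  then show "0 \<le> approx n f f" by (simp add: zero_le_mult_iff)
  assume g: "g \<in> L2 M"
  have *: "approx n f g = l2_inner M f g - l2_inner M f (res n g)" if "f \<in> L2 M" "g \<in> L2 M" for f g
    using res_sym[OF that] by (simp add: approx_def)
  show "approx n f g = approx n g f"
    using L2.q_sym[OF f g] L2.q_sym[OF f res_L2[OF g]] *[OF f g] by (simp add: approx_def)
  show "approx n (\<lambda>x. c * f x) g = c * approx n f g"
    by (simp add: * f g L2.q_rules res_L2[OF g] right_diff_distrib)
  assume h: "h \<in> L2 M"
  show "approx n (\<lambda>x. f x + g x) h = approx n f h + approx n g h"
    by (simp add: * f g h L2.q_rules res_L2[OF h])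
qed (auto simp: L2.q_rules)

sublocale A: semi_inner "L2 M" "approx n" for n
  by (rule approx_semi_inner)

lemma approx_le_l2:
  assumes f: "f \<in> L2 M"
  shows "qnorm (approx n) f \<le> l2_norm M f"
proof -
  note u = res_dom[OF f, of n]
  have "0 \<le> fval a (res n f) (res n f) + real (Suc n) * l2_inner M (res n f) (res n f)"
    by (intro add_nonneg_nonneg E.q_nonneg u mult_nonneg_nonneg) (auto simp: l2_inner_def)
  also have "\<dots> = real (Suc n) * l2_inner M (res n f) f"
    using res_eq[OF f u, of n] L2.q_sym[OF f dom_L2[OF u]] by (simp add: algebra_simps)
  finally have "0 \<le> l2_inner M (res n f) f" by (simp add: zero_le_mult_iff)
  then show ?thesis by (simp add: qnorm_def approx_def l2_norm_def)
qed

lemma approx_tendsto: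
  assumes u: "\<And>k. u k \<in> L2 M" and v: "\<And>k. v k \<in> L2 M" and f: "f \<in> L2 M" and g: "g \<in> L2 M"
    and lu: "(\<lambda>k. l2_norm M (\<lambda>x. u k x - f x)) \<longlonglongrightarrow> 0"
    and lv: "(\<lambda>k. l2_norm M (\<lambda>x. v k x - g x)) \<longlonglongrightarrow> 0"
  shows "(\<lambda>k. approx n (u k) (v k)) \<longlonglongrightarrow> approx n f g"
proof (intro A.tendsto_q u v f g)
  show "(\<lambda>k. qnorm (approx n) (\<lambda>x. u k x - f x)) \<longlonglongrightarrow> 0"
    by (rule Lim_null_comparison[OF _ lu])
      (auto simp: A.qnorm_nonneg L2.diff u f approx_le_l2)
  show "(\<lambda>k. qnorm (approx n) (\<lambda>x. v k x - g x)) \<longlonglongrightarrow> 0"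
    by (rule Lim_null_comparison[OF _ lv])
      (auto simp: A.qnorm_nonneg L2.diff v g approx_le_l2)
qed

end

locale dirichlet_L2_form = closed_L2_form M "L2 M" a for M :: "'a measure" and a +
  assumes dirichlet: "dirichlet_form M (L2 M) a" and space: "space M = UNIV"
begin

lemma dense: "densely_defined M (L2 M) a"
  using dirichlet by (simp add: dirichlet_form_def)

lemma clip:
  assumes "f \<in> fdom a"
  shows clip_dom: "(\<lambda>x. min (max 0 (f x)) 1) \<in> fdom a"
    and clip_le: "fval a (\<lambda>x. min (max 0 (f x)) 1) (\<lambda>x. min (max 0 (f x)) 1) \<le> fval a f f"
  using dirichlet assms by (auto simp: dirichlet_form_def)

text \<open>The clipped resolvent has no larger energy and, as \<open>f\<close> takes values in
  [0,1], no larger distance to \<open>f\<close>. It does as well as the minimizer, and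
  \<open>res_variation\<close> forces the two to coincide a.e.\<close>

lemma markov:
  assumes f: "f \<in> L2 M" and f01: "AE x in M. 0 \<le> f x \<and> f x \<le> 1"
  shows "AE x in M. 0 \<le> res n f x \<and> res n f x \<le> 1"
proof -
  note u = res_dom[OF f, of n]
  define w where "w x = min (max 0 (res n f x)) 1" for x
  have w: "w \<in> fdom a" "fval a w w \<le> fval a (res n f) (res n f)"
    unfolding w_def by (rule clip_dom[OF u], rule clip_le[OF u])
  have "l2_norm M (\<lambda>x. w x - f x) \<le> l2_norm M (\<lambda>x. res n f x - f x)"
  proof (intro l2_norm_mono_AE L2.diff dom_L2[OF u] f)
    show "(\<lambda>x. w x - f x) \<in> borel_measurable M"
      by (intro L2_measurable L2.diff dom_L2[OF w(1)] f)
    show "AE x in M. \<bar>w x - f x\<bar> \<le> \<bar>res n f x - f x\<bar>"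
      using f01 by eventually_elim (auto simp: w_def)
  qed
  then have "l2_inner M (\<lambda>x. w x - f x) (\<lambda>x. w x - f x)
      \<le> l2_inner M (\<lambda>x. res n f x - f x) (\<lambda>x. res n f x - f x)"
    by (simp add: l2_norm_def)
  then have "real (Suc n) * l2_inner M (\<lambda>x. w x - f x) (\<lambda>x. w x - f x)
      \<le> real (Suc n) * l2_inner M (\<lambda>x. res n f x - f x) (\<lambda>x. res n f x - f x)"
    by (intro mult_left_mono) auto
  moreover have "0 \<le> fval a (\<lambda>x. w x - res n f x) (\<lambda>x. w x - res n f x)"
    by (intro E.q_nonneg E.diff u w)
  ultimately have "real (Suc n) * l2_inner M (\<lambda>x. w x - res n f x) (\<lambda>x. w x - res n f x) \<le> 0"
    using res_variation[OF f w(1), of n] w(2) by linarith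
  then have "l2_inner M (\<lambda>x. w x - res n f x) (\<lambda>x. w x - res n f x) \<le> 0"
    by (simp add: mult_le_0_iff)
  moreover have "0 \<le> l2_inner M (\<lambda>x. w x - res n f x) (\<lambda>x. w x - res n f x)"
    by (simp add: l2_inner_def)
  ultimately have "AE x in M. w x - res n f x = 0"
    by (intro l2_inner_eq_0_AE L2.diff dom_L2 u w) auto
  then show ?thesis by eventually_elim (auto simp: w_def split: if_splits simp: min_def max_def)
qed

text \<open>
  The value \<open>z\<close> of \<open>p\<close> is the one taken on a set of possibly infinite measure; what escapes there is
  collected in the weights \<open>\<kappa>\<close>.
\<close>

lemma approx_simple:
  fixes p :: "'a \<Rightarrow> 'b"
  assumes fin: "finite (range p)"
    and ind: "\<And>v. v \<noteq> z \<Longrightarrow> indicator (p -` {v}) \<in> L2 M"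
  obtains I t \<kappa> where "finite I" "I \<subseteq> range p" "\<And>u. u \<in> I \<Longrightarrow> 0 \<le> \<kappa> u" "\<And>u v. u \<in> I \<Longrightarrow> v \<in> I \<Longrightarrow> 0 \<le> t u v"
    "\<And>G H. G z = 0 \<Longrightarrow> H z = 0 \<Longrightarrow> approx n (\<lambda>x. G (p x)) (\<lambda>x. H (p x))
      = (\<Sum>u\<in>I. \<kappa> u * (G u * H u)) + (\<Sum>u\<in>I. \<Sum>v\<in>I. t u v * ((G u - G v) * (H u - H v)))"
proof -
  define I where "I = range p - {z}"
  define e where "e v = (indicator (p -` {v}) :: 'a \<Rightarrow> real)" for v
  define b where "b u v = approx n (e u) (e v)" for u v
  define \<kappa> where "\<kappa> u = (\<Sum>v\<in>I. b u v)" for u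
  \<comment> \<open>The half compensates for each pair of values occurring twice in the double
    sum.\<close>
  define t where "t u v = (if u = v then 0 else - b u v / 2)" for u v
  define s where "s x = (\<Sum>v\<in>I. 1 * e v x)" for x
  have fI: "finite I" using fin by (simp add: I_def)
  have eL: "e v \<in> L2 M" if "v \<in> I" for v using ind that by (auto simp: I_def e_def)
  have sL: "s \<in> L2 M" unfolding s_def by (rule L2.sum_scaled[OF fI eL])
  have rep: "(\<lambda>x. G (p x)) = (\<lambda>x. \<Sum>v\<in>I. G v * e v x)" if "G z = 0" for G :: "'b \<Rightarrow> real"
  proof
    fix x
    have "(\<Sum>v\<in>I. G v * e v x) = (\<Sum>v\<in>I. if v = p x then G v else 0)"
      by (intro sum.cong) (auto simp: e_def indicator_def)
    also have "\<dots> = G (p x)" using fI that by (auto simp: I_def)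
    finally show "G (p x) = (\<Sum>v\<in>I. G v * e v x)" by simp
  qed
  have s_eq: "s x = (if p x = z then 0 else 1)" for x
    using fun_cong[OF rep[of "\<lambda>v. if v = z then 0 else 1"], of x]
    unfolding s_def I_def by (auto intro!: sum.cong)
  have sym: "b u v = b v u" if "u \<in> I" "v \<in> I" for u v
    unfolding b_def by (intro A.q_sym eL that)
  have e01: "AE x in M. 0 \<le> e v x \<and> e v x \<le> 1" for v
    by (auto simp: e_def indicator_def)
  have t0: "0 \<le> t u v" if "u \<in> I" "v \<in> I" for u v
  proof (cases "u = v")
    case False
    \<comment> \<open>Distinct values have disjoint level sets, so \<open>b u v\<close> is minus the
      pairing of the nonnegative function \<open>res n (e u)\<close> with
      \<open>e v\<close>.\<close>
    have "l2_inner M (e u) (e v) = 0"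
      using False by (auto simp: l2_inner_def e_def indicator_def intro!: integral_eq_zero_AE)
    moreover have "0 \<le> l2_inner M (res n (e u)) (e v)"
      unfolding l2_inner_def
      by (intro integral_nonneg_AE, use markov[OF eL[OF that(1)] e01, of n] in eventually_elim)
        (simp add: e_def)
    ultimately show ?thesis using False by (simp add: t_def b_def approx_def)
  qed (simp add: t_def)
  have k0: "0 \<le> \<kappa> u" if u: "u \<in> I" for u
  proof -
    have "approx n s (e u) = (\<Sum>v\<in>I. 1 * approx n (e v) (e u))"
      unfolding s_def by (rule A.q_sum_scaled[OF fI eL eL[OF u]])
    \<comment> \<open>\<open>s\<close> is the indicator of the set where \<open>p\<close> differs
      from \<open>z\<close>. By the Markov property \<open>res n s\<close> is at most 1, the value
      of \<open>s\<close> there, so the pairing with \<open>e u\<close> is nonnegative.\<close>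
    then have "\<kappa> u = approx n s (e u)"
      unfolding \<kappa>_def using sym[OF _ u] by (simp add: b_def)
    also have "\<dots> = l2_inner M (\<lambda>x. s x - res n s x) (e u)"
      by (simp add: approx_def L2.q_diff sL res_L2 eL u)
    also have "\<dots> \<ge> 0"
    proof -
      have "AE x in M. 0 \<le> res n s x \<and> res n s x \<le> 1"
        by (rule markov[OF sL]) (auto simp: s_eq)
      then have "AE x in M. 0 \<le> (s x - res n s x) * e u x"
        by eventually_elim (use u in \<open>auto simp: e_def indicator_def s_eq I_def\<close>)
      then show ?thesis unfolding l2_inner_def by (rule integral_nonneg_AE)
    qed
    finally show ?thesis .
  qed
  have main: "approx n (\<lambda>x. G (p x)) (\<lambda>x. H (p x))
      = (\<Sum>u\<in>I. \<kappa> u * (G u * H u)) + (\<Sum>u\<in>I. \<Sum>v\<in>I. t u v * ((G u - G v) * (H u - H v)))"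
    if G: "G z = 0" and H: "H z = 0" for G H
  proof -
    have "approx n (\<lambda>x. G (p x)) (\<lambda>x. H (p x)) = (\<Sum>u\<in>I. \<Sum>v\<in>I. G u * H v * b u v)"
      unfolding rep[of G, OF G] rep[of H, OF H] b_def by (rule A.q_sum_scaled2[OF fI eL])
    moreover have "(\<Sum>u\<in>I. \<Sum>v\<in>I. t u v * ((G u - G v) * (H u - H v)))
        = (\<Sum>u\<in>I. \<Sum>v\<in>I. (G u * H v * b u v + G v * H u * b u v) / 2
            - (b u v * (G u * H u) + b u v * (G v * H v)) / 2)"
      by (intro sum.cong refl) (auto simp: t_def field_simps)
    moreover have "\<dots> = ((\<Sum>u\<in>I. \<Sum>v\<in>I. G u * H v * b u v) + (\<Sum>u\<in>I. \<Sum>v\<in>I. G v * H u * b u v)) / 2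
        - ((\<Sum>u\<in>I. \<Sum>v\<in>I. b u v * (G u * H u)) + (\<Sum>u\<in>I. \<Sum>v\<in>I. b u v * (G v * H v))) / 2"
      by (simp add: sum_subtractf sum.distrib sum_divide_distrib[symmetric])
    moreover have "(\<Sum>u\<in>I. \<Sum>v\<in>I. G v * H u * b u v) = (\<Sum>u\<in>I. \<Sum>v\<in>I. G u * H v * b u v)"
      by (subst sum.swap) (use sym in \<open>auto intro!: sum.cong\<close>)
    moreover have "(\<Sum>u\<in>I. \<Sum>v\<in>I. b u v * (G v * H v)) = (\<Sum>u\<in>I. \<Sum>v\<in>I. b u v * (G u * H u))"
      by (subst sum.swap) (use sym in \<open>auto intro!: sum.cong\<close>)
    moreover have "(\<Sum>u\<in>I. \<Sum>v\<in>I. b u v * (G u * H u)) = (\<Sum>u\<in>I. \<kappa> u * (G u * H u))"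
      by (simp add: \<kappa>_def sum_distrib_right)
    ultimately show ?thesis by simp
  qed
  show thesis by (rule that[OF fI _ k0 t0 main]) (auto simp: I_def)
qed

end

text \<open>Rounding is towards zero, so that a rounded \<open>L\<^sub>2\<close>-function vanishes off a set of finite measure.\<close>

definition rnd :: "nat \<Rightarrow> real \<Rightarrow> real" where
  "rnd k x = of_int (if 0 \<le> x then \<lfloor>real (Suc k) * x\<rfloor> else \<lceil>real (Suc k) * x\<rceil>) / real (Suc k)"

lemma rnd_measurable [measurable]: "rnd k \<in> borel_measurable borel"
  unfolding rnd_def by measurable

lemma rnd_pos: "0 \<le> x \<Longrightarrow> 0 \<le> rnd k x"
  by (simp add: rnd_def)

lemma rnd_abs: "\<bar>rnd k x\<bar> \<le> \<bar>x\<bar>"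
proof (cases "0 \<le> x")
  case True
  have "of_int \<lfloor>real (Suc k) * x\<rfloor> \<le> real (Suc k) * x" by (rule of_int_floor_le)
  then have "rnd k x \<le> x" using True by (simp add: rnd_def field_simps)
  then show ?thesis using True rnd_pos[OF True, of k] by simp
next
  case False
  have "real (Suc k) * x \<le> of_int \<lceil>real (Suc k) * x\<rceil>" by (rule le_of_int_ceiling)
  then have "x \<le> rnd k x" using False by (simp add: rnd_def field_simps)
  moreover have "\<lceil>real (Suc k) * x\<rceil> \<le> 0"
    using False by (simp add: ceiling_le_iff mult_nonneg_nonpos)
  then have "real_of_int \<lceil>real (Suc k) * x\<rceil> / real (Suc k) \<le> 0"
    by (intro divide_nonpos_pos) (auto simp del: of_nat_Suc)
  then have "rnd k x \<le> 0" using False by (simp add: rnd_def)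
  ultimately show ?thesis by simp
qed

lemma rnd_interval: "l \<le> 0 \<Longrightarrow> 0 \<le> b \<Longrightarrow> x \<in> {l..b} \<Longrightarrow> rnd k x \<in> {l..b}"
proof (cases "0 \<le> x")
  case False
  moreover assume "l \<le> 0" "0 \<le> b" "x \<in> {l..b}"
  moreover have "rnd k x \<le> 0"
  proof -
    have "real_of_int \<lceil>real (Suc k) * x\<rceil> \<le> 0"
      using False by (simp add: ceiling_le_iff mult_nonneg_nonpos)
    then show ?thesis using False by (simp add: rnd_def divide_nonpos_pos)
  qed
  ultimately show ?thesis using rnd_abs[of k x] by auto
qed (use rnd_abs[of k x] rnd_pos[of x k] in auto)

lemma rnd_dist: "\<bar>rnd k x - x\<bar> \<le> 1 / real (Suc k)"
proof -
  have c: "0 < real (Suc k)" by simp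
  define j where "j = (if 0 \<le> x then \<lfloor>real (Suc k) * x\<rfloor> else \<lceil>real (Suc k) * x\<rceil>)"
  have "\<bar>real_of_int j - real (Suc k) * x\<bar> \<le> 1"
    unfolding j_def by (simp del: of_nat_Suc) linarith
  moreover have "rnd k x = of_int j / real (Suc k)" by (simp add: rnd_def j_def)
  ultimately have "\<bar>(rnd k x - x) * real (Suc k)\<bar> \<le> 1"
    using c by (simp add: left_diff_distrib mult.commute[of x] del: of_nat_Suc)
  then show ?thesis using c by (simp add: abs_mult pos_le_divide_eq del: of_nat_Suc)
qed

lemma rnd_tendsto: "(\<lambda>k. rnd k x) \<longlonglongrightarrow> x"
proof -
  have "(\<lambda>k. rnd k x - x) \<longlonglongrightarrow> 0"
    by (rule Lim_null_comparison[OF _ LIMSEQ_Suc[OF lim_1_over_n]])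
      (use rnd_dist in \<open>auto simp del: of_nat_Suc\<close>)
  then show ?thesis by (rule LIM_zero_cancel)
qed

lemma rnd_finite_range:
  assumes "\<And>x. f x \<in> {l..b}" "l \<le> 0" "0 \<le> b"
  shows "finite (range (\<lambda>x. rnd k (f x)))"
proof (rule finite_subset)
  define N where "N = \<lceil>real (Suc k) * max (- l) b\<rceil>"
  show "range (\<lambda>x. rnd k (f x)) \<subseteq> (\<lambda>j. of_int j / real (Suc k)) ` {-N..N}"
  proof safe
    fix x
    define j where "j = (if 0 \<le> f x then \<lfloor>real (Suc k) * f x\<rfloor> else \<lceil>real (Suc k) * f x\<rceil>)"
    have r: "rnd k (f x) = of_int j / real (Suc k)" by (simp add: rnd_def j_def)
    have "\<bar>of_int j / real (Suc k)\<bar> \<le> max (- l) b"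
      using rnd_interval[OF assms(2,3,1), of k x] unfolding r by auto
    then have "\<bar>real_of_int j\<bar> \<le> real (Suc k) * max (- l) b" by (simp add: field_simps)
    then have "\<bar>j\<bar> \<le> N" unfolding N_def by linarith
    then show "rnd k (f x) \<in> (\<lambda>j. of_int j / real (Suc k)) ` {-N..N}"
      unfolding r by (intro imageI) auto
  qed
qed simp

text \<open>The linear bound puts \<open>G (f x) (g x)\<close> into \<open>L2\<close> although the
  measure may be infinite, dominates the rounded versions uniformly, and forces
  \<open>G 0 0 = 0\<close> when the box contains the origin.\<close>

definition linearly_bounded_on :: "real set \<Rightarrow> real set \<Rightarrow> (real \<Rightarrow> real \<Rightarrow> real) \<Rightarrow> bool" where
  "linearly_bounded_on U V G \<longleftrightarrow> continuous_on UNIV (\<lambda>v. G (fst v) (snd v))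
    \<and> (\<exists>B\<ge>0. \<forall>u\<in>U. \<forall>v\<in>V. \<bar>G u v\<bar> \<le> B * (\<bar>u\<bar> + \<bar>v\<bar>))"

lemma L2_rnd_tendsto:
  assumes f: "f \<in> L2 M" "\<And>x. f x \<in> {l..b}" "l \<le> 0" "0 \<le> b"
    and g: "g \<in> L2 M" "\<And>x. g x \<in> {l'..b'}" "l' \<le> 0" "0 \<le> b'"
    and G: "linearly_bounded_on {l..b} {l'..b'} G"
  shows "(\<lambda>x. G (f x) (g x)) \<in> L2 M" "(\<lambda>x. G (rnd k (f x)) (rnd k (g x))) \<in> L2 M"
    "(\<lambda>k. l2_norm M (\<lambda>x. G (rnd k (f x)) (rnd k (g x)) - G (f x) (g x))) \<longlonglongrightarrow> 0"
proof -
  obtain B where B: "0 \<le> B" and le: "\<And>u v. u \<in> {l..b} \<Longrightarrow> v \<in> {l'..b'} \<Longrightarrow> \<bar>G u v\<bar> \<le> B * (\<bar>u\<bar> + \<bar>v\<bar>)"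
    and cont: "continuous_on UNIV (\<lambda>v. G (fst v) (snd v))"
    using G unfolding linearly_bounded_on_def by blast
  note [measurable] = L2_measurable[OF f(1)] L2_measurable[OF g(1)]
  have Gm: "(\<lambda>x. G (h x) (h' x)) \<in> borel_measurable M"
    if [measurable]: "h \<in> borel_measurable M" "h' \<in> borel_measurable M" for h h'
    using measurable_compose[of "\<lambda>x. (h x, h' x)" M borel, OF _ borel_measurable_continuous_onI[OF cont]]
    by simp
  have abs: "(\<lambda>x. \<bar>h x\<bar>) \<in> L2 M" if "h \<in> L2 M" for h
    by (rule L2_dominated(1)[OF that, of _ 1]) (use L2_measurable[OF that] in auto)
  have wL: "(\<lambda>x. 2 * B * (\<bar>f x\<bar> + \<bar>g x\<bar>)) \<in> L2 M"
    by (intro L2.scale L2.add abs f g)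
  have le1: "\<bar>G (f x) (g x)\<bar> \<le> B * (\<bar>f x\<bar> + \<bar>g x\<bar>)" for x
    by (rule le[OF f(2) g(2)])
  have le2: "\<bar>G (rnd k (f x)) (rnd k (g x))\<bar> \<le> B * (\<bar>f x\<bar> + \<bar>g x\<bar>)" for k x
    using le[OF rnd_interval[OF f(3,4,2)] rnd_interval[OF g(3,4,2)], of k x k x]
      mult_left_mono[OF add_mono[OF rnd_abs rnd_abs] B, of k "f x" k "g x"] by linarith
  have w: "B * (\<bar>f x\<bar> + \<bar>g x\<bar>) \<le> \<bar>2 * B * (\<bar>f x\<bar> + \<bar>g x\<bar>)\<bar>" for x
    using B by simp
  show 1: "(\<lambda>x. G (f x) (g x)) \<in> L2 M"
    by (rule L2_dominated(1)[OF wL, of _ 1]) (auto intro!: Gm AE_I2 order_trans[OF le1 w])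
  show 2: "(\<lambda>x. G (rnd k (f x)) (rnd k (g x))) \<in> L2 M" for k
    by (rule L2_dominated(1)[OF wL, of _ 1]) (auto intro!: Gm AE_I2 order_trans[OF le2 w])
  show "(\<lambda>k. l2_norm M (\<lambda>x. G (rnd k (f x)) (rnd k (g x)) - G (f x) (g x))) \<longlonglongrightarrow> 0"
  proof (rule L2_dominated_convergence[OF L2_measurable[OF 1] L2_measurable[OF 2] wL])
    fix k x
    show "\<bar>G (rnd k (f x)) (rnd k (g x)) - G (f x) (g x)\<bar> \<le> \<bar>2 * B * (\<bar>f x\<bar> + \<bar>g x\<bar>)\<bar>"
      using le1[of x] le2[of k x] B by (simp add: abs_le_iff)
    have "isCont (\<lambda>v. G (fst v) (snd v)) (f x, g x)"
      using cont by (simp add: continuous_on_eq_continuous_at)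
    from isCont_tendsto_compose[OF this tendsto_Pair[OF rnd_tendsto rnd_tendsto]]
    show "(\<lambda>k. G (rnd k (f x)) (rnd k (g x))) \<longlonglongrightarrow> G (f x) (g x)" by simp
  qed
qed

context dirichlet_L2_form
begin

text \<open>
  The weights \<open>\<kappa>\<close> need no separate hypothesis: all functions vanish at \<open>(0, 0)\<close>, so their products are
  products of increments from there.
\<close>

lemma approx_transfer:
  fixes G H :: "nat \<Rightarrow> real \<Rightarrow> real \<Rightarrow> real"
  assumes f: "f \<in> L2 M" "\<And>x. f x \<in> {l..b}" "l \<le> 0" "0 \<le> b"
    and g: "g \<in> L2 M" "\<And>x. g x \<in> {l'..b'}" "l' \<le> 0" "0 \<le> b'"
    and J: "finite J"
    and lin: "\<And>j. j \<in> J \<Longrightarrow> linearly_bounded_on {l..b} {l'..b'} (G j)"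
      "\<And>j. j \<in> J \<Longrightarrow> linearly_bounded_on {l..b} {l'..b'} (H j)"
    and pos: "\<And>u v u' v'. u \<in> {l..b} \<Longrightarrow> u' \<in> {l..b} \<Longrightarrow> v \<in> {l'..b'} \<Longrightarrow> v' \<in> {l'..b'} \<Longrightarrow>
      0 \<le> (\<Sum>j\<in>J. c j * ((G j u v - G j u' v') * (H j u v - H j u' v')))"
  shows "0 \<le> (\<Sum>j\<in>J. c j * approx n (\<lambda>x. G j (f x) (g x)) (\<lambda>x. H j (f x) (g x)))"
proof (rule LIMSEQ_le_const)
  note G = L2_rnd_tendsto[OF f g lin(1)] and H = L2_rnd_tendsto[OF f g lin(2)]
  show "(\<lambda>k. \<Sum>j\<in>J. c j * approx n (\<lambda>x. G j (rnd k (f x)) (rnd k (g x))) (\<lambda>x. H j (rnd k (f x)) (rnd k (g x))))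
      \<longlonglongrightarrow> (\<Sum>j\<in>J. c j * approx n (\<lambda>x. G j (f x) (g x)) (\<lambda>x. H j (f x) (g x)))"
    by (intro tendsto_intros approx_tendsto G H)
  have nonneg: "0 \<le> (\<Sum>j\<in>J. c j * approx n (\<lambda>x. G j (rnd k (f x)) (rnd k (g x))) (\<lambda>x. H j (rnd k (f x)) (rnd k (g x))))"
    for k
  proof -
    note [measurable] = L2_measurable[OF f(1)] L2_measurable[OF g(1)]
    define p where "p x = (rnd k (f x), rnd k (g x))" for x
    have fin: "finite (range p)"
      by (rule finite_subset[of _ "range (\<lambda>x. rnd k (f x)) \<times> range (\<lambda>x. rnd k (g x))"])
        (auto simp: p_def intro!: rnd_finite_range[OF f(2-4)] rnd_finite_range[OF g(2-4)])
    have [measurable]: "p \<in> measurable M borel" unfolding p_def by measurable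
    \<comment> \<open>One coordinate of \<open>v\<close> is nonzero. On the level set the
      corresponding function is at least that coordinate in absolute value, because rounding never
      increases absolute values; so a multiple of that function dominates the indicator.\<close>
    have ind: "indicator (p -` {v}) \<in> L2 M" if "v \<noteq> 0" for v
    proof -
      have "p -` {v} \<in> sets M" using measurable_sets[of p M borel "{v}"] by (simp add: space)
      then have m: "(indicator (p -` {v}) :: 'a \<Rightarrow> real) \<in> borel_measurable M" by simp
      show ?thesis
      proof (cases "fst v = 0")
        case True
        with that have v: "snd v \<noteq> 0" by (auto simp: prod_eq_iff)
        show ?thesis
          by (rule L2_dominated(1)[OF g(1) m, of "1 / \<bar>snd v\<bar>"])
            (use v rnd_abs[of k] in \<open>auto simp: indicator_def p_def field_simps\<close>)
      next
        case False
        then show ?thesis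
          by (intro L2_dominated(1)[OF f(1) m, of "1 / \<bar>fst v\<bar>"])
            (use rnd_abs[of k] in \<open>auto simp: indicator_def p_def field_simps\<close>)
      qed
    qed
    obtain I t \<kappa> where I: "finite I" "I \<subseteq> range p" "\<And>u. u \<in> I \<Longrightarrow> 0 \<le> \<kappa> u"
      "\<And>u v. u \<in> I \<Longrightarrow> v \<in> I \<Longrightarrow> 0 \<le> t u v"
      "\<And>G H. G 0 = 0 \<Longrightarrow> H 0 = 0 \<Longrightarrow> approx n (\<lambda>x. G (p x)) (\<lambda>x. H (p x))
        = (\<Sum>u\<in>I. \<kappa> u * (G u * H u)) + (\<Sum>u\<in>I. \<Sum>v\<in>I. t u v * ((G u - G v) * (H u - H v)))"
      by (rule approx_simple[OF fin ind, of 0 n]) blast+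
    have box: "fst u \<in> {l..b}" "snd u \<in> {l'..b'}" if "u \<in> I" for u
      using that I(2) rnd_interval[OF f(3,4,2), of k] rnd_interval[OF g(3,4,2), of k]
      unfolding p_def by auto
    define G' where "G' j u = G j (fst u) (snd u)" for j and u :: "real \<times> real"
    define H' where "H' j u = H j (fst u) (snd u)" for j and u :: "real \<times> real"
    have zero: "K 0 0 = 0" if "linearly_bounded_on {l..b} {l'..b'} K" for K
      using that f(3,4) g(3,4) unfolding linearly_bounded_on_def by force
    have G0: "G' j 0 = 0" "H' j 0 = 0" if "j \<in> J" for j
      using zero[OF lin(1)[OF that]] zero[OF lin(2)[OF that]] by (simp_all add: G'_def H'_def)
    have "(\<Sum>j\<in>J. c j * approx n (\<lambda>x. G j (rnd k (f x)) (rnd k (g x))) (\<lambda>x. H j (rnd k (f x)) (rnd k (g x))))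
        = (\<Sum>j\<in>J. c j * approx n (\<lambda>x. G' j (p x)) (\<lambda>x. H' j (p x)))"
      by (simp add: G'_def H'_def p_def)
    also have "\<dots> = (\<Sum>j\<in>J. c j * ((\<Sum>u\<in>I. \<kappa> u * (G' j u * H' j u))
        + (\<Sum>u\<in>I. \<Sum>v\<in>I. t u v * ((G' j u - G' j v) * (H' j u - H' j v)))))"
      by (intro sum.cong refl) (simp add: I(5) G0)
    also have "\<dots> = (\<Sum>j\<in>J. \<Sum>u\<in>I. \<kappa> u * (c j * (G' j u * H' j u)))
        + (\<Sum>j\<in>J. \<Sum>u\<in>I. \<Sum>v\<in>I. t u v * (c j * ((G' j u - G' j v) * (H' j u - H' j v))))"
      by (simp add: distrib_left sum.distrib sum_distrib_left mult.left_commute)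
    also have "(\<Sum>j\<in>J. \<Sum>u\<in>I. \<kappa> u * (c j * (G' j u * H' j u)))
        = (\<Sum>u\<in>I. \<kappa> u * (\<Sum>j\<in>J. c j * (G' j u * H' j u)))"
      unfolding sum_distrib_left by (rule sum.swap)
    also have "(\<Sum>j\<in>J. \<Sum>u\<in>I. \<Sum>v\<in>I. t u v * (c j * ((G' j u - G' j v) * (H' j u - H' j v))))
        = (\<Sum>u\<in>I. \<Sum>v\<in>I. t u v * (\<Sum>j\<in>J. c j * ((G' j u - G' j v) * (H' j u - H' j v))))"
      unfolding sum_distrib_left
      by (subst sum.swap, intro sum.cong refl, rule sum.swap)
    also have "0 \<le> (\<Sum>u\<in>I. \<kappa> u * (\<Sum>j\<in>J. c j * (G' j u * H' j u)))
        + (\<Sum>u\<in>I. \<Sum>v\<in>I. t u v * (\<Sum>j\<in>J. c j * ((G' j u - G' j v) * (H' j u - H' j v))))"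
    proof -
      have "0 \<le> (\<Sum>j\<in>J. c j * ((G' j u - G' j v) * (H' j u - H' j v)))" if "u \<in> I" "v \<in> I" for u v
        unfolding G'_def H'_def by (intro pos box that)
      moreover have "0 \<le> (\<Sum>j\<in>J. c j * (G' j u * H' j u))" if u: "u \<in> I" for u
      proof -
        have "0 \<le> (\<Sum>j\<in>J. c j * ((G j (fst u) (snd u) - G j 0 0) * (H j (fst u) (snd u) - H j 0 0)))"
          by (intro pos box u) (use f g in auto)
        also have "\<dots> = (\<Sum>j\<in>J. c j * (G' j u * H' j u))"
          using G0 by (intro sum.cong) (auto simp: G'_def H'_def)
        finally show ?thesis .
      qed
      ultimately show ?thesis
        by (intro add_nonneg_nonneg sum_nonneg[where A = I] mult_nonneg_nonneg[OF I(3)]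
            mult_nonneg_nonneg[OF I(4)])
    qed
    finally show ?thesis .
  qed
  then show "\<exists>N. \<forall>k\<ge>N. 0 \<le> (\<Sum>j\<in>J. c j * approx n (\<lambda>x. G j (rnd k (f x)) (rnd k (g x))) (\<lambda>x. H j (rnd k (f x)) (rnd k (g x))))"
    by blast
qed

lemma linearly_bounded_on_basic:
  "linearly_bounded_on U V (\<lambda>u v. u)" "linearly_bounded_on U V (\<lambda>u v. v)"
  "linearly_bounded_on U {l..b} (\<lambda>u v. u * v)" "linearly_bounded_on U {l..b} (\<lambda>u v. v\<^sup>2)"
proof -
  have le: "\<bar>v\<bar> \<le> max \<bar>l\<bar> \<bar>b\<bar>" if "v \<in> {l..b}" for v :: real using that by auto
  show "linearly_bounded_on U V (\<lambda>u v. u)" "linearly_bounded_on U V (\<lambda>u v. v)"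
    unfolding linearly_bounded_on_def by (auto intro!: continuous_intros exI[of _ 1])
  have "\<bar>u * v\<bar> \<le> max \<bar>l\<bar> \<bar>b\<bar> * (\<bar>u\<bar> + \<bar>v\<bar>)" if "v \<in> {l..b}" for u v :: real
  proof -
    have "\<bar>u * v\<bar> \<le> max \<bar>l\<bar> \<bar>b\<bar> * \<bar>u\<bar>"
      using mult_right_mono[OF le[OF that] abs_ge_zero[of u]] by (simp add: abs_mult mult.commute)
    also have "\<dots> \<le> max \<bar>l\<bar> \<bar>b\<bar> * (\<bar>u\<bar> + \<bar>v\<bar>)" by (intro mult_left_mono) auto
    finally show ?thesis .
  qed
  then show "linearly_bounded_on U {l..b} (\<lambda>u v. u * v)"
    unfolding linearly_bounded_on_def
    by (auto intro!: continuous_intros exI[of _ "max \<bar>l\<bar> \<bar>b\<bar>"])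
  have "\<bar>v\<^sup>2\<bar> \<le> max \<bar>l\<bar> \<bar>b\<bar> * (\<bar>u\<bar> + \<bar>v\<bar>)" if "v \<in> {l..b}" for u v :: real
  proof -
    have "\<bar>v\<^sup>2\<bar> \<le> max \<bar>l\<bar> \<bar>b\<bar> * \<bar>v\<bar>"
      using mult_right_mono[OF le[OF that] abs_ge_zero[of v]]
      by (simp add: power2_eq_square abs_mult_self_eq)
    also have "\<dots> \<le> max \<bar>l\<bar> \<bar>b\<bar> * (\<bar>u\<bar> + \<bar>v\<bar>)" by (intro mult_left_mono) auto
    finally show ?thesis .
  qed
  then show "linearly_bounded_on U {l..b} (\<lambda>u v. v\<^sup>2)"
    unfolding linearly_bounded_on_def
    by (auto intro!: continuous_intros exI[of _ "max \<bar>l\<bar> \<bar>b\<bar>"])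
qed

text \<open>The Leibniz rule for increments, x y - x' y' = x (y - y') + y' (x - x'), is squared and
  fed into \<open>approx_transfer\<close>. The three forms are indexed through lists, with
  coefficient -1 for the product.\<close>

lemma approx_mult_le:
  assumes f: "f \<in> L2 M" "\<And>x. \<bar>f x\<bar> \<le> K" and g: "g \<in> L2 M" "\<And>x. \<bar>g x\<bar> \<le> L"
  shows "(\<lambda>x. f x * g x) \<in> L2 M"
    "approx n (\<lambda>x. f x * g x) (\<lambda>x. f x * g x) \<le> 2 * K\<^sup>2 * approx n g g + 2 * L\<^sup>2 * approx n f f"
proof -
  have K: "0 \<le> K" using f(2) abs_ge_zero order_trans by blast
  have L: "0 \<le> L" using g(2) abs_ge_zero order_trans by blast
  have box: "f x \<in> {-K..K}" "g x \<in> {-L..L}" for x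
    using f(2)[of x] g(2)[of x] by (auto simp: abs_le_iff)
  show "(\<lambda>x. f x * g x) \<in> L2 M"
    by (rule L2_rnd_tendsto(1)[OF f(1) box(1) _ K g(1) box(2) _ L linearly_bounded_on_basic(3)])
      (use K L in auto)
  have pt: "(x * y - x' * y')\<^sup>2 \<le> 2 * K\<^sup>2 * (y - y')\<^sup>2 + 2 * L\<^sup>2 * (x - x')\<^sup>2"
    if "\<bar>x\<bar> \<le> K" "\<bar>y'\<bar> \<le> L" for x y x' y' :: real
  proof -
    have "x * y - x' * y' = x * (y - y') + y' * (x - x')" by (simp add: algebra_simps)
    then have "(x * y - x' * y')\<^sup>2 \<le> 2 * (x * (y - y'))\<^sup>2 + 2 * (y' * (x - x'))\<^sup>2"
      using sum_squares_ge_zero[of "x * (y - y') - y' * (x - x')" 0]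
      by (simp add: power2_eq_square algebra_simps)
    also have "\<dots> = 2 * (x\<^sup>2 * (y - y')\<^sup>2) + 2 * (y'\<^sup>2 * (x - x')\<^sup>2)"
      by (simp add: power_mult_distrib)
    also have "\<dots> \<le> 2 * (K\<^sup>2 * (y - y')\<^sup>2) + 2 * (L\<^sup>2 * (x - x')\<^sup>2)"
      using that power_mono[OF that(1), of 2] power_mono[OF that(2), of 2]
      by (intro add_mono mult_left_mono mult_right_mono) auto
    finally show ?thesis by (simp add: mult.assoc)
  qed
  define G :: "nat \<Rightarrow> real \<Rightarrow> real \<Rightarrow> real" where "G = (!) [\<lambda>u v. u * v, \<lambda>u v. v, \<lambda>u v. u]"
  define c where "c = (!) [- 1, 2 * K\<^sup>2, 2 * L\<^sup>2]"
  have lin: "linearly_bounded_on {-K..K} {-L..L} (G j)" if "j \<in> {0, 1, 2}" for j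
    using that by (auto simp: G_def linearly_bounded_on_basic)
  have "0 \<le> (\<Sum>j\<in>{0, 1, 2}. c j * approx n (\<lambda>x. G j (f x) (g x)) (\<lambda>x. G j (f x) (g x)))"
  proof (rule approx_transfer[OF f(1) box(1) _ K g(1) box(2) _ L _ lin lin])
    fix u u' v v' assume "u \<in> {-K..K}" "u' \<in> {-K..K}" "v \<in> {-L..L}" "v' \<in> {-L..L}"
    then show "0 \<le> (\<Sum>j\<in>{0, 1, 2}. c j * ((G j u v - G j u' v') * (G j u v - G j u' v')))"
      using pt[of u v' v u'] by (simp add: G_def c_def power2_eq_square abs_le_iff)
  qed (use K L in auto)
  then show "approx n (\<lambda>x. f x * g x) (\<lambda>x. f x * g x) \<le> 2 * K\<^sup>2 * approx n g g + 2 * L\<^sup>2 * approx n f f"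
    by (simp add: G_def c_def)
qed

text \<open>On increments the cross terms cancel and the truncated form becomes (u + u')/2 times (v
  - v')^2; the mean of two values of \<open>f\<close> lies between 0 and \<open>C\<close>.\<close>

lemma approx_truncated:
  assumes f: "f \<in> L2 M" "\<And>x. 0 \<le> f x" "\<And>x. f x \<le> C" and g: "g \<in> L2 M" "\<And>x. \<bar>g x\<bar> \<le> L"
  shows "0 \<le> approx n (\<lambda>x. f x * g x) g - approx n f (\<lambda>x. (g x)\<^sup>2) / 2"
    "approx n (\<lambda>x. f x * g x) g - approx n f (\<lambda>x. (g x)\<^sup>2) / 2 \<le> C * approx n g g"
proof -
  have C: "0 \<le> C" using f(2,3) order_trans by blast
  have L: "0 \<le> L" using g(2) abs_ge_zero order_trans by blast
  have box: "f x \<in> {0..C}" "g x \<in> {-L..L}" for x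
    using f(2,3)[of x] g(2)[of x] by (auto simp: abs_le_iff)
  define G :: "nat \<Rightarrow> real \<Rightarrow> real \<Rightarrow> real" where "G = (!) [\<lambda>u v. u * v, \<lambda>u v. u, \<lambda>u v. v]"
  define H :: "nat \<Rightarrow> real \<Rightarrow> real \<Rightarrow> real" where "H = (!) [\<lambda>u v. v, \<lambda>u v. v\<^sup>2, \<lambda>u v. v]"
  have lin: "linearly_bounded_on {0..C} {-L..L} (G j)" "linearly_bounded_on {0..C} {-L..L} (H j)"
    if "j \<in> {0, 1, 2}" for j
    using that by (auto simp: G_def H_def linearly_bounded_on_basic)
  have pt: "(u * v - u' * v') * (v - v') - (u - u') * (v\<^sup>2 - v'\<^sup>2) / 2 = (u + u') / 2 * (v - v')\<^sup>2"
    for u v u' v' :: real by (simp add: power2_eq_square field_simps)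
  have le: "0 \<le> (u + u') / 2 * (v - v')\<^sup>2 \<and> (u + u') / 2 * (v - v')\<^sup>2 \<le> C * (v - v')\<^sup>2"
    if "u \<in> {0..C}" "u' \<in> {0..C}" for u u' v v' :: real
    using that by (intro conjI mult_nonneg_nonneg mult_right_mono) auto
  \<comment> \<open>The third pair belongs to the upper bound below; here its coefficient is
    0.\<close>
  have "0 \<le> (\<Sum>j\<in>{0, 1, 2}. ((!) [1, - 1/2, 0]) j * approx n (\<lambda>x. G j (f x) (g x)) (\<lambda>x. H j (f x) (g x)))"
  proof (rule approx_transfer[OF f(1) box(1) _ C g(1) box(2) _ L _ lin])
    fix u u' v v' assume u: "u \<in> {0..C}" "u' \<in> {0..C}"
    have "(\<Sum>j\<in>{0, 1, 2}. ((!) [1, - 1/2, 0]) j * ((G j u v - G j u' v') * (H j u v - H j u' v')))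
        = (u * v - u' * v') * (v - v') - (u - u') * (v\<^sup>2 - v'\<^sup>2) / 2"
      by (simp add: G_def H_def power2_eq_square)
    then show "0 \<le> (\<Sum>j\<in>{0, 1, 2}. ((!) [1, - 1/2, 0]) j * ((G j u v - G j u' v') * (H j u v - H j u' v')))"
      using le[OF u, of v v'] unfolding pt by simp
  qed (use L in auto)
  then show "0 \<le> approx n (\<lambda>x. f x * g x) g - approx n f (\<lambda>x. (g x)\<^sup>2) / 2"
    by (simp add: G_def H_def)
  have "0 \<le> (\<Sum>j\<in>{0, 1, 2}. ((!) [- 1, 1/2, C]) j * approx n (\<lambda>x. G j (f x) (g x)) (\<lambda>x. H j (f x) (g x)))"
  proof (rule approx_transfer[OF f(1) box(1) _ C g(1) box(2) _ L _ lin])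
    fix u u' v v' assume u: "u \<in> {0..C}" "u' \<in> {0..C}"
    have "(\<Sum>j\<in>{0, 1, 2}. ((!) [- 1, 1/2, C]) j * ((G j u v - G j u' v') * (H j u v - H j u' v')))
        = C * (v - v')\<^sup>2 - ((u * v - u' * v') * (v - v') - (u - u') * (v\<^sup>2 - v'\<^sup>2) / 2)"
      by (simp add: G_def H_def power2_eq_square)
    then show "0 \<le> (\<Sum>j\<in>{0, 1, 2}. ((!) [- 1, 1/2, C]) j * ((G j u v - G j u' v') * (H j u v - H j u' v')))"
      using le[OF u, of v v'] unfolding pt by simp
  qed (use L in auto)
  then show "approx n (\<lambda>x. f x * g x) g - approx n f (\<lambda>x. (g x)\<^sup>2) / 2 \<le> C * approx n g g"
    by (simp add: G_def H_def)
qed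

end

section \<open>Products and truncated forms\<close>

lemma LinfE:
  assumes "f \<in> Linf M"
  obtains K where "0 \<le> K" "AE x in M. \<bar>f x\<bar> \<le> K" "f \<in> borel_measurable M"
proof -
  obtain C where "AE x in M. \<bar>f x\<bar> \<le> C" "f \<in> borel_measurable M"
    using assms by (auto simp: Linf_def)
  then show thesis by (intro that[of "max 0 C"]) (auto elim: eventually_mono)
qed

context dirichlet_L2_form
begin

text \<open>\<open>approx_transfer\<close> works with bounds at every point, hence the clamped
  representatives. The bound of \<open>approx_mult_le\<close>, multiplied by \<open>n + 1\<close>,
  stays below the claimed energy for all \<open>n\<close>, and \<open>approx_bounded_dom\<close>
  applies.\<close>

lemma mult_le:
  assumes f: "f \<in> fdom a" "0 \<le> K" "AE x in M. \<bar>f x\<bar> \<le> K"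
    and g: "g \<in> fdom a" "0 \<le> L" "AE x in M. \<bar>g x\<bar> \<le> L"
  shows "(\<lambda>x. f x * g x) \<in> fdom a"
    "fval a (\<lambda>x. f x * g x) (\<lambda>x. f x * g x) \<le> 2 * K\<^sup>2 * fval a g g + 2 * L\<^sup>2 * fval a f f"
proof -
  define f' where "f' x = max (- K) (min (f x) K)" for x
  define g' where "g' x = max (- L) (min (g x) L)" for x
  have [measurable]: "f \<in> borel_measurable M" "g \<in> borel_measurable M"
    using L2_measurable[OF dom_L2] f g by auto
  have mf: "f' \<in> borel_measurable M" and mg: "g' \<in> borel_measurable M"
    unfolding f'_def g'_def by measurable
  have ef: "AE x in M. f x = f' x" using f(3) by eventually_elim (auto simp: f'_def)
  have eg: "AE x in M. g x = g' x" using g(3) by eventually_elim (auto simp: g'_def)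
  have f': "f' \<in> fdom a" by (rule dom_cong[OF f(1) mf ef])
  have g': "g' \<in> fdom a" by (rule dom_cong[OF g(1) mg eg])
  have bf: "\<bar>f' x\<bar> \<le> K" for x using f(2) by (auto simp: f'_def)
  have bg: "\<bar>g' x\<bar> \<le> L" for x using g(2) by (auto simp: g'_def)
  note ap = approx_mult_le[OF dom_L2[OF f'] bf dom_L2[OF g'] bg]
  have le: "real (Suc n) * approx n (\<lambda>x. f' x * g' x) (\<lambda>x. f' x * g' x)
      \<le> 2 * K\<^sup>2 * fval a g' g' + 2 * L\<^sup>2 * fval a f' f'" for n
  proof -
    have "real (Suc n) * approx n (\<lambda>x. f' x * g' x) (\<lambda>x. f' x * g' x)
        \<le> real (Suc n) * (2 * K\<^sup>2 * approx n g' g' + 2 * L\<^sup>2 * approx n f' f')"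
      by (intro mult_left_mono ap) simp
    also have "\<dots> = 2 * K\<^sup>2 * (real (Suc n) * approx n g' g') + 2 * L\<^sup>2 * (real (Suc n) * approx n f' f')"
      by (simp add: algebra_simps)
    also have "\<dots> \<le> 2 * K\<^sup>2 * fval a g' g' + 2 * L\<^sup>2 * fval a f' f'"
      by (intro add_mono mult_left_mono approx_le_fval f' g') auto
    finally show ?thesis .
  qed
  note r = approx_bounded_dom[OF dense ap(1) le]
  have e: "AE x in M. f' x * g' x = f x * g x" using ef eg by eventually_elim simp
  have m: "(\<lambda>x. f x * g x) \<in> borel_measurable M" by measurable
  show "(\<lambda>x. f x * g x) \<in> fdom a" by (rule dom_cong[OF r(1) m e])
  show "fval a (\<lambda>x. f x * g x) (\<lambda>x. f x * g x) \<le> 2 * K\<^sup>2 * fval a g g + 2 * L\<^sup>2 * fval a f f"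
    using r(2) fval_cong[OF r(1) m e r(1) m e] fval_cong[OF f(1) mf ef f(1) mf ef]
      fval_cong[OF g(1) mg eg g(1) mg eg] by simp
qed

definition Db :: "('a \<Rightarrow> real) set" where
  "Db = fdom a \<inter> Linf M"

lemma Db_D: "f \<in> Db \<Longrightarrow> f \<in> fdom a"
  by (simp add: Db_def)

lemma Db_measurable: "f \<in> Db \<Longrightarrow> f \<in> borel_measurable M"
  by (simp add: Db_def Linf_def)

lemma Db_I: "f \<in> fdom a \<Longrightarrow> AE x in M. \<bar>f x\<bar> \<le> K \<Longrightarrow> f \<in> Db"
  using L2_measurable[OF dom_L2] by (auto simp: Db_def Linf_def)

lemma Db_E:
  assumes "f \<in> Db"
  obtains K where "0 \<le> K" "AE x in M. \<bar>f x\<bar> \<le> K" "f \<in> fdom a"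
  using assms by (auto simp: Db_def elim: LinfE)

lemma Db_mult:
  assumes "f \<in> Db" "g \<in> Db"
  shows "(\<lambda>x. f x * g x) \<in> Db"
proof -
  obtain K where K: "0 \<le> K" "AE x in M. \<bar>f x\<bar> \<le> K" "f \<in> fdom a" using assms(1) by (rule Db_E)
  obtain L where L: "0 \<le> L" "AE x in M. \<bar>g x\<bar> \<le> L" "g \<in> fdom a" using assms(2) by (rule Db_E)
  have "AE x in M. \<bar>f x * g x\<bar> \<le> K * L"
    using K(2) L(2) by eventually_elim (auto simp: abs_mult intro: mult_mono)
  then show ?thesis by (intro Db_I mult_le[OF K(3,1,2) L(3,1,2)])
qed

lemma Db_zero: "(\<lambda>_. 0) \<in> Db"
  by (rule Db_I[of _ 0]) (auto simp: E.zero)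

lemma Db_scale: "f \<in> Db \<Longrightarrow> (\<lambda>x. c * f x) \<in> Db"
proof -
  assume "f \<in> Db"
  then obtain K where K: "0 \<le> K" "AE x in M. \<bar>f x\<bar> \<le> K" "f \<in> fdom a" by (rule Db_E)
  have "AE x in M. \<bar>c * f x\<bar> \<le> \<bar>c\<bar> * K"
    using K(2) by eventually_elim (auto simp: abs_mult intro: mult_left_mono)
  then show ?thesis by (intro Db_I E.scale K)
qed

lemma Db_add: "f \<in> Db \<Longrightarrow> g \<in> Db \<Longrightarrow> (\<lambda>x. f x + g x) \<in> Db"
proof -
  assume "f \<in> Db" "g \<in> Db"
  from this(1) obtain K where K: "0 \<le> K" "AE x in M. \<bar>f x\<bar> \<le> K" "f \<in> fdom a" by (rule Db_E)
  from \<open>g \<in> Db\<close> obtain L where L: "0 \<le> L" "AE x in M. \<bar>g x\<bar> \<le> L" "g \<in> fdom a" by (rule Db_E)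
  have "AE x in M. \<bar>f x + g x\<bar> \<le> K + L"
    using K(2) L(2) by eventually_elim auto
  then show ?thesis by (intro Db_I E.add K L)
qed

lemma Db_diff: "f \<in> Db \<Longrightarrow> g \<in> Db \<Longrightarrow> (\<lambda>x. f x - g x) \<in> Db"
  using Db_add[of f "\<lambda>x. (-1) * g x"] Db_scale[of g "-1"] by simp

text \<open>The bounds of \<open>approx_truncated\<close>, multiplied by \<open>n + 1\<close>,
  converge to the claim, since \<open>mult_le\<close> places the products that occur in the
  domain.\<close>

lemma truncated_bounds:
  assumes f: "f \<in> fdom a" "0 \<le> C" "AE x in M. 0 \<le> f x \<and> f x \<le> C"
    and g: "g \<in> fdom a" "0 \<le> L" "AE x in M. \<bar>g x\<bar> \<le> L"
  shows "0 \<le> truncated_form a f g" "truncated_form a f g \<le> C * fval a g g"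
proof -
  define f' where "f' x = max 0 (min (f x) C)" for x
  define g' where "g' x = max (- L) (min (g x) L)" for x
  have [measurable]: "f \<in> borel_measurable M" "g \<in> borel_measurable M"
    using L2_measurable[OF dom_L2] f g by auto
  have mf: "f' \<in> borel_measurable M" and mg: "g' \<in> borel_measurable M"
    unfolding f'_def g'_def by measurable
  have ef: "AE x in M. f x = f' x" using f(3) by eventually_elim (auto simp: f'_def)
  have eg: "AE x in M. g x = g' x" using g(3) by eventually_elim (auto simp: g'_def)
  have f': "f' \<in> fdom a" by (rule dom_cong[OF f(1) mf ef])
  have g': "g' \<in> fdom a" by (rule dom_cong[OF g(1) mg eg])
  have bf: "0 \<le> f' x" "f' x \<le> C" for x using f(2) by (auto simp: f'_def)
  have bg: "\<bar>g' x\<bar> \<le> L" for x using g(2) by (auto simp: g'_def)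
  note ap = approx_truncated[OF dom_L2[OF f'] bf dom_L2[OF g'] bg]
  have fb: "f' \<in> Db" using bf by (intro Db_I[OF f', of C]) auto
  have gb: "g' \<in> Db" using bg by (intro Db_I[OF g', of L]) auto
  have fg: "(\<lambda>x. f' x * g' x) \<in> fdom a" by (intro Db_D Db_mult fb gb)
  have gg: "(\<lambda>x. (g' x)\<^sup>2) \<in> fdom a" using Db_D[OF Db_mult[OF gb gb]] by (simp add: power2_eq_square)
  have l1: "(\<lambda>n. real (Suc n) * approx n (\<lambda>x. f' x * g' x) g' - real (Suc n) * approx n f' (\<lambda>x. (g' x)\<^sup>2) / 2)
      \<longlonglongrightarrow> truncated_form a f' g'"
    unfolding truncated_form_def by (intro tendsto_intros approx_limit fg gg f' g') simp
  have l2: "(\<lambda>n. C * (real (Suc n) * approx n g' g')) \<longlonglongrightarrow> C * fval a g' g'"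
    by (intro tendsto_intros approx_limit g')
  have e1: "real (Suc n) * approx n (\<lambda>x. f' x * g' x) g' - real (Suc n) * approx n f' (\<lambda>x. (g' x)\<^sup>2) / 2
      = real (Suc n) * (approx n (\<lambda>x. f' x * g' x) g' - approx n f' (\<lambda>x. (g' x)\<^sup>2) / 2)" for n
    by (simp add: algebra_simps)
  have "0 \<le> truncated_form a f' g'"
    by (rule LIMSEQ_le_const[OF l1]) (auto simp only: e1 intro!: mult_nonneg_nonneg ap)
  moreover have "truncated_form a f' g' \<le> C * fval a g' g'"
  proof (rule LIMSEQ_le[OF l1 l2], intro exI allI impI)
    fix n
    show "real (Suc n) * approx n (\<lambda>x. f' x * g' x) g' - real (Suc n) * approx n f' (\<lambda>x. (g' x)\<^sup>2) / 2
        \<le> C * (real (Suc n) * approx n g' g')"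
      unfolding e1 mult.left_commute[of C] by (intro mult_left_mono ap) simp
  qed
  moreover have "truncated_form a f g = truncated_form a f' g'"
  proof -
    have e: "AE x in M. f' x * g' x = f x * g x" using ef eg by eventually_elim simp
    have e2: "AE x in M. (g' x)\<^sup>2 = (g x)\<^sup>2" using eg by eventually_elim simp
    have eg': "AE x in M. g' x = g x" and ef': "AE x in M. f' x = f x"
      using eg ef by (auto elim: eventually_mono)
    have "fval a (\<lambda>x. f' x * g' x) g' = fval a (\<lambda>x. f x * g x) g"
      by (rule fval_cong[OF fg _ e g' _ eg']) measurable
    moreover have "fval a f' (\<lambda>x. (g' x)\<^sup>2) = fval a f (\<lambda>x. (g x)\<^sup>2)"
      by (rule fval_cong[OF f' _ ef' gg _ e2]) measurable
    ultimately show ?thesis by (simp add: truncated_form_def)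
  qed
  moreover have "fval a g g = fval a g' g'" by (rule fval_cong[OF g(1) mg eg g(1) mg eg])
  ultimately show "0 \<le> truncated_form a f g" "truncated_form a f g \<le> C * fval a g g" by simp_all
qed

section \<open>Truncated forms as semi-inner products and their extension by continuity\<close>

definition cutoff :: "('a \<Rightarrow> real) \<Rightarrow> bool" where
  "cutoff w \<longleftrightarrow> w \<in> Db \<and> (AE x in M. 0 \<le> w x \<and> w x \<le> 1)"

lemma cutoffs_cutoff: "w \<in> cutoffs M a \<Omega> \<Longrightarrow> cutoff w"
proof -
  assume w: "w \<in> cutoffs M a \<Omega>"
  then have "AE x in M. 0 \<le> w x \<and> w x \<le> indicator \<Omega> x" by (simp add: cutoffs_def)
  then have "AE x in M. 0 \<le> w x \<and> w x \<le> 1"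
    by eventually_elim (meson indicator_le_1 order_trans)
  then show ?thesis using w by (simp add: cutoffs_def cutoff_def Db_def)
qed

text \<open>Polarization of the truncated form. For a form with a carre du champ Gamma it is the
  integral of \<open>w\<close> times Gamma(f, g). Being a semi-inner product, it gives the triangle
  inequality for the square root of the truncated form.\<close>

definition truncated_inner :: "('a \<Rightarrow> real) \<Rightarrow> ('a \<Rightarrow> real) \<Rightarrow> ('a \<Rightarrow> real) \<Rightarrow> real" where
  "truncated_inner w f g =
    (fval a (\<lambda>x. w x * f x) g + fval a (\<lambda>x. w x * g x) f - fval a w (\<lambda>x. f x * g x)) / 2"

lemma truncated_inner_self: "truncated_inner w f f = truncated_form a w f"
  by (simp add: truncated_inner_def truncated_form_def power2_eq_square diff_divide_distrib)

lemma cutoff_bounds: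
  assumes w: "cutoff w" and f: "f \<in> Db"
  shows "0 \<le> truncated_form a w f" "truncated_form a w f \<le> fval a f f"
proof -
  obtain L where L: "0 \<le> L" "AE x in M. \<bar>f x\<bar> \<le> L" "f \<in> fdom a" using f by (rule Db_E)
  show "0 \<le> truncated_form a w f" "truncated_form a w f \<le> fval a f f"
    using truncated_bounds[of w 1, OF _ _ _ L(3,1,2)] w by (auto simp: cutoff_def Db_def)
qed

lemma truncated_semi_inner:
  assumes w: "cutoff w"
  shows "semi_inner Db (truncated_inner w)"
proof unfold_locales
  fix f g h :: "'a \<Rightarrow> real" and c :: real
  have wb: "w \<in> Db" using w by (simp add: cutoff_def)
  assume f: "f \<in> Db"
  show "(\<lambda>x. c * f x) \<in> Db" by (rule Db_scale[OF f])
  show "0 \<le> truncated_inner w f f" using cutoff_bounds[OF w f] by (simp add: truncated_inner_self)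
  assume g: "g \<in> Db"
  show "(\<lambda>x. f x + g x) \<in> Db" by (rule Db_add[OF f g])
  show "truncated_inner w f g = truncated_inner w g f"
    by (simp add: truncated_inner_def mult.commute)
  have "(\<lambda>x. w x * (c * f x)) = (\<lambda>x. c * (w x * f x))" "(\<lambda>x. c * f x * g x) = (\<lambda>x. c * (f x * g x))"
    by (auto simp: algebra_simps)
  then show "truncated_inner w (\<lambda>x. c * f x) g = c * truncated_inner w f g"
    by (simp add: truncated_inner_def E.q_scale E.q_scale_right Db_D Db_mult wb f g algebra_simps)
  assume h: "h \<in> Db"
  have "(\<lambda>x. w x * (f x + g x)) = (\<lambda>x. w x * f x + w x * g x)"
    "(\<lambda>x. (f x + g x) * h x) = (\<lambda>x. f x * h x + g x * h x)"
    by (auto simp: algebra_simps)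
  then show "truncated_inner w (\<lambda>x. f x + g x) h = truncated_inner w f h + truncated_inner w g h"
    by (simp add: truncated_inner_def E.q_add E.q_add_right Db_D Db_mult wb f g h add_divide_distrib diff_divide_distrib)
qed (rule Db_zero)

lemma qnorm_truncated_le:
  "cutoff w \<Longrightarrow> f \<in> Db \<Longrightarrow> qnorm (truncated_inner w) f \<le> qnorm (fval a) f"
  using cutoff_bounds[of w f] by (simp add: qnorm_def truncated_inner_self)

lemma sqrt_truncated_le_add:
  assumes w: "cutoff w" and f: "f \<in> Db" and g: "g \<in> Db"
  shows "sqrt (truncated_form a w f) \<le> sqrt (truncated_form a w g) + qnorm (fval a) (\<lambda>x. f x - g x)"
proof -
  interpret T: semi_inner Db "truncated_inner w" by (rule truncated_semi_inner[OF w])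
  show ?thesis
    using T.qnorm_le_add_diff[OF f g] qnorm_truncated_le[OF w Db_diff[OF f g]]
    unfolding qnorm_def[of "truncated_inner w"] truncated_inner_self by linarith
qed

lemma fval_tendsto_diff:
  assumes "\<And>n. u n \<in> fdom a" "\<And>n. v n \<in> fdom a" "f \<in> fdom a" "g \<in> fdom a"
    and "(\<lambda>n. graph_norm M a (\<lambda>x. u n x - f x)) \<longlonglongrightarrow> 0"
    and "(\<lambda>n. graph_norm M a (\<lambda>x. v n x - g x)) \<longlonglongrightarrow> 0"
  shows "(\<lambda>n. qnorm (fval a) (\<lambda>x. u n x - v n x)) \<longlonglongrightarrow> qnorm (fval a) (\<lambda>x. f x - g x)"
proof (rule E.tendsto_qnorm)
  show "(\<lambda>n. qnorm (fval a) (\<lambda>x. u n x - v n x - (f x - g x))) \<longlonglongrightarrow> 0"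
  proof (rule Lim_null_comparison)
    show "(\<lambda>n. qnorm (fval a) (\<lambda>x. u n x - f x) + qnorm (fval a) (\<lambda>x. v n x - g x)) \<longlonglongrightarrow> 0"
      using tendsto_add[OF graph_limit_fval graph_limit_fval] assms by fastforce
    have "qnorm (fval a) (\<lambda>x. u n x - v n x - (f x - g x))
        \<le> qnorm (fval a) (\<lambda>x. u n x - f x) + qnorm (fval a) (\<lambda>x. v n x - g x)" for n
    proof -
      have "(\<lambda>x. u n x - v n x - (f x - g x)) = (\<lambda>x. u n x - f x - (v n x - g x))" by auto
      then show ?thesis
        using E.qnorm_triangle_diff[OF E.diff E.diff, OF assms(1,3,2,4), of n n] by simp
    qed
    then show "\<forall>\<^sub>F n in sequentially. norm (qnorm (fval a) (\<lambda>x. u n x - v n x - (f x - g x)))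
        \<le> qnorm (fval a) (\<lambda>x. u n x - f x) + qnorm (fval a) (\<lambda>x. v n x - g x)"
      by (simp add: E.qnorm_nonneg E.diff assms)
  qed
qed (intro E.diff assms)+

text \<open>The square root of the truncated form is 1-Lipschitz, so the extension by continuity exists.\<close>

lemma truncated_form_ext_limit:
  assumes w: "cutoff w" and f: "f \<in> fdom a"
    and v: "\<And>n. v n \<in> Db" and lv: "(\<lambda>n. graph_norm M a (\<lambda>x. v n x - f x)) \<longlonglongrightarrow> 0"
  shows "(\<lambda>n. truncated_form a w (v n)) \<longlonglongrightarrow> truncated_form_ext M a w f"
proof -
  define s where "s u n = sqrt (truncated_form a w (u n))" for u and n :: nat
  have close: "(\<lambda>n. s u n - s v n) \<longlonglongrightarrow> 0"
    if u: "\<And>n. u n \<in> Db" and lu: "(\<lambda>n. graph_norm M a (\<lambda>x. u n x - f x)) \<longlonglongrightarrow> 0" for u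
  proof (rule Lim_null_comparison)
    show "(\<lambda>n. qnorm (fval a) (\<lambda>x. u n x - v n x)) \<longlonglongrightarrow> 0"
      using fval_tendsto_diff[OF Db_D[OF u] Db_D[OF v] f f lu lv]
      by (simp add: qnorm_def E.q_zero E.zero)
    have "norm (s u n - s v n) \<le> qnorm (fval a) (\<lambda>x. u n x - v n x)" for n
      using sqrt_truncated_le_add[OF w u v, of n n] sqrt_truncated_le_add[OF w v u, of n n]
        E.qnorm_minus_commute[OF Db_D[OF u] Db_D[OF v], of n n]
      by (simp add: s_def abs_le_iff)
    then show "\<forall>\<^sub>F n in sequentially. norm (s u n - s v n) \<le> qnorm (fval a) (\<lambda>x. u n x - v n x)"
      by simp
  qed
  have "Cauchy (s v)"
    unfolding Cauchy_def
  proof (intro allI impI)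
    fix e :: real assume "0 < e"
    then obtain N where N: "\<And>m n. N \<le> m \<Longrightarrow> N \<le> n \<Longrightarrow> qnorm (fval a) (\<lambda>x. v m x - v n x) < e"
      using E.limit_Cauchyq[OF Db_D[OF v] f graph_limit_fval[OF Db_D[OF v] f lv]]
      unfolding E.Cauchyq_def by blast
    have "dist (s v m) (s v n) < e" if "N \<le> m" "N \<le> n" for m n
      using sqrt_truncated_le_add[OF w v v, of m n] sqrt_truncated_le_add[OF w v v, of n m]
        E.qnorm_minus_commute[OF Db_D[OF v] Db_D[OF v], of m n] N[OF that]
      by (simp add: s_def dist_real_def abs_less_iff)
    then show "\<exists>N. \<forall>m\<ge>N. \<forall>n\<ge>N. dist (s v m) (s v n) < e" by blast
  qed
  then obtain l where l: "s v \<longlonglongrightarrow> l" using Cauchy_convergent convergent_def by blast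
  have lim: "(\<lambda>n. truncated_form a w (u n)) \<longlonglongrightarrow> l\<^sup>2"
    if u: "\<And>n. u n \<in> Db" and lu: "(\<lambda>n. graph_norm M a (\<lambda>x. u n x - f x)) \<longlonglongrightarrow> 0" for u
  proof -
    have "(\<lambda>n. (s v n + (s u n - s v n))\<^sup>2) \<longlonglongrightarrow> (l + 0)\<^sup>2"
      by (intro tendsto_intros l close u lu)
    then show ?thesis using cutoff_bounds(1)[OF w u] by (simp add: s_def)
  qed
  have "truncated_form_ext M a w f = l\<^sup>2"
    unfolding truncated_form_ext_def
  proof (rule the_equality)
    show "\<forall>u. (\<forall>n. u n \<in> fdom a \<inter> Linf M) \<and> (\<lambda>n. graph_norm M a (\<lambda>x. u n x - f x)) \<longlonglongrightarrow> 0
        \<longrightarrow> (\<lambda>n. truncated_form a w (u n)) \<longlonglongrightarrow> l\<^sup>2"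
      using lim by (auto simp: Db_def)
    fix c assume "\<forall>u. (\<forall>n. u n \<in> fdom a \<inter> Linf M) \<and> (\<lambda>n. graph_norm M a (\<lambda>x. u n x - f x)) \<longlonglongrightarrow> 0
        \<longrightarrow> (\<lambda>n. truncated_form a w (u n)) \<longlonglongrightarrow> c"
    then have "(\<lambda>n. truncated_form a w (v n)) \<longlonglongrightarrow> c" using v lv by (auto simp: Db_def)
    then show "c = l\<^sup>2" using lim[OF v lv] LIMSEQ_unique by blast
  qed
  then show ?thesis using lim[OF v lv] by simp
qed

lemma truncated_form_ext_Db:
  assumes w: "cutoff w" and f: "f \<in> Db"
  shows "truncated_form_ext M a w f = truncated_form a w f"
proof -
  have "graph_norm M a (\<lambda>x. 0) = 0"
    by (simp add: graph_norm_def E.q_zero E.zero l2_norm_def l2_inner_def)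
  then have "(\<lambda>_. truncated_form a w f) \<longlonglongrightarrow> truncated_form_ext M a w f"
    using truncated_form_ext_limit[OF w Db_D[OF f], of "\<lambda>_. f"] f by simp
  then show ?thesis by (simp add: LIMSEQ_const_iff)
qed

end

locale strongly_local_form = dirichlet_L2_form M a for M :: "'a::metric_space measure" and a +
  assumes loc: "strongly_local M a" and regular: "regular_form M a" and borel: "sets M = sets borel"
begin

lemma localD:
  "f \<in> fdom a \<Longrightarrow> g \<in> fdom a \<Longrightarrow> (AE x in M. (f x + c) * g x = 0) \<Longrightarrow> fval a f g = 0"
  using loc unfolding strongly_local_def by blast

lemma Cc_bounded: "f \<in> Cc \<Longrightarrow> \<exists>K\<ge>0. \<forall>x. \<bar>f x\<bar> \<le> K"
proof -
  assume "f \<in> Cc"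
  then have "continuous_on UNIV f" "compact (closure {x. f x \<noteq> 0})" by (auto simp: Cc_def)
  then have "compact (f ` closure {x. f x \<noteq> 0})"
    using compact_continuous_image[OF continuous_on_subset[of UNIV f]] by blast
  then have "bounded (f ` closure {x. f x \<noteq> 0})" by (rule compact_imp_bounded)
  then obtain K where K: "\<And>x. x \<in> closure {x. f x \<noteq> 0} \<Longrightarrow> \<bar>f x\<bar> \<le> K"
    unfolding bounded_iff by auto
  have "\<bar>f x\<bar> \<le> max 0 K" for x
    using K[of x] closure_subset[of "{x. f x \<noteq> 0}"] by (cases "f x = 0") auto
  then show ?thesis by (intro exI[of _ "max 0 K"]) auto
qed

lemma Cc_Db: "f \<in> fdom a \<Longrightarrow> f \<in> Cc \<Longrightarrow> f \<in> Db"
  using Cc_bounded[of f] Db_I[of f] by (auto intro: AE_I2)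

lemma Cc_dense:
  assumes f: "f \<in> fdom a"
  obtains u where "\<And>n. u n \<in> fdom a" "\<And>n. u n \<in> Cc" "(\<lambda>n. graph_norm M a (\<lambda>x. u n x - f x)) \<longlonglongrightarrow> 0"
proof -
  have "\<exists>g\<in>fdom a \<inter> Cc. graph_norm M a (\<lambda>x. f x - g x) < e" if "0 < e" for e
    using regular f that unfolding regular_form_def by blast
  from G.approximating_sequence[of "fdom a \<inter> Cc", folded graph_norm_qnorm, OF this _ f]
  show thesis using that by (metis IntD1 IntD2 Int_lower1)
qed

lemma ext_bounds:
  assumes w: "cutoff w" and f: "f \<in> fdom a"
  shows "0 \<le> truncated_form_ext M a w f" "truncated_form_ext M a w f \<le> fval a f f"
proof -
  obtain u where u: "\<And>n. u n \<in> fdom a" "\<And>n. u n \<in> Cc" "(\<lambda>n. graph_norm M a (\<lambda>x. u n x - f x)) \<longlonglongrightarrow> 0"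
    by (rule Cc_dense[OF f]) blast
  note ub = Cc_Db[OF u(1,2)]
  note l = truncated_form_ext_limit[OF w f ub u(3)]
  show "0 \<le> truncated_form_ext M a w f"
    by (rule LIMSEQ_le_const[OF l]) (use cutoff_bounds[OF w ub] in auto)
  have "(\<lambda>n. fval a (u n) (u n)) \<longlonglongrightarrow> fval a f f"
    by (intro E.tendsto_q graph_limit_fval u f)
  then show "truncated_form_ext M a w f \<le> fval a f f"
    by (rule LIMSEQ_le[OF l]) (use cutoff_bounds[OF w ub] in auto)
qed

lemma ext_le_add:
  assumes w: "cutoff w" and f: "f \<in> fdom a" and g: "g \<in> fdom a"
  shows "sqrt (truncated_form_ext M a w f)
    \<le> sqrt (truncated_form_ext M a w g) + qnorm (fval a) (\<lambda>x. f x - g x)"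
proof -
  obtain u where u: "\<And>n. u n \<in> fdom a" "\<And>n. u n \<in> Cc" "(\<lambda>n. graph_norm M a (\<lambda>x. u n x - f x)) \<longlonglongrightarrow> 0"
    by (rule Cc_dense[OF f]) blast
  obtain v where v: "\<And>n. v n \<in> fdom a" "\<And>n. v n \<in> Cc" "(\<lambda>n. graph_norm M a (\<lambda>x. v n x - g x)) \<longlonglongrightarrow> 0"
    by (rule Cc_dense[OF g]) blast
  note ub = Cc_Db[OF u(1,2)] note vb = Cc_Db[OF v(1,2)]
  show ?thesis
  proof (rule LIMSEQ_le)
    show "(\<lambda>n. sqrt (truncated_form a w (u n))) \<longlonglongrightarrow> sqrt (truncated_form_ext M a w f)"
      by (intro tendsto_real_sqrt truncated_form_ext_limit[OF w f ub u(3)])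
    show "(\<lambda>n. sqrt (truncated_form a w (v n)) + qnorm (fval a) (\<lambda>x. u n x - v n x))
        \<longlonglongrightarrow> sqrt (truncated_form_ext M a w g) + qnorm (fval a) (\<lambda>x. f x - g x)"
      by (intro tendsto_add tendsto_real_sqrt truncated_form_ext_limit[OF w g vb v(3)]
          fval_tendsto_diff u v f g)
  qed (use sqrt_truncated_le_add[OF w ub vb] in auto)
qed

section \<open>The Neumann quadratic form and the effect of strong locality\<close>

lemma zero_cutoffs: "(\<lambda>_. 0) \<in> cutoffs M a \<Omega>"
  using Db_zero by (auto simp: cutoffs_def Db_def)

lemma ext_le_neumann:
  assumes "w \<in> cutoffs M a \<Omega>" "f \<in> fdom a"
  shows "truncated_form_ext M a w f \<le> neumann_quad M a \<Omega> f"
  unfolding neumann_quad_def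
  using ext_bounds(2)[OF cutoffs_cutoff assms(2)]
  by (intro cSUP_upper[OF assms(1)] bdd_aboveI2) blast

lemma neumann_least:
  assumes "\<And>w. w \<in> cutoffs M a \<Omega> \<Longrightarrow> truncated_form_ext M a w f \<le> C"
  shows "neumann_quad M a \<Omega> f \<le> C"
  unfolding neumann_quad_def using zero_cutoffs assms by (intro cSUP_least) auto

lemma neumann_bounds:
  assumes f: "f \<in> fdom a"
  shows "0 \<le> neumann_quad M a \<Omega> f" "neumann_quad M a \<Omega> f \<le> fval a f f"
  using ext_le_neumann[OF zero_cutoffs f] ext_bounds[OF cutoffs_cutoff f] zero_cutoffs
  by (meson neumann_least order_trans)+

text \<open>The square roots of all truncated forms are 1-Lipschitz in the energy seminorm, and a
  supremum over cutoffs keeps this constant.\<close>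

lemma neumann_le_add:
  assumes f: "f \<in> fdom a" and g: "g \<in> fdom a"
  shows "sqrt (neumann_quad M a \<Omega> f) \<le> sqrt (neumann_quad M a \<Omega> g) + qnorm (fval a) (\<lambda>x. f x - g x)"
    (is "_ \<le> ?r")
proof -
  have r: "0 \<le> ?r" by (intro add_nonneg_nonneg E.qnorm_nonneg E.diff f g) (simp add: neumann_bounds g)
  have "neumann_quad M a \<Omega> f \<le> ?r\<^sup>2"
  proof (rule neumann_least)
    fix w assume w: "w \<in> cutoffs M a \<Omega>"
    have "sqrt (truncated_form_ext M a w f) \<le> ?r"
      using ext_le_add[OF cutoffs_cutoff[OF w] f g] real_sqrt_le_mono[OF ext_le_neumann[OF w g]]
      by linarith
    then show "truncated_form_ext M a w f \<le> ?r\<^sup>2" using sqrt_le_D by blast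
  qed
  then show ?thesis using r real_le_lsqrt by blast
qed

text \<open>For the difference \<open>h\<close> of the two functions, \<open>w x * h x\<close>
  vanishes a.e., so both terms of the truncated form are zero by strong locality with the constant
  0. A zero seminorm of the difference gives equal seminorms.\<close>

lemma truncated_eq:
  assumes w: "w \<in> cutoffs M a \<Omega>" and f: "f \<in> Db" and g: "g \<in> Db"
    and eq: "AE x in M. x \<in> \<Omega> \<longrightarrow> f x = g x"
  shows "truncated_form a w f = truncated_form a w g"
proof -
  note wc = cutoffs_cutoff[OF w]
  interpret T: semi_inner Db "truncated_inner w" by (rule truncated_semi_inner[OF wc])
  have wb: "w \<in> Db" using wc by (simp add: cutoff_def)
  have w0: "AE x in M. x \<notin> \<Omega> \<longrightarrow> w x = 0"
  proof -
    have "AE x in M. 0 \<le> w x \<and> w x \<le> indicator \<Omega> x" using w by (simp add: cutoffs_def)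
    then show ?thesis by eventually_elim auto
  qed
  have 0: "truncated_form a w h = 0" if h: "h \<in> Db" and h0: "AE x in M. x \<in> \<Omega> \<longrightarrow> h x = 0" for h
  proof -
    have wh: "AE x in M. w x * h x = 0" using w0 h0 by eventually_elim auto
    have "fval a (\<lambda>x. w x * h x) h = 0"
      by (rule localD[of _ _ 0]) (use wh in \<open>auto intro!: Db_D Db_mult wb h elim: eventually_mono\<close>)
    moreover have "fval a w (\<lambda>x. (h x)\<^sup>2) = 0"
      unfolding power2_eq_square
      by (rule localD[of _ _ 0]) (use wh in \<open>auto intro!: Db_D Db_mult wb h elim: eventually_mono\<close>)
    ultimately show ?thesis by (simp add: truncated_form_def)
  qed
  have "qnorm (truncated_inner w) f = qnorm (truncated_inner w) g"
    if "f \<in> Db" "g \<in> Db" "AE x in M. x \<in> \<Omega> \<longrightarrow> f x = g x" for f g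
  proof (rule antisym)
    have "qnorm (truncated_inner w) (\<lambda>x. f x - g x) = 0"
      using that 0[OF Db_diff[OF that(1,2)]] by (simp add: qnorm_def truncated_inner_self)
    then show "qnorm (truncated_inner w) f \<le> qnorm (truncated_inner w) g"
      "qnorm (truncated_inner w) g \<le> qnorm (truncated_inner w) f"
      using T.qnorm_le_add_diff[OF that(1,2)] T.qnorm_le_add_diff[OF that(2,1)]
        T.qnorm_minus_commute[OF that(1,2)] by auto
  qed
  from this[OF f g eq] show ?thesis
    by (simp add: qnorm_def truncated_inner_self)
qed

text \<open>\<open>h\<close> is carried by the set where \<open>w\<close> is 1. Strong locality with
  the constant -1 removes the correction term, since \<open>w - 1\<close> times the square of
  \<open>h\<close> vanishes a.e.\<close>

lemma truncated_full:
  assumes w: "w \<in> cutoffs M a \<Omega>" and h: "h \<in> Db" and eq: "AE x in M. (w x - 1) * h x = 0"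
  shows "truncated_form a w h = fval a h h"
proof -
  have wb: "w \<in> Db" using cutoffs_cutoff[OF w] by (simp add: cutoff_def)
  have "AE x in M. w x * h x = h x" using eq by eventually_elim (auto simp: algebra_simps)
  then have "fval a (\<lambda>x. w x * h x) h = fval a h h"
    by (intro fval_cong) (auto intro!: Db_D Db_measurable Db_mult wb h)
  moreover have "fval a w (\<lambda>x. (h x)\<^sup>2) = 0"
    unfolding power2_eq_square
    by (rule localD[of _ _ "-1"]) (use eq in \<open>auto intro!: Db_D Db_mult wb h elim: eventually_mono\<close>)
  ultimately show ?thesis by (simp add: truncated_form_def)
qed

end

section \<open>Cutoff functions and the Dirichlet form on an open set\<close>

locale lc_dirichlet = strongly_local_form M a for M :: "'a::metric_space measure" and a +
  fixes \<Omega> :: "'a set"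
  assumes lc: "locally_compact_space (euclidean :: 'a topology)"
    and sc: "sigma_compact (UNIV :: 'a set)"
    and radon: "radon_measure M"
    and open_\<Omega>: "open \<Omega>"
begin

lemma compact_neighbourhood:
  assumes "compact (K :: 'a set)"
  obtains U L where "open U" "compact L" "K \<subseteq> U" "U \<subseteq> L"
proof -
  have "\<exists>U L. open U \<and> compact L \<and> x \<in> U \<and> U \<subseteq> L" for x :: 'a
    using lc unfolding locally_compact_space_def by (simp flip: open_openin)
  then obtain U L where UL: "\<And>x :: 'a. open (U x)" "\<And>x :: 'a. compact (L x)" "\<And>x. x \<in> U x" "\<And>x. U x \<subseteq> L x"
    by metis
  obtain F where F: "F \<subseteq> K" "finite F" "K \<subseteq> (\<Union>x\<in>F. U x)"
  proof (rule compactE_image[OF assms, of K U])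
    show "K \<subseteq> (\<Union>x\<in>K. U x)" using UL(3) by blast
  qed (use UL(1) in auto)
  show thesis
  proof (rule that[of "\<Union>x\<in>F. U x" "\<Union>x\<in>F. L x"])
    show "(\<Union>x\<in>F. U x) \<subseteq> (\<Union>x\<in>F. L x)" using UL(4) by (intro UN_mono) auto
  qed (use F UL in \<open>auto intro!: compact_UN\<close>)
qed

lemma min_max_dom:
  assumes f: "f \<in> fdom a" and c: "0 < c"
  shows "(\<lambda>x. min (max 0 (f x)) c) \<in> fdom a"
proof -
  have "(\<lambda>x. c * min (max 0 (1 / c * f x)) 1) \<in> fdom a"
    by (intro E.scale clip_dom f)
  also have "(\<lambda>x. c * min (max 0 (1 / c * f x)) 1) = (\<lambda>x. min (max 0 (f x)) c)"
    using c by (auto simp: min_def max_def field_simps)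
  finally show ?thesis .
qed

text \<open>Regularity supplies only a uniform approximation \<open>g\<close> of the distance cutoff
  \<open>h\<close>. An error of 1/3 is small enough that the levels 1/3 and 2/3 of \<open>g\<close>
  still separate \<open>K\<close> from the complement of \<open>L\<close>; cutting at these levels
  and rescaling restores exact values and stays in the domain.\<close>

lemma bump:
  assumes K: "compact K" and U: "open U" "K \<subseteq> U"
  obtains \<eta> L where "\<eta> \<in> fdom a" "continuous_on UNIV \<eta>" "\<And>x. 0 \<le> \<eta> x" "\<And>x. \<eta> x \<le> 1"
    "\<And>x. x \<in> K \<Longrightarrow> \<eta> x = 1" "compact L" "L \<subseteq> U" "\<And>x. x \<notin> L \<Longrightarrow> \<eta> x = 0"
proof (cases "K = {}")
  case True
  show thesis by (rule that[of "\<lambda>_. 0" "{}"]) (use True in \<open>auto simp: E.zero\<close>)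
next
  case False
  obtain V L0 where V: "open V" "compact L0" "K \<subseteq> V" "V \<subseteq> L0"
    using compact_neighbourhood[OF K] by blast
  have cl: "closed (- (V \<inter> U))" using V U by auto
  \<comment> \<open>The distance to the closed complement attains a positive minimum on the compact
    set \<open>K\<close>.\<close>
  obtain d where d: "0 < d" "\<And>x y. x \<in> K \<Longrightarrow> y \<notin> V \<inter> U \<Longrightarrow> d \<le> dist x y"
  proof (cases "V \<inter> U = UNIV")
    case True
    then show thesis by (intro that[of 1]) auto
  next
    case ne: False
    obtain z where z: "z \<in> K" "\<And>x. x \<in> K \<Longrightarrow> infdist z (- (V \<inter> U)) \<le> infdist x (- (V \<inter> U))"
      using continuous_attains_inf[OF K False continuous_on_infdist[OF continuous_on_id]] by blast
    have "infdist z (- (V \<inter> U)) \<noteq> 0"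
      using in_closed_iff_infdist_zero[OF cl, of z] ne z(1) V U by blast
    then have "0 < infdist z (- (V \<inter> U))" using infdist_nonneg[of z "- (V \<inter> U)"] by linarith
    then show thesis
      using order_trans[OF z(2) infdist_le] by (intro that[of "infdist z (- (V \<inter> U))"]) blast+
  qed
  define h where "h x = max 0 (1 - 2 * infdist x K / d)" for x
  define L where "L = {x. infdist x K \<le> d / 2}"
  have hc: "continuous_on UNIV h" unfolding h_def by (intro continuous_intros) (use d in auto)
  have LVU: "L \<subseteq> V \<inter> U"
  proof
    fix x assume "x \<in> L"
    then have "infdist x K < d" using d by (simp add: L_def)
    then obtain k where "k \<in> K" "dist x k < d"
      using cInf_lessD[of "dist x ` K" d] False by (auto simp: infdist_def)
    then show "x \<in> V \<inter> U" using d(2)[of k x] by (force simp: dist_commute)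
  qed
  have Lcl: "closed L" unfolding L_def by (intro closed_Collect_le continuous_intros)
  have Lc: "compact L"
    using compact_Int_closed[OF V(2) Lcl] LVU V(4) by (metis Int_absorb1 Int_subset_iff order_trans)
  have h0: "h x = 0" if "x \<notin> L" for x
    using that d by (auto simp: h_def L_def field_simps)
  have hK: "h x = 1" if "x \<in> K" for x using that by (simp add: h_def)
  have "h \<in> C0"
    unfolding C0_def
  proof (intro CollectI conjI hc allI impI)
    fix e :: real assume e: "0 < e"
    have "closed {x. e \<le> \<bar>h x\<bar>}" by (intro closed_Collect_le continuous_intros hc)
    moreover have "{x. e \<le> \<bar>h x\<bar>} \<subseteq> L" using h0 e by force
    ultimately show "compact {x. e \<le> \<bar>h x\<bar>}"
      using compact_Int_closed[OF Lc] by (metis Int_absorb1)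
  qed
  then have "\<exists>g\<in>fdom a \<inter> Cc. \<forall>x. \<bar>h x - g x\<bar> \<le> 1/3"
    using regular unfolding regular_form_def by (metis zero_less_divide_1_iff zero_less_numeral)
  then obtain g where g: "g \<in> fdom a" "g \<in> Cc" "\<And>x. \<bar>h x - g x\<bar> \<le> 1/3" by blast
  \<comment> \<open>This is \<open>3 * g x - 1\<close> clamped to [0,1], written as a difference of
    two truncations that \<open>min_max_dom\<close> places in the domain.\<close>
  define \<eta> where "\<eta> x = 3 * (min (max 0 (g x)) (2/3) - min (max 0 (g x)) (1/3))" for x
  show thesis
  proof (rule that[of \<eta> L])
    show "\<eta> \<in> fdom a" unfolding \<eta>_def by (intro E.scale E.diff min_max_dom g) auto
    show "continuous_on UNIV \<eta>"
      using g(2) unfolding \<eta>_def Cc_def by (auto intro!: continuous_intros)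
    show "0 \<le> \<eta> x" "\<eta> x \<le> 1" for x unfolding \<eta>_def by auto
    show "\<eta> x = 1" if "x \<in> K" for x
    proof -
      have "2/3 \<le> g x" using g(3)[of x] hK[OF that] by linarith
      then show ?thesis by (simp add: \<eta>_def)
    qed
    show "\<eta> x = 0" if "x \<notin> L" for x
    proof -
      have "g x \<le> 1/3" using g(3)[of x] h0[OF that] by linarith
      then show ?thesis by (simp add: \<eta>_def)
    qed
  qed (use Lc LVU in auto)
qed

lemma borel_set: "A \<in> sets borel \<Longrightarrow> A \<in> sets M"
  using borel by simp

text \<open>Inner regularity reduces the claim to compact sets on which \<open>f\<close> is nonzero
  and which miss the support. Such a set has a finite cover by open sets on each of which
  \<open>f\<close> vanishes a.e., hence measure zero.\<close>

lemma ess_supp_AE: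
  assumes f: "f \<in> borel_measurable M"
  shows "AE x in M. x \<notin> ess_supp M f \<longrightarrow> f x = 0"
proof -
  have cl: "open (- ess_supp M f)"
    unfolding open_subopen[of "- ess_supp M f"] by (auto simp: ess_supp_def)
  define A where "A = {x. f x \<noteq> 0} \<inter> - ess_supp M f"
  have fs: "{x. f x \<noteq> 0} \<in> sets M"
    using measurable_sets[OF f, of "- {0}"] by (simp add: space vimage_def Collect_neg_eq)
  have "- ess_supp M f \<in> sets M" using cl by (intro borel_set) auto
  then have A: "A \<in> sets M" unfolding A_def by (intro sets.Int fs)
  have "emeasure M K = 0" if K: "compact K" "K \<subseteq> A" for K
  proof -
    have "\<exists>U. open U \<and> x \<in> U \<and> (AE y in M. y \<in> U \<longrightarrow> f y = 0)" if "x \<in> K" for x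
    proof -
      have "x \<notin> ess_supp M f" using that K(2) by (auto simp: A_def)
      then show ?thesis unfolding ess_supp_def by blast
    qed
    then obtain U where U: "\<And>x. x \<in> K \<Longrightarrow> open (U x)" "\<And>x. x \<in> K \<Longrightarrow> x \<in> U x"
      "\<And>x. x \<in> K \<Longrightarrow> AE y in M. y \<in> U x \<longrightarrow> f y = 0" by metis
    obtain F where F: "F \<subseteq> K" "finite F" "K \<subseteq> (\<Union>x\<in>F. U x)"
    proof (rule compactE_image[OF K(1), of K U])
      show "K \<subseteq> (\<Union>x\<in>K. U x)" using U(2) by blast
    qed (use U(1) in auto)
    have "AE y in M. \<forall>x\<in>F. y \<in> U x \<longrightarrow> f y = 0"
      using F U by (intro AE_finite_allI) auto
    then have "AE y in M. y \<notin> K"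
    proof eventually_elim
      case (elim y)
      then show ?case using F(3) K(2) by (auto simp: A_def)
    qed
    moreover have "K \<in> sets M" by (intro borel_set borel_compact K)
    ultimately show ?thesis by (simp add: AE_iff_measurable space)
  qed
  moreover have "emeasure M A = (SUP K\<in>{K. compact K \<and> K \<subseteq> A}. emeasure M K)"
    using radon A by (auto simp: radon_measure_def)
  moreover have "(SUP K\<in>{K. compact K \<and> K \<subseteq> A}. emeasure M K) \<le> 0"
    by (intro SUP_least) (use calculation(1) in simp)
  ultimately have "emeasure M A = 0" by simp
  then have "AE x in M. x \<notin> A" using A by (simp add: AE_iff_measurable space)
  then show ?thesis by eventually_elim (auto simp: A_def)
qed

text \<open>Any compact carrier inside \<open>\<Omega>\<close> serves in place of the essential
  support, which is closed and contained in every such carrier. Sums and products can then be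
  treated through carriers.\<close>

lemma D_compact_iff:
  "f \<in> D_compact M a \<Omega> \<longleftrightarrow> f \<in> fdom a \<and> (\<exists>K. compact K \<and> K \<subseteq> \<Omega> \<and> (AE x in M. x \<notin> K \<longrightarrow> f x = 0))"
proof safe
  assume "f \<in> D_compact M a \<Omega>"
  then show "f \<in> fdom a" "\<exists>K. compact K \<and> K \<subseteq> \<Omega> \<and> (AE x in M. x \<notin> K \<longrightarrow> f x = 0)"
    using ess_supp_AE[OF L2_measurable[OF dom_L2, of f]]
    by (auto simp: D_compact_def intro!: exI[of _ "ess_supp M f"])
next
  fix K assume f: "f \<in> fdom a" and K: "compact K" "K \<subseteq> \<Omega>" "AE x in M. x \<notin> K \<longrightarrow> f x = 0"
  have "open (- ess_supp M f)"
    unfolding open_subopen[of "- ess_supp M f"] by (auto simp: ess_supp_def)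
  then have cl: "closed (ess_supp M f)" by (simp add: closed_def)
  have sub: "ess_supp M f \<subseteq> K"
  proof
    fix x assume x: "x \<in> ess_supp M f"
    show "x \<in> K"
    proof (rule ccontr)
      assume "x \<notin> K"
      moreover have "open (- K)" using compact_imp_closed[OF K(1)] by (simp add: closed_def)
      ultimately have "\<not> (AE y in M. y \<in> - K \<longrightarrow> f y = 0)"
        using x unfolding ess_supp_def by blast
      then show False using K(3) by simp
    qed
  qed
  then have "compact (ess_supp M f)" using compact_Int_closed[OF K(1) cl] by (metis Int_absorb1)
  then show "f \<in> D_compact M a \<Omega>" using f sub K(2) by (auto simp: D_compact_def)
qed

lemma D_compact_dom: "f \<in> D_compact M a \<Omega> \<Longrightarrow> f \<in> fdom a"
  by (simp add: D_compact_def)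

section \<open>The Dirichlet domain as a closure in the graph norm\<close>

lemma D_compact_zero: "(\<lambda>_. 0) \<in> D_compact M a \<Omega>"
  unfolding D_compact_iff by (auto simp: E.zero intro!: exI[of _ "{}"])

lemma D_compact_scale: "f \<in> D_compact M a \<Omega> \<Longrightarrow> (\<lambda>x. c * f x) \<in> D_compact M a \<Omega>"
  unfolding D_compact_iff by (auto simp: E.scale elim: eventually_mono)

lemma D_compact_add:
  assumes "f \<in> D_compact M a \<Omega>" "g \<in> D_compact M a \<Omega>"
  shows "(\<lambda>x. f x + g x) \<in> D_compact M a \<Omega>"
proof -
  obtain K L where "f \<in> fdom a" "compact K" "K \<subseteq> \<Omega>" and 1: "AE x in M. x \<notin> K \<longrightarrow> f x = 0"
    and "g \<in> fdom a" "compact L" "L \<subseteq> \<Omega>" and 2: "AE x in M. x \<notin> L \<longrightarrow> g x = 0"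
    using assms unfolding D_compact_iff by blast
  moreover have "AE x in M. x \<notin> K \<union> L \<longrightarrow> f x + g x = 0" using 1 2 by eventually_elim auto
  ultimately show ?thesis unfolding D_compact_iff by (auto simp: E.add intro!: exI[of _ "K \<union> L"])
qed

definition DD :: "('a \<Rightarrow> real) set" where
  "DD = fdom (form_D M a \<Omega>)"

lemma DD_iff:
  "f \<in> DD \<longleftrightarrow> f \<in> fdom a \<and> (\<exists>u. (\<forall>n. u n \<in> D_compact M a \<Omega>)
    \<and> (\<lambda>n. graph_norm M a (\<lambda>x. u n x - f x)) \<longlonglongrightarrow> 0)"
proof safe
  assume f: "f \<in> DD"
  then show fd: "f \<in> fdom a" by (simp add: DD_def form_D_def)
  have "\<exists>g\<in>D_compact M a \<Omega>. graph_norm M a (\<lambda>x. f x - g x) < e" if "0 < e" for e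
    using f that by (simp add: DD_def form_D_def)
  from G.approximating_sequence[of "D_compact M a \<Omega>", folded graph_norm_qnorm, OF this _ fd]
  show "\<exists>u. (\<forall>n. u n \<in> D_compact M a \<Omega>) \<and> (\<lambda>n. graph_norm M a (\<lambda>x. u n x - f x)) \<longlonglongrightarrow> 0"
    using D_compact_dom by blast
next
  fix u assume f: "f \<in> fdom a" and u: "\<forall>n. u n \<in> D_compact M a \<Omega>"
    and lim: "(\<lambda>n. graph_norm M a (\<lambda>x. u n x - f x)) \<longlonglongrightarrow> 0"
  have "\<exists>g\<in>D_compact M a \<Omega>. graph_norm M a (\<lambda>x. f x - g x) < e" if e: "0 < e" for e
  proof -
    obtain n where "norm (graph_norm M a (\<lambda>x. u n x - f x) - 0) < e"
      using LIMSEQ_D[OF lim e] by blast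
    then show ?thesis
      using u G.qnorm_minus_commute[OF f D_compact_dom, of "u n"]
      by (intro bexI[of _ "u n"]) (auto simp: graph_norm_qnorm)
  qed
  then show "f \<in> DD" using f by (simp add: DD_def form_D_def)
qed

lemma DD_dom: "f \<in> DD \<Longrightarrow> f \<in> fdom a"
  by (simp add: DD_iff)

lemma D_compact_DD: "f \<in> D_compact M a \<Omega> \<Longrightarrow> f \<in> DD"
  unfolding DD_iff
  by (auto simp: D_compact_dom graph_norm_qnorm qnorm_def G.q_zero G.zero intro!: exI[of _ "\<lambda>_. f"])

lemma DD_closed:
  assumes f: "f \<in> fdom a" and u: "\<And>n. u n \<in> DD"
    and lim: "(\<lambda>n. graph_norm M a (\<lambda>x. u n x - f x)) \<longlonglongrightarrow> 0"
  shows "f \<in> DD"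
proof -
  have "\<exists>g\<in>D_compact M a \<Omega>. graph_norm M a (\<lambda>x. f x - g x) < e" if e: "0 < e" for e
  proof -
    obtain n where n: "norm (graph_norm M a (\<lambda>x. u n x - f x) - 0) < e / 2"
      using LIMSEQ_D[OF lim, of "e / 2"] e by auto
    obtain g where g: "g \<in> D_compact M a \<Omega>" "graph_norm M a (\<lambda>x. u n x - g x) < e / 2"
      using u[of n] e unfolding DD_def form_D_def by (force dest: spec[of _ "e / 2"])
    have "graph_norm M a (\<lambda>x. f x - g x) \<le> graph_norm M a (\<lambda>x. u n x - f x) + graph_norm M a (\<lambda>x. u n x - g x)"
      using G.qnorm_triangle3[OF f DD_dom[OF u] D_compact_dom[OF g(1)], of n]
        G.qnorm_minus_commute[OF f DD_dom[OF u], of n] by (simp add: graph_norm_qnorm)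
    then show ?thesis using n g by force
  qed
  then show ?thesis using f by (simp add: DD_def form_D_def)
qed

lemma \<Omega>_measurable: "\<Omega> \<in> sets M"
  using open_\<Omega> by (intro borel_set) auto

lemma indicator_measurable: "(indicator \<Omega> :: 'a \<Rightarrow> real) \<in> borel_measurable M"
  using \<Omega>_measurable by simp

lemma L2_on_L2: "L2_on M \<Omega> \<subseteq> L2 M"
  by (auto simp: L2_on_def)

lemma DD_L2_on: "f \<in> DD \<Longrightarrow> f \<in> L2_on M \<Omega>"
proof -
  assume "f \<in> DD"
  then obtain u where f: "f \<in> fdom a" and u: "\<And>n. u n \<in> D_compact M a \<Omega>"
    and lim: "(\<lambda>n. graph_norm M a (\<lambda>x. u n x - f x)) \<longlonglongrightarrow> 0"
    unfolding DD_iff by blast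
  note ud = D_compact_dom[OF u]
  note l2 = graph_limit_l2[OF ud f lim]
  note [measurable] = indicator_measurable L2_measurable[OF dom_L2[OF f]]
  have m: "(\<lambda>x. (1 - indicator \<Omega> x) * f x) \<in> borel_measurable M" by measurable
  have u0: "AE x in M. x \<notin> \<Omega> \<longrightarrow> u n x = 0" for n
    using u[of n] unfolding D_compact_iff by (auto elim!: eventually_mono)
  have "l2_norm M (\<lambda>x. (1 - indicator \<Omega> x) * f x) \<le> l2_norm M (\<lambda>x. u n x - f x)" for n
    by (rule l2_norm_mono_AE[OF L2.diff[OF dom_L2[OF ud] dom_L2[OF f]] m])
      (use u0[of n] in \<open>auto simp: indicator_def elim!: eventually_mono\<close>)
  then have "l2_norm M (\<lambda>x. (1 - indicator \<Omega> x) * f x) \<le> 0"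
    by (intro LIMSEQ_le_const[OF l2]) auto
  then have 0: "l2_inner M (\<lambda>x. (1 - indicator \<Omega> x) * f x) (\<lambda>x. (1 - indicator \<Omega> x) * f x) = 0"
    using l2_norm_nonneg[of M "\<lambda>x. (1 - indicator \<Omega> x) * f x"] by (simp add: l2_norm_def)
  have "(\<lambda>x. (1 - indicator \<Omega> x) * f x) \<in> L2 M"
    by (rule L2_dominated(1)[OF dom_L2[OF f] m, of 1]) (auto simp: indicator_def)
  from l2_inner_eq_0_AE[OF this 0] have "AE x in M. f x = indicator \<Omega> x * f x"
    by eventually_elim (simp add: left_diff_distrib)
  then show ?thesis using dom_L2[OF f] by (simp add: L2_on_def)
qed

lemma form_D_closed: "closed_form M (L2_on M \<Omega>) (form_D M a \<Omega>)"
proof -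
  have fv: "fval (form_D M a \<Omega>) = fval a" by (simp add: form_D_def)
  have gn: "graph_norm M (form_D M a \<Omega>) = graph_norm M a" by (simp add: graph_norm_def fv fun_eq_iff)
  have add: "(\<lambda>x. f x + g x) \<in> DD" if "f \<in> DD" "g \<in> DD" for f g
  proof -
    obtain u v where f: "f \<in> fdom a" and u: "\<And>n. u n \<in> D_compact M a \<Omega>"
      and lu: "(\<lambda>n. graph_norm M a (\<lambda>x. u n x - f x)) \<longlonglongrightarrow> 0"
      and g: "g \<in> fdom a" and v: "\<And>n. v n \<in> D_compact M a \<Omega>"
      and lv: "(\<lambda>n. graph_norm M a (\<lambda>x. v n x - g x)) \<longlonglongrightarrow> 0"
      using \<open>f \<in> DD\<close> \<open>g \<in> DD\<close> unfolding DD_iff by blast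
    note ud = D_compact_dom[OF u] note vd = D_compact_dom[OF v]
    have "norm (graph_norm M a (\<lambda>x. u n x + v n x - (f x + g x)))
        \<le> graph_norm M a (\<lambda>x. u n x - f x) + graph_norm M a (\<lambda>x. v n x - g x)" for n
    proof -
      have "(\<lambda>x. u n x + v n x - (f x + g x)) = (\<lambda>x. (u n x - f x) + (v n x - g x))" by auto
      then show ?thesis
        using G.qnorm_triangle[OF E.diff[OF ud f] E.diff[OF vd g], of n n]
          G.qnorm_nonneg[OF E.add[OF E.diff[OF ud f] E.diff[OF vd g]], of n n]
        by (simp add: graph_norm_qnorm)
    qed
    then have "(\<lambda>n. graph_norm M a (\<lambda>x. u n x + v n x - (f x + g x))) \<longlonglongrightarrow> 0"
      by (rule Lim_null_comparison[OF always_eventually[OF allI]])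
        (use tendsto_add[OF lu lv] in simp)
    then show ?thesis
      unfolding DD_iff using E.add[OF f g] D_compact_add[OF u v]
      by (intro conjI exI[of _ "\<lambda>n x. u n x + v n x"]) auto
  qed
  have scale: "(\<lambda>x. c * f x) \<in> DD" if "f \<in> DD" for f c
  proof -
    obtain u where f: "f \<in> fdom a" and u: "\<And>n. u n \<in> D_compact M a \<Omega>"
      and lu: "(\<lambda>n. graph_norm M a (\<lambda>x. u n x - f x)) \<longlonglongrightarrow> 0"
      using \<open>f \<in> DD\<close> unfolding DD_iff by blast
    have "graph_norm M a (\<lambda>x. c * u n x - c * f x) = \<bar>c\<bar> * graph_norm M a (\<lambda>x. u n x - f x)" for n
      using G.qnorm_scale[OF E.diff[OF D_compact_dom[OF u] f], of c n]
      by (simp add: graph_norm_qnorm right_diff_distrib)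
    then have "(\<lambda>n. graph_norm M a (\<lambda>x. c * u n x - c * f x)) \<longlonglongrightarrow> 0"
      using tendsto_mult_right_zero[OF lu] by simp
    then show ?thesis
      unfolding DD_iff using E.scale[OF f] D_compact_scale[OF u]
      by (intro conjI exI[of _ "\<lambda>n x. c * u n x"]) auto
  qed
  have cong: "g \<in> DD" if "f \<in> DD" "g \<in> borel_measurable M" "AE x in M. f x = g x" for f g
  proof -
    have f: "f \<in> fdom a" by (rule DD_dom[OF that(1)])
    have g: "g \<in> fdom a" by (rule dom_cong[OF f that(2,3)])
    have e: "AE x in M. f x - g x = 0" using that(3) by eventually_elim simp
    have "fval a (\<lambda>x. f x - g x) (\<lambda>x. f x - g x) = fval a (\<lambda>_. 0) (\<lambda>_. 0)"
      by (intro fval_cong E.diff f g e) auto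
    moreover have "l2_norm M (\<lambda>x. f x - g x) = l2_norm M (\<lambda>_. 0)"
      by (intro l2_norm_cong_AE L2_measurable dom_L2 E.diff E.zero f g e)
    ultimately have "graph_norm M a (\<lambda>x. f x - g x) = 0"
      by (simp add: graph_norm_def E.q_zero E.zero l2_norm_def l2_inner_def)
    then show ?thesis by (intro DD_closed[OF g, of "\<lambda>_. f"]) (auto simp: that)
  qed
  have zero: "(\<lambda>_. 0) \<in> DD" by (intro D_compact_DD D_compact_zero)
  have pos: "positive_form M (L2_on M \<Omega>) (form_D M a \<Omega>)"
    unfolding positive_form_def fv DD_def[symmetric]
  proof (intro conjI ballI allI impI)
    fix f g h assume "f \<in> DD" "g \<in> borel_measurable M" "AE x in M. f x = g x"
    then show "g \<in> DD" by (rule cong)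
    assume h: "h \<in> DD"
    show "fval a f h = fval a g h"
      by (rule fval_cong) (use \<open>f \<in> DD\<close> \<open>g \<in> borel_measurable M\<close> \<open>AE x in M. f x = g x\<close> h in
        \<open>auto intro: DD_dom L2_measurable dom_L2\<close>)
  qed (auto simp: DD_L2_on zero add scale DD_dom E.q_add E.q_scale E.q_nonneg intro: E.q_sym)
  show ?thesis
    unfolding closed_form_def gn DD_def[symmetric]
  proof (intro conjI pos allI impI)
    fix u :: "nat \<Rightarrow> 'a \<Rightarrow> real"
    assume u: "(\<forall>n. u n \<in> DD) \<and> (\<forall>e>0. \<exists>N. \<forall>m\<ge>N. \<forall>n\<ge>N. graph_norm M a (\<lambda>x. u m x - u n x) < e)"
    then obtain f where f: "f \<in> fdom a" "(\<lambda>n. graph_norm M a (\<lambda>x. u n x - f x)) \<longlonglongrightarrow> 0"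
      using closed DD_dom unfolding closed_form_def by blast
    then show "\<exists>f\<in>DD. (\<lambda>n. graph_norm M a (\<lambda>x. u n x - f x)) \<longlonglongrightarrow> 0"
      using DD_closed[OF f(1)] u by blast
  qed
qed

lemma exhaustion:
  obtains L :: "nat \<Rightarrow> 'a set" where "\<And>n. compact (L n)" "\<And>n. L n \<subseteq> \<Omega>"
    "\<And>x. x \<in> \<Omega> \<Longrightarrow> eventually (\<lambda>n. x \<in> L n) sequentially"
proof -
  obtain K :: "nat \<Rightarrow> 'a set" where K: "\<And>n. compact (K n)" "(\<Union>n. K n) = UNIV"
    using sc by (auto simp: sigma_compact_def)
  \<comment> \<open>The points at distance at least 1/(n+1) from the complement of
    \<open>\<Omega>\<close>: a closed subset of \<open>\<Omega>\<close>, eventually containing each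
    of its points.\<close>
  define C where "C n = - (\<Union>y\<in>-\<Omega>. ball y (1 / Suc n))" for n :: nat
  show thesis
  proof (rule that[of "\<lambda>n. (\<Union>i\<le>n. K i) \<inter> C n"])
    fix n
    have "closed (C n)" unfolding C_def by (intro closed_Compl open_UN) auto
    then show "compact ((\<Union>i\<le>n. K i) \<inter> C n)" by (intro compact_Int_closed compact_UN K) auto
    have "x \<in> (\<Union>y\<in>-\<Omega>. ball y (1 / Suc n))" if "x \<notin> \<Omega>" for x
      using that by (intro UN_I[of x]) auto
    then show "(\<Union>i\<le>n. K i) \<inter> C n \<subseteq> \<Omega>" unfolding C_def by blast
  next
    fix x assume "x \<in> \<Omega>"
    then obtain r where r: "0 < r" "ball x r \<subseteq> \<Omega>" using open_\<Omega> open_contains_ball by blast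
    obtain i where i: "x \<in> K i" using K by blast
    obtain N :: nat where N: "1 / Suc N < r" using r nat_approx_posE by blast
    have "x \<in> (\<Union>i\<le>n. K i) \<inter> C n" if n: "max i N \<le> n" for n
    proof -
      have "1 / real (Suc n) \<le> 1 / real (Suc N)" using n by (simp add: field_simps)
      then have "1 / real (Suc n) < r" using N by linarith
      then have "x \<in> C n" using r by (force simp: C_def dist_commute)
      then show ?thesis using i n by auto
    qed
    then show "eventually (\<lambda>n. x \<in> (\<Union>i\<le>n. K i) \<inter> C n) sequentially"
      unfolding eventually_sequentially by blast
  qed
qed

lemma form_D_dense: "densely_defined M (L2_on M \<Omega>) (form_D M a \<Omega>)"
  unfolding densely_defined_def DD_def[symmetric]
proof (intro ballI allI impI)
  fix f and e :: real assume f: "f \<in> L2_on M \<Omega>" and e: "0 < e"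
  have fL: "f \<in> L2 M" and f0: "AE x in M. f x = indicator \<Omega> x * f x" using f by (auto simp: L2_on_def)
  note [measurable] = L2_measurable[OF fL] indicator_measurable
  obtain L :: "nat \<Rightarrow> 'a set" where L: "\<And>n. compact (L n)" "\<And>n. L n \<subseteq> \<Omega>"
    "\<And>x. x \<in> \<Omega> \<Longrightarrow> eventually (\<lambda>n. x \<in> L n) sequentially"
    using exhaustion by blast
  have [measurable]: "L n \<in> sets M" for n by (intro borel_set borel_compact L)
  have "(\<lambda>n. l2_norm M (\<lambda>x. indicator (L n) x * f x - indicator \<Omega> x * f x)) \<longlonglongrightarrow> 0"
  proof (rule L2_dominated_convergence[OF _ _ fL])
    show "\<bar>indicator (L n) x * f x - indicator \<Omega> x * f x\<bar> \<le> \<bar>f x\<bar>" for n x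
      using L(2)[of n] by (auto simp: indicator_def)
    show "(\<lambda>n. indicator (L n) x * f x) \<longlonglongrightarrow> indicator \<Omega> x * f x" for x
    proof (cases "x \<in> \<Omega>")
      case True
      show ?thesis
        by (rule tendsto_eventually, use L(3)[OF True] in eventually_elim) (use True in simp)
    next
      case False
      then have "x \<notin> L n" for n using L(2) by blast
      then show ?thesis using False by simp
    qed
  qed measurable
  from LIMSEQ_D[OF this, of "e / 2"] e obtain n
    where "norm (l2_norm M (\<lambda>x. indicator (L n) x * f x - indicator \<Omega> x * f x) - 0) < e / 2"
    by auto
  then have n: "l2_norm M (\<lambda>x. indicator (L n) x * f x - indicator \<Omega> x * f x) < e / 2" by simp
  define f' where "f' x = indicator (L n) x * f x" for x
  have f'm: "f' \<in> borel_measurable M" unfolding f'_def by measurable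
  have f'L: "f' \<in> L2 M"
    by (rule L2_dominated(1)[OF fL f'm, of 1]) (auto simp: f'_def indicator_def)
  have "l2_norm M (\<lambda>x. f' x - f x) = l2_norm M (\<lambda>x. indicator (L n) x * f x - indicator \<Omega> x * f x)"
    unfolding f'_def
    by (rule l2_norm_cong_AE; (measurable)?) (use f0 in \<open>auto elim: eventually_mono\<close>)
  then have d1: "l2_norm M (\<lambda>x. f x - f' x) < e / 2"
    using n L2.qnorm_minus_commute[OF fL f'L] by (simp add: l2_norm_qnorm)
  obtain g0 where g0: "g0 \<in> fdom a" "l2_norm M (\<lambda>x. f' x - g0 x) < e / 4"
    using dense f'L e unfolding densely_defined_def by (metis zero_less_divide_iff zero_less_numeral)
  obtain g where g: "g \<in> fdom a" "g \<in> Cc" "graph_norm M a (\<lambda>x. g0 x - g x) < e / 4"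
    using regular g0(1) e unfolding regular_form_def
    by (metis IntD1 IntD2 zero_less_divide_iff zero_less_numeral)
  have d2: "l2_norm M (\<lambda>x. f' x - g x) < e / 2"
    using L2.qnorm_triangle3[OF f'L dom_L2[OF g0(1)] dom_L2[OF g(1)]] g0(2) g(3)
      l2_le_graph[OF E.diff[OF g0(1) g(1)]] by (simp add: l2_norm_qnorm)
  obtain \<eta> K where \<eta>: "\<eta> \<in> fdom a" "\<And>x. 0 \<le> \<eta> x" "\<And>x. \<eta> x \<le> 1" "\<And>x. x \<in> L n \<Longrightarrow> \<eta> x = 1"
    "compact K" "K \<subseteq> \<Omega>" "\<And>x. x \<notin> K \<Longrightarrow> \<eta> x = 0"
    using bump[OF L(1) open_\<Omega> L(2), of n] by metis
  have \<eta>b: "\<eta> \<in> Db" by (rule Db_I[OF \<eta>(1), of 1]) (use \<eta> in auto)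
  have \<eta>g: "(\<lambda>x. \<eta> x * g x) \<in> D_compact M a \<Omega>"
    unfolding D_compact_iff
    using Db_D[OF Db_mult[OF \<eta>b Cc_Db[OF g(1,2)]]] \<eta> by (auto intro!: exI[of _ K])
  \<comment> \<open>\<open>f'\<close> is carried by \<open>L n\<close> and \<open>\<eta>\<close> is
    1 there, so the difference is \<open>\<eta>\<close> times \<open>f' - g\<close>; the cutoff
    costs nothing in norm.\<close>
  have "l2_norm M (\<lambda>x. f' x - \<eta> x * g x) \<le> l2_norm M (\<lambda>x. f' x - g x)"
  proof (rule l2_norm_mono_AE)
    show "(\<lambda>x. f' x - g x) \<in> L2 M" by (intro L2.diff f'L dom_L2 g)
    show "(\<lambda>x. f' x - \<eta> x * g x) \<in> borel_measurable M"
      by (intro L2_measurable L2.diff f'L dom_L2 D_compact_dom[OF \<eta>g])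
    have "\<bar>f' x - \<eta> x * g x\<bar> \<le> \<bar>f' x - g x\<bar>" for x
    proof -
      have "f' x - \<eta> x * g x = \<eta> x * (f' x - g x)"
        using \<eta>(4)[of x] by (auto simp: f'_def indicator_def algebra_simps)
      then show ?thesis using \<eta>(2,3)[of x] by (simp add: abs_mult mult_left_le_one_le)
    qed
    then show "AE x in M. \<bar>f' x - \<eta> x * g x\<bar> \<le> \<bar>f' x - g x\<bar>" by simp
  qed
  then have "l2_norm M (\<lambda>x. f x - \<eta> x * g x) < e"
    using L2.qnorm_triangle3[OF fL f'L dom_L2[OF D_compact_dom[OF \<eta>g]]] d1 d2
    by (simp add: l2_norm_qnorm)
  then show "\<exists>g\<in>DD. l2_norm M (\<lambda>x. f x - g x) < e"
    by (intro bexI[of _ "\<lambda>x. \<eta> x * g x"] D_compact_DD \<eta>g)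
qed

end

section \<open>From the semigroups to the capacity\<close>

context lc_dirichlet
begin

lemma fval_form_D: "fval (form_D M a \<Omega>) = fval a"
  by (simp add: form_D_def)

sublocale D: closed_L2_form M "L2_on M \<Omega>" "form_D M a \<Omega>"
  by unfold_locales (rule form_D_closed, rule L2_on_L2)

definition restr :: "('a \<Rightarrow> real) \<Rightarrow> 'a \<Rightarrow> real" where
  "restr f = (\<lambda>x. indicator \<Omega> x * f x)"

lemma restr_add: "restr (\<lambda>x. f x + g x) = (\<lambda>x. restr f x + restr g x)"
  by (simp add: restr_def distrib_left)

lemma restr_diff: "restr (\<lambda>x. f x - g x) = (\<lambda>x. restr f x - restr g x)"
  by (simp add: restr_def right_diff_distrib)

lemma restr_scale: "restr (\<lambda>x. c * f x) = (\<lambda>x. c * restr f x)"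
  by (simp add: restr_def algebra_simps)

lemma restr_zero: "restr (\<lambda>_. 0) = (\<lambda>_. 0)"
  by (simp add: restr_def)

lemma restr_restr: "restr (restr f) = restr f"
  by (auto simp: restr_def indicator_def)

lemma restr_abs_le: "\<bar>restr f x\<bar> \<le> \<bar>f x\<bar>"
  by (auto simp: restr_def indicator_def)

lemma restr_measurable: "f \<in> borel_measurable M \<Longrightarrow> restr f \<in> borel_measurable M"
  unfolding restr_def using indicator_measurable by simp

lemma restr_L2: "f \<in> L2 M \<Longrightarrow> restr f \<in> L2 M"
  by (rule L2_dominated(1)[of f _ _ 1])
    (auto simp: restr_abs_le intro: restr_measurable L2_measurable)

lemma restr_norm_le: "f \<in> L2 M \<Longrightarrow> l2_norm M (restr f) \<le> l2_norm M f"
  by (rule l2_norm_mono_AE) (auto simp: restr_abs_le intro: restr_measurable L2_measurable)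

lemma restr_L2_on: "f \<in> L2 M \<Longrightarrow> restr f \<in> L2_on M \<Omega>"
  using restr_L2[of f] fun_cong[OF restr_restr[of f]] by (simp add: L2_on_def restr_def)

lemma L2_on_AE: "f \<in> L2_on M \<Omega> \<Longrightarrow> AE x in M. f x = restr f x"
  by (simp add: L2_on_def restr_def)

lemma L2_on_diff: "f \<in> L2_on M \<Omega> \<Longrightarrow> g \<in> L2_on M \<Omega> \<Longrightarrow> (\<lambda>x. f x - g x) \<in> L2_on M \<Omega>"
proof -
  assume f: "f \<in> L2_on M \<Omega>" and g: "g \<in> L2_on M \<Omega>"
  have "AE x in M. f x - g x = indicator \<Omega> x * (f x - g x)"
    using L2_on_AE[OF f] L2_on_AE[OF g] by eventually_elim (auto simp: restr_def right_diff_distrib)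
  then show ?thesis using f g by (simp add: L2_on_def L2.diff)
qed

lemma L2_on_scale: "f \<in> L2_on M \<Omega> \<Longrightarrow> (\<lambda>x. c * f x) \<in> L2_on M \<Omega>"
proof -
  assume f: "f \<in> L2_on M \<Omega>"
  have "AE x in M. c * f x = indicator \<Omega> x * (c * f x)"
    using L2_on_AE[OF f] by eventually_elim (simp add: restr_def)
  then show ?thesis using f by (simp add: L2_on_def L2.scale)
qed

lemma L2_on_inner: "f \<in> L2_on M \<Omega> \<Longrightarrow> g \<in> L2 M \<Longrightarrow> l2_inner M f g = l2_inner M f (restr g)"
proof -
  assume f: "f \<in> L2_on M \<Omega>" and g: "g \<in> L2 M"
  have fL: "f \<in> L2 M" using f L2_on_L2 by blast
  have "AE x in M. f x * g x = f x * restr g x"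
    using L2_on_AE[OF f] by eventually_elim (auto simp: restr_def indicator_def split: if_splits)
  then show ?thesis
    unfolding l2_inner_def
    using L2_measurable[OF fL] L2_measurable[OF g] restr_measurable[OF L2_measurable[OF g]]
    by (intro integral_cong_AE) auto
qed

text \<open>
  For the resolvents \<open>u\<close> of \<open>restr \<psi>\<close>, the operator inclusion turns the energy of \<open>u\<close> into \<open>b(u, \<psi>)\<close>,
  and the Cauchy-Schwarz inequality for \<open>b\<close> bounds it by \<open>b(\<psi>, \<psi>)\<close>.
\<close>

lemma restr_in_DD_of_operator_inclusion:
  assumes b: "positive_form M (L2 M) b"
    and incl: "form_operator M (L2_on M \<Omega>) (form_D M a \<Omega>) \<subseteq> form_operator M (L2 M) b"
    and psi: "\<psi> \<in> fdom b"
  shows "restr \<psi> \<in> DD"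
proof -
  interpret B: semi_inner "fdom b" "fval b"
    by unfold_locales (use b in \<open>auto simp: positive_form_def\<close>)
  have psiL: "\<psi> \<in> L2 M" using b psi by (auto simp: positive_form_def)
  define f where "f = restr \<psi>"
  have f: "f \<in> L2_on M \<Omega>" unfolding f_def by (rule restr_L2_on[OF psiL])
  have fL: "f \<in> L2 M" using f L2_on_L2 by blast
  have bound: "fval (form_D M a \<Omega>) (D.res n f) (D.res n f) \<le> fval b \<psi> \<psi>" for n
  proof -
    define u where "u = D.res n f"
    define g where "g = (\<lambda>x. real (Suc n) * (f x - u x))"
    have "(u, g) \<in> form_operator M (L2_on M \<Omega>) (form_D M a \<Omega>)"
      unfolding u_def g_def
      by (rule D.res_operator[OF f]) (intro L2_on_scale L2_on_diff f D.dom_H)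
    then have opD: "u \<in> DD" "g \<in> L2_on M \<Omega>" "\<And>h. h \<in> DD \<Longrightarrow> fval (form_D M a \<Omega>) u h = l2_inner M g h"
      and opB: "u \<in> fdom b" "\<And>h. h \<in> fdom b \<Longrightarrow> fval b u h = l2_inner M g h"
      using incl unfolding form_operator_def DD_def by blast+
    have gL: "g \<in> L2 M" using opD(2) L2_on_L2 by blast
    have uL: "u \<in> L2 M" using D.dom_L2 opD(1) by (simp add: DD_def)
    define x where "x = fval b u u"
    have x: "x = fval (form_D M a \<Omega>) u u" using opD opB by (simp add: x_def)
    \<comment> \<open>This pairing is nonnegative, so replacing \<open>u\<close> by \<open>f\<close>
      in the pairing with \<open>g\<close> can only increase it. As \<open>g\<close> lives on
      \<open>\<Omega>\<close>, \<open>f\<close> may then be exchanged for \<open>\<psi>\<close>, a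
      test function of \<open>b\<close>.\<close>
    have "l2_inner M g (\<lambda>x. f x - u x) = real (Suc n) * l2_inner M (\<lambda>x. f x - u x) (\<lambda>x. f x - u x)"
      unfolding g_def by (intro L2.q_scale L2.diff fL uL)
    also have "\<dots> \<ge> 0" by (simp add: l2_inner_def)
    finally have "l2_inner M g u \<le> l2_inner M g f" by (simp add: L2.q_diff_right fL uL gL)
    then have "x \<le> fval b u \<psi>"
      using opB(2)[OF psi] opB(2)[OF opB(1)] L2_on_inner[OF opD(2) psiL] by (simp add: x_def f_def)
    also have "\<dots> \<le> qnorm (fval b) u * qnorm (fval b) \<psi>" using B.cauchy_schwarz[OF opB(1) psi] by simp
    finally have le: "sqrt x * sqrt x \<le> sqrt x * sqrt (fval b \<psi> \<psi>)"
      using B.q_nonneg[OF opB(1)] by (simp add: qnorm_def x_def)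
    have "x \<le> fval b \<psi> \<psi>"
    proof (cases "x = 0")
      case True
      then show ?thesis using B.q_nonneg[OF psi] by simp
    next
      case False
      then have "0 < sqrt x" using B.q_nonneg[OF opB(1)] by (simp add: x_def)
      then have "sqrt x \<le> sqrt (fval b \<psi> \<psi>)" using le by (simp only: mult_le_cancel_left_pos)
      then show ?thesis by simp
    qed
    then show ?thesis using x by (simp add: u_def)
  qed
  have "f \<in> fdom (form_D M a \<Omega>)"
    by (rule D.closed_weak_limit[OF D.res_dom[OF fL] bound fL D.res_limit[OF form_D_dense f]])
  then show ?thesis by (simp add: DD_def f_def)
qed

section \<open>Capacity of the boundary\<close>

lemma graph_clip_le:
  assumes f: "f \<in> fdom a"
  shows "graph_norm M a (\<lambda>x. min (max 0 (f x)) 1) \<le> graph_norm M a f"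
proof -
  have "l2_norm M (\<lambda>x. min (max 0 (f x)) 1) \<le> l2_norm M f"
    by (rule l2_norm_mono_AE[OF dom_L2[OF f] L2_measurable[OF dom_L2[OF clip_dom[OF f]]]]) auto
  then have "(l2_norm M (\<lambda>x. min (max 0 (f x)) 1))\<^sup>2 \<le> (l2_norm M f)\<^sup>2"
    by (intro power_mono l2_norm_nonneg)
  then show ?thesis unfolding graph_norm_def using clip_le[OF f] by (intro real_sqrt_le_mono) simp
qed

lemma frontier_disjoint: "frontier \<Omega> \<inter> \<Omega> = {}"
  using open_\<Omega> by (auto simp: frontier_def interior_open)

lemma small_near_frontier:
  assumes R: "\<And>\<psi>. \<psi> \<in> fdom a \<Longrightarrow> restr \<psi> \<in> DD" and K: "compact K" and e: "0 < e"
  obtains \<phi> V where "\<phi> \<in> fdom a" "\<And>x. 0 \<le> \<phi> x" "graph_norm M a \<phi> < e"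
    "open V" "K \<inter> frontier \<Omega> \<subseteq> V" "AE x in M. x \<in> V \<inter> \<Omega> \<longrightarrow> 1 \<le> \<phi> x"
proof -
  have Kf: "compact (K \<inter> frontier \<Omega>)" by (intro compact_Int_closed K) simp
  obtain \<eta> where \<eta>: "\<eta> \<in> fdom a" "continuous_on UNIV \<eta>" "\<And>x. x \<in> K \<inter> frontier \<Omega> \<Longrightarrow> \<eta> x = 1"
    using bump[OF Kf open_UNIV] by (metis subset_UNIV)
  define p where "p = restr (\<lambda>x. 2 * \<eta> x)"
  have p: "p \<in> DD" unfolding p_def by (intro R E.scale \<eta>)
  then obtain g where g: "g \<in> D_compact M a \<Omega>" "graph_norm M a (\<lambda>x. p x - g x) < e"
    using e by (auto simp: DD_def form_D_def)
  then obtain C where C: "compact C" "C \<subseteq> \<Omega>" "AE x in M. x \<notin> C \<longrightarrow> g x = 0"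
    unfolding D_compact_iff by blast
  have d: "(\<lambda>x. p x - g x) \<in> fdom a" by (intro E.diff DD_dom p D_compact_dom g)
  show thesis
  \<comment> \<open>On this set inside \<open>\<Omega>\<close> the function \<open>p\<close> exceeds
    1 and \<open>g\<close> vanishes. The closed set \<open>C\<close> lies in the open set
    \<open>\<Omega>\<close>, so removing it does not touch the boundary. Clipping makes the function
    nonnegative, which \<open>rel_cap_frontier_zero\<close> uses when summing.\<close>
  proof (rule that[of "\<lambda>x. min (max 0 (p x - g x)) 1" "{x. 1/2 < \<eta> x} \<inter> - C"])
    show "(\<lambda>x. min (max 0 (p x - g x)) 1) \<in> fdom a" by (rule clip_dom[OF d])
    show "graph_norm M a (\<lambda>x. min (max 0 (p x - g x)) 1) < e"
      using graph_clip_le[OF d] g(2) by linarith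
    show "open ({x. 1/2 < \<eta> x} \<inter> - C)"
      using compact_imp_closed[OF C(1)] \<eta>(2) by (intro open_Int open_Collect_less open_Compl) auto
    show "K \<inter> frontier \<Omega> \<subseteq> {x. 1/2 < \<eta> x} \<inter> - C"
      using \<eta>(3) C(2) frontier_disjoint by fastforce
    show "AE x in M. x \<in> {x. 1/2 < \<eta> x} \<inter> - C \<inter> \<Omega> \<longrightarrow> 1 \<le> min (max 0 (p x - g x)) 1"
      using C(3) by eventually_elim (auto simp: p_def restr_def)
  qed auto
qed

text \<open>The boundary need not be compact. Its pieces in a countable compact cover get functions
  of graph norm below e/2^(n+1); being nonnegative, they are all dominated by their sum, which has
  graph norm at most e.\<close>

lemma rel_cap_frontier_zero:
  assumes R: "\<And>\<psi>. \<psi> \<in> fdom a \<Longrightarrow> restr \<psi> \<in> DD"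
  shows "rel_cap M a \<Omega> (frontier \<Omega>) = 0"
proof -
  have le: "rel_cap M a \<Omega> (frontier \<Omega>) \<le> ennreal (e\<^sup>2)" if e: "0 < e" for e
  proof -
    obtain K :: "nat \<Rightarrow> 'a set" where K: "\<And>n. compact (K n)" "(\<Union>n. K n) = UNIV"
      using sc by (auto simp: sigma_compact_def)
    define P where "P n \<phi> V \<longleftrightarrow> \<phi> \<in> fdom a \<and> (\<forall>x. 0 \<le> \<phi> x) \<and> graph_norm M a \<phi> < e / 2 ^ Suc n
      \<and> open V \<and> K n \<inter> frontier \<Omega> \<subseteq> V \<and> (AE x in M. x \<in> V \<inter> \<Omega> \<longrightarrow> 1 \<le> \<phi> x)" for n \<phi> V
    have "\<exists>\<phi> V. P n \<phi> V" for n
      unfolding P_def by (rule small_near_frontier[OF R K(1), of "e / 2 ^ Suc n" n]) (use e in auto)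
    then obtain \<phi> V where P: "\<And>n. P n (\<phi> n) (V n)" by metis
    have \<phi>: "\<And>n. \<phi> n \<in> fdom a" "\<And>n x. 0 \<le> \<phi> n x" "\<And>n. graph_norm M a (\<phi> n) < e / 2 ^ Suc n"
      and V: "\<And>n. open (V n)" "\<And>n. K n \<inter> frontier \<Omega> \<subseteq> V n"
        "\<And>n. AE x in M. x \<in> V n \<inter> \<Omega> \<longrightarrow> 1 \<le> \<phi> n x"
      using P unfolding P_def by blast+
    define s where "s m x = (\<Sum>i<m. \<phi> i x)" for m x
    have s_Suc: "s (Suc m) = (\<lambda>x. s m x + \<phi> m x)" for m by (simp add: s_def fun_eq_iff)
    have s: "s m \<in> fdom a" for m
      by (induction m) (auto simp: s_Suc E.add \<phi>, simp add: s_def E.zero)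
    \<comment> \<open>Telescoped geometric sums: the case \<open>n = 0\<close> bounds the whole sum
      by \<open>e\<close>, large \<open>n\<close> give the Cauchy property.\<close>
    have tail: "graph_norm M a (\<lambda>x. s m x - s n x) \<le> e / 2 ^ n - e / 2 ^ m" if "n \<le> m" for m n
      using that
    proof (induction m rule: dec_induct)
      case base
      show ?case by (simp add: graph_norm_qnorm qnorm_def G.q_zero G.zero)
    next
      case (step m)
      have "(\<lambda>x. s (Suc m) x - s n x) = (\<lambda>x. (s m x - s n x) + \<phi> m x)" by (auto simp: s_Suc)
      then have "graph_norm M a (\<lambda>x. s (Suc m) x - s n x)
          \<le> graph_norm M a (\<lambda>x. s m x - s n x) + graph_norm M a (\<phi> m)"
        using G.qnorm_triangle[OF E.diff[OF s s] \<phi>(1), of m n m] by (simp add: graph_norm_qnorm)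
      also have "\<dots> \<le> (e / 2 ^ n - e / 2 ^ m) + e / 2 ^ Suc m"
        using step.IH \<phi>(3)[of m] by linarith
      also have "\<dots> = e / 2 ^ n - e / 2 ^ Suc m" by (simp add: field_simps)
      finally show ?case .
    qed
    have "G.Cauchyq s"
    proof (rule G.CauchyqI[OF s, of "\<lambda>n. (e * (1 / 2) ^ n)\<^sup>2"])
      have "(\<lambda>n. (e * (1 / 2) ^ n)\<^sup>2) \<longlonglongrightarrow> (e * 0)\<^sup>2"
        by (intro tendsto_intros LIMSEQ_realpow_zero) auto
      then show "(\<lambda>n. (e * (1 / 2) ^ n)\<^sup>2) \<longlonglongrightarrow> 0" by simp
      fix m n :: nat assume nm: "n \<le> m"
      have "0 \<le> e / 2 ^ m" using e by simp
      then have "graph_norm M a (\<lambda>x. s m x - s n x) \<le> e * (1 / 2) ^ n"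
        using tail[OF nm] by (simp add: power_divide)
      then have "(graph_norm M a (\<lambda>x. s m x - s n x))\<^sup>2 \<le> (e * (1 / 2) ^ n)\<^sup>2"
        by (intro power_mono) (simp_all add: graph_norm_qnorm G.qnorm_nonneg E.diff s)
      then show "graph_inner M a 1 (\<lambda>x. s m x - s n x) (\<lambda>x. s m x - s n x) \<le> (e * (1 / 2) ^ n)\<^sup>2"
        by (simp add: graph_norm_qnorm G.qnorm_sq E.diff s)
    qed
    then obtain f where f: "f \<in> fdom a" "(\<lambda>n. graph_norm M a (\<lambda>x. s n x - f x)) \<longlonglongrightarrow> 0"
      using closed s unfolding closed_form_def G.Cauchyq_def graph_norm_qnorm by blast
    have "(\<lambda>n. graph_norm M a (s n)) \<longlonglongrightarrow> graph_norm M a f"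
      unfolding graph_norm_qnorm by (intro G.tendsto_qnorm s f f(2)[unfolded graph_norm_qnorm])
    moreover have "graph_norm M a (s n) \<le> e" for n
    proof -
      have "0 \<le> e / 2 ^ n" using e by simp
      moreover have "s 0 = (\<lambda>_. 0)" by (simp add: s_def fun_eq_iff)
      ultimately show ?thesis using tail[of 0 n] by simp
    qed
    ultimately have fe: "graph_norm M a f \<le> e" by (intro LIMSEQ_le_const2) auto
    have fge: "AE x in M. \<phi> n x \<le> f x" for n
    proof (rule L2_limit_ge[OF dom_L2[OF s] dom_L2[OF f(1)] L2_measurable[OF dom_L2[OF \<phi>(1)]]
          graph_limit_l2[OF s f], of "Suc n"])
      fix m assume "Suc n \<le> m"
      then have "\<phi> n x \<le> s m x" for x
        unfolding s_def by (intro member_le_sum) (auto simp: \<phi>(2))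
      then show "AE x in M. \<phi> n x \<le> s m x" by simp
    qed
    have "AE x in M. \<forall>n. \<phi> n x \<le> f x \<and> (x \<in> V n \<inter> \<Omega> \<longrightarrow> 1 \<le> \<phi> n x)"
      using fge V(3) by (simp add: AE_all_countable)
    then have "AE x in M. x \<in> (\<Union>n. V n) \<inter> \<Omega> \<longrightarrow> 1 \<le> f x"
      by eventually_elim (auto intro: order_trans)
    moreover have "open (\<Union>n. V n)" using V by auto
    moreover have "frontier \<Omega> \<subseteq> (\<Union>n. V n)" 
    proof
      fix x assume x: "x \<in> frontier \<Omega>"
      obtain n where "x \<in> K n" using K(2) by blast
      then show "x \<in> (\<Union>n. V n)" using x V(2)[of n] by blast
    qed
    ultimately have mem: "f \<in> {f \<in> fdom a. \<exists>V. open V \<and> frontier \<Omega> \<subseteq> V \<and> (AE x in M. x \<in> V \<inter> \<Omega> \<longrightarrow> 1 \<le> f x)}"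
      using f(1) by blast
    have "rel_cap M a \<Omega> (frontier \<Omega>) \<le> ennreal ((graph_norm M a f)\<^sup>2)"
      unfolding rel_cap_def by (rule INF_lower[OF mem])
    also have "\<dots> \<le> ennreal (e\<^sup>2)"
      using fe by (intro ennreal_leI power_mono) (simp_all add: graph_norm_qnorm G.qnorm_nonneg f)
    finally show ?thesis .
  qed
  have "rel_cap M a \<Omega> (frontier \<Omega>) \<le> 0"
  proof (rule ennreal_le_epsilon)
    fix e :: real assume "0 < e"
    then show "rel_cap M a \<Omega> (frontier \<Omega>) \<le> 0 + ennreal e" using le[of "sqrt e"] by simp
  qed
  then show ?thesis by simp
qed

section \<open>From the capacity to the forms\<close>

text \<open>A cutoff equal to 1 on a compact carrier of \<open>h\<close> lies below the indicator of
  \<open>\<Omega>\<close> and sees the full energy of \<open>h\<close>. It does not distinguish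
  \<open>h\<close> from \<open>g\<close>, since these agree on \<open>\<Omega>\<close>.\<close>

lemma form_le_neumann:
  assumes h: "h \<in> D_compact M a \<Omega>" "h \<in> Db" and g: "g \<in> Db" and eq: "AE x in M. h x = restr g x"
  shows "fval a h h \<le> neumann_quad M a \<Omega> g"
proof -
  obtain K where K: "compact K" "K \<subseteq> \<Omega>" "AE x in M. x \<notin> K \<longrightarrow> h x = 0"
    using h(1) unfolding D_compact_iff by blast
  obtain \<eta> L where \<eta>: "\<eta> \<in> fdom a" "\<And>x. 0 \<le> \<eta> x" "\<And>x. \<eta> x \<le> 1" "\<And>x. x \<in> K \<Longrightarrow> \<eta> x = 1"
    "L \<subseteq> \<Omega>" "\<And>x. x \<notin> L \<Longrightarrow> \<eta> x = 0"
    using bump[OF K(1) open_\<Omega> K(2)] by metis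
  have \<eta>b: "\<eta> \<in> Db" by (rule Db_I[OF \<eta>(1), of 1]) (use \<eta> in auto)
  have "\<eta> x \<le> indicator \<Omega> x" for x
  proof (cases "x \<in> \<Omega>")
    case False
    then have "\<eta> x = 0" using \<eta>(5,6) by blast
    then show ?thesis by simp
  qed (simp add: \<eta>(3))
  then have w: "\<eta> \<in> cutoffs M a \<Omega>" using \<eta>b \<eta>(2) by (auto simp: cutoffs_def Db_def)
  have full: "AE x in M. (\<eta> x - 1) * h x = 0"
    using K(3) by eventually_elim (use \<eta>(4) in auto)
  have hg: "AE x in M. x \<in> \<Omega> \<longrightarrow> h x = g x" using eq by eventually_elim (auto simp: restr_def)
  have "fval a h h = truncated_form a \<eta> h" by (rule truncated_full[OF w h(2) full, symmetric])
  also have "\<dots> = truncated_form a \<eta> g" by (rule truncated_eq[OF w h(2) g hg])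
  also have "\<dots> = truncated_form_ext M a \<eta> g"
    by (rule truncated_form_ext_Db[OF cutoffs_cutoff[OF w] g, symmetric])
  also have "\<dots> \<le> neumann_quad M a \<Omega> g" by (rule ext_le_neumann[OF w Db_D[OF g]])
  finally show ?thesis .
qed

lemma Db_restr: "f \<in> Db \<Longrightarrow> restr f \<in> fdom a \<Longrightarrow> restr f \<in> Db"
proof -
  assume "f \<in> Db" and r: "restr f \<in> fdom a"
  then obtain K where K: "AE x in M. \<bar>f x\<bar> \<le> K" by (auto elim: Db_E)
  have "AE x in M. \<bar>restr f x\<bar> \<le> K"
    using K by eventually_elim (rule order_trans[OF restr_abs_le])
  then show ?thesis by (rule Db_I[OF r])
qed

text \<open>Boundedness allows multiplication by the capacity functions; compact support leaves a
  compact part of \<open>\<Omega>\<close> once a neighbourhood of the boundary is removed. The set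
  is closed under differences, which \<open>restr_DD\<close> uses for Cauchy sequences.\<close>

definition compactly_supported :: "('a \<Rightarrow> real) set" where
  "compactly_supported = {f \<in> Db. \<exists>K. compact K \<and> (\<forall>x. x \<notin> K \<longrightarrow> f x = 0)}"

lemma Cc_compactly_supported: "f \<in> fdom a \<Longrightarrow> f \<in> Cc \<Longrightarrow> f \<in> compactly_supported"
  using closure_subset[of "{x. f x \<noteq> 0}"]
  by (auto simp: compactly_supported_def Cc_Db Cc_def intro!: exI[of _ "closure {x. f x \<noteq> 0}"])

lemma compactly_supported_diff:
  assumes "f \<in> compactly_supported" "g \<in> compactly_supported"
  shows "(\<lambda>x. f x - g x) \<in> compactly_supported"
proof -
  obtain K L where "f \<in> Db" "compact K" "\<forall>x. x \<notin> K \<longrightarrow> f x = 0"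
    and "g \<in> Db" "compact L" "\<forall>x. x \<notin> L \<longrightarrow> g x = 0"
    using assms by (auto simp: compactly_supported_def)
  then show ?thesis
    by (auto simp: compactly_supported_def Db_diff intro!: exI[of _ "K \<union> L"])
qed

lemma capacity_sequence:
  assumes cap: "rel_cap M a \<Omega> (frontier \<Omega>) = 0"
  obtains \<phi> V where "\<And>n. \<phi> n \<in> fdom a" "\<And>n x. 0 \<le> \<phi> n x" "\<And>n x. \<phi> n x \<le> 1"
    "\<And>n. graph_norm M a (\<phi> n) \<le> 1 / Suc n" "\<And>n. open (V n)" "\<And>n. frontier \<Omega> \<subseteq> V n"
    "\<And>n. AE x in M. x \<in> V n \<inter> \<Omega> \<longrightarrow> \<phi> n x = 1"
proof -
  define P where "P n \<phi> V \<longleftrightarrow> \<phi> \<in> fdom a \<and> (\<forall>x. 0 \<le> \<phi> x) \<and> (\<forall>x. \<phi> x \<le> 1)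
    \<and> graph_norm M a \<phi> \<le> 1 / Suc n \<and> open V \<and> frontier \<Omega> \<subseteq> V
    \<and> (AE x in M. x \<in> V \<inter> \<Omega> \<longrightarrow> \<phi> x = 1)" for n \<phi> V
  have "\<exists>\<phi> V. P n \<phi> V" for n
  proof -
    have "rel_cap M a \<Omega> (frontier \<Omega>) < ennreal ((1 / Suc n)\<^sup>2)" by (simp add: cap)
    then obtain f V where f: "f \<in> fdom a" "ennreal ((graph_norm M a f)\<^sup>2) < ennreal ((1 / Suc n)\<^sup>2)"
      and V: "open V" "frontier \<Omega> \<subseteq> V" "AE x in M. x \<in> V \<inter> \<Omega> \<longrightarrow> 1 \<le> f x"
      unfolding rel_cap_def INF_less_iff by blast
    have "(graph_norm M a f)\<^sup>2 < (1 / Suc n)\<^sup>2" using f(2) by (simp add: ennreal_less_iff)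
    then have "graph_norm M a f < 1 / Suc n" by (rule power2_less_imp_less) simp
    then have "graph_norm M a (\<lambda>x. min (max 0 (f x)) 1) \<le> 1 / Suc n"
      using graph_clip_le[OF f(1)] by linarith
    moreover have "AE x in M. x \<in> V \<inter> \<Omega> \<longrightarrow> min (max 0 (f x)) 1 = 1"
      using V(3) by eventually_elim auto
    ultimately show ?thesis
      using clip_dom[OF f(1)] V(1,2) unfolding P_def by (intro exI[of _ "\<lambda>x. min (max 0 (f x)) 1"] exI[of _ V]) auto
  qed
  then obtain \<phi> V where P: "\<And>n. P n (\<phi> n) (V n)" by metis
  show thesis by (rule that[of \<phi> V]) (use P in \<open>unfold P_def, blast+\<close>)
qed

lemma restr_compactly_supported:
  assumes cap: "rel_cap M a \<Omega> (frontier \<Omega>) = 0" and psi: "\<psi> \<in> compactly_supported"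
  shows "restr \<psi> \<in> DD" "qnorm (fval a) (restr \<psi>) \<le> sqrt (neumann_quad M a \<Omega> \<psi>)"
proof -
  obtain \<phi> V where \<phi>: "\<And>n. \<phi> n \<in> fdom a" "\<And>n x. 0 \<le> \<phi> n x" "\<And>n x. \<phi> n x \<le> 1"
    "\<And>n. graph_norm M a (\<phi> n) \<le> 1 / Suc n" and V: "\<And>n. open (V n)" "\<And>n. frontier \<Omega> \<subseteq> V n"
    "\<And>n. AE x in M. x \<in> V n \<inter> \<Omega> \<longrightarrow> \<phi> n x = 1"
    by (rule capacity_sequence[OF cap]) blast
  have \<phi>b: "\<phi> n \<in> Db" for n by (rule Db_I[OF \<phi>(1), where K = 1]) (use \<phi> in auto)
  obtain K where psib: "\<psi> \<in> Db" and K: "compact K" "\<And>x. x \<notin> K \<Longrightarrow> \<psi> x = 0"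
    using psi by (auto simp: compactly_supported_def)
  obtain C where C: "0 \<le> C" "AE x in M. \<bar>\<psi> x\<bar> \<le> C" using psib by (auto elim: Db_E)
  note psid = Db_D[OF psib]
  \<comment> \<open>The property of the \<open>w n\<close> that must survive in the convex
    combinations \<open>v n\<close>: it is stable under midpoints.\<close>
  define S where "S = {w \<in> Db. restr (\<lambda>x. \<psi> x - w x) \<in> D_compact M a \<Omega>}"
  define w where "w n = (\<lambda>x. \<phi> n x * \<psi> x)" for n
  have wb: "w n \<in> Db" for n unfolding w_def by (rule Db_mult[OF \<phi>b psib])
  have wS: "w n \<in> S" for n
  proof -
    \<comment> \<open>A point of the closure of \<open>\<Omega>\<close> outside \<open>V n\<close>
      is not on the boundary, so what remains of \<open>K\<close> is a compact subset of
      \<open>\<Omega>\<close>.\<close>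
    have cl: "K \<inter> (closure \<Omega> \<inter> - V n) \<subseteq> \<Omega>"
      using V(2)[of n] open_\<Omega> by (auto simp: frontier_def interior_open)
    have cc: "compact (K \<inter> (closure \<Omega> \<inter> - V n))"
      using V(1)[of n] by (intro compact_Int_closed K closed_Int) auto
    obtain \<eta> L where \<eta>: "\<eta> \<in> fdom a" "\<And>x. 0 \<le> \<eta> x" "\<And>x. \<eta> x \<le> 1"
      "\<And>x. x \<in> K \<inter> (closure \<Omega> \<inter> - V n) \<Longrightarrow> \<eta> x = 1"
      "compact L" "L \<subseteq> \<Omega>" "\<And>x. x \<notin> L \<Longrightarrow> \<eta> x = 0"
      using bump[OF cc open_\<Omega> cl] by metis
    have \<eta>b: "\<eta> \<in> Db" by (rule Db_I[OF \<eta>(1), of 1]) (use \<eta> in auto)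
    have h: "(\<lambda>x. \<eta> x * (\<psi> x - w n x)) \<in> fdom a"
      by (intro Db_D Db_mult \<eta>b Db_diff psib wb)
    have eq: "AE x in M. \<eta> x * (\<psi> x - w n x) = restr (\<lambda>x. \<psi> x - w n x) x"
      using V(3)[of n]
    proof eventually_elim
      case (elim x)
      show ?case
      proof (cases "x \<in> \<Omega>")
        case True
        show ?thesis
        proof (cases "x \<in> V n")
          case True
          then show ?thesis using elim \<open>x \<in> \<Omega>\<close> by (simp add: w_def restr_def)
        next
          case False
          show ?thesis
          proof (cases "x \<in> K")
            case True
            then have "\<eta> x = 1" using False \<open>x \<in> \<Omega>\<close> closure_subset[of \<Omega>] by (intro \<eta>) auto
            then show ?thesis using \<open>x \<in> \<Omega>\<close> by (simp add: restr_def)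
          next
            case False
            then show ?thesis by (simp add: K w_def restr_def)
          qed
        qed
      next
        case False
        then have "\<eta> x = 0" using \<eta>(6,7) by blast
        then show ?thesis using False by (simp add: restr_def)
      qed
    qed
    have rm: "restr (\<lambda>x. \<psi> x - w n x) \<in> borel_measurable M"
      by (intro restr_measurable Db_measurable Db_diff psib wb)
    have "restr (\<lambda>x. \<psi> x - w n x) \<in> fdom a" by (rule dom_cong[OF h rm eq])
    moreover have "AE x in M. x \<notin> L \<longrightarrow> restr (\<lambda>x. \<psi> x - w n x) x = 0"
      using eq by eventually_elim (use \<eta>(7) in auto)
    ultimately show ?thesis using wb \<eta>(5,6) unfolding S_def D_compact_iff by blast
  qed
  \<comment> \<open>\<open>mult_le\<close> with the bounds 1 for \<open>\<phi> n\<close> and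
    \<open>C\<close> for \<open>\<psi>\<close>; the energy of \<open>\<phi> n\<close> is at most
    1.\<close>
  have wbd: "fval a (w n) (w n) \<le> 2 * fval a \<psi> \<psi> + 2 * C\<^sup>2" for n
  proof -
    have "fval a (w n) (w n) \<le> 2 * 1\<^sup>2 * fval a \<psi> \<psi> + 2 * C\<^sup>2 * fval a (\<phi> n) (\<phi> n)"
      unfolding w_def by (rule mult_le(2)) (use \<phi> C psid in auto)
    also have "fval a (\<phi> n) (\<phi> n) \<le> 1"
    proof -
      have "qnorm (fval a) (\<phi> n) \<le> 1 / Suc n" using fval_le_graph[OF \<phi>(1)] \<phi>(4) order_trans by blast
      also have "\<dots> \<le> 1" by simp
      finally show ?thesis by (simp add: qnorm_def)
    qed
    finally show ?thesis by (simp add: mult_left_mono)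
  qed
  have wl: "(\<lambda>n. l2_norm M (\<lambda>x. w n x - 0)) \<longlonglongrightarrow> 0"
  proof (rule Lim_null_comparison)
    have "(\<lambda>n. C * (1 / Suc n)) \<longlonglongrightarrow> C * 0" by (intro tendsto_intros LIMSEQ_Suc[OF lim_1_over_n])
    then show "(\<lambda>n. C * (1 / Suc n)) \<longlonglongrightarrow> 0" by simp
    have "l2_norm M (w n) \<le> C * (1 / Suc n)" for n
    proof -
      have "l2_norm M (w n) \<le> l2_norm M (\<lambda>x. C * \<phi> n x)"
      proof (rule l2_norm_mono_AE)
        show "AE x in M. \<bar>w n x\<bar> \<le> \<bar>C * \<phi> n x\<bar>"
          using C(2)
        proof eventually_elim
          case (elim x)
          then show ?case
            using mult_left_mono[OF elim \<phi>(2)[of n x]] \<phi>(2)[of n x] C(1)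
            by (simp add: w_def abs_mult mult.commute)
        qed
      qed (auto intro: Db_measurable wb L2.scale dom_L2 \<phi>)
      also have "\<dots> = C * l2_norm M (\<phi> n)"
        using L2.qnorm_scale[OF dom_L2[OF \<phi>(1)], of C n] C(1) by (simp add: l2_norm_qnorm)
      also have "\<dots> \<le> C * (1 / Suc n)"
        using order_trans[OF l2_le_graph[OF \<phi>(1)] \<phi>(4)] C(1) by (rule mult_left_mono)
      finally show ?thesis .
    qed
    then show "\<forall>\<^sub>F n in sequentially. norm (l2_norm M (\<lambda>x. w n x - 0)) \<le> C * (1 / Suc n)"
      by (simp add: l2_norm_nonneg)
  qed
  obtain v where v: "\<And>n. v n \<in> midpoints (w ` {n..})" "(\<lambda>n. graph_norm M a (\<lambda>x. v n x - 0)) \<longlonglongrightarrow> 0"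
    by (rule closed_weak_limit[OF Db_D[OF wb] wbd L2.zero wl]) blast
  have S: "u \<in> S" if "u \<in> midpoints (w ` {n..})" for u n
    using that
  proof (induction rule: midpoints.induct)
    case (mid f g)
    have "restr (\<lambda>x. \<psi> x - (f x / 2 + g x / 2))
        = (\<lambda>x. 1/2 * restr (\<lambda>x. \<psi> x - f x) x + 1/2 * restr (\<lambda>x. \<psi> x - g x) x)"
      by (auto simp: restr_def indicator_def field_simps)
    moreover have "\<dots> \<in> D_compact M a \<Omega>"
      using mid.IH by (intro D_compact_add D_compact_scale) (auto simp: S_def)
    moreover have "(\<lambda>x. f x / 2 + g x / 2) \<in> Db"
      using Db_add[OF Db_scale[of f "1/2"] Db_scale[of g "1/2"]] mid.IH by (simp add: S_def)
    ultimately show ?case by (simp add: S_def)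
  qed (auto simp: wS)
  have vb: "v n \<in> Db" for n using S[OF v(1)] by (simp add: S_def)
  define h where "h n = restr (\<lambda>x. \<psi> x - v n x)" for n
  have h: "h n \<in> D_compact M a \<Omega>" for n using S[OF v(1)] by (simp add: S_def h_def)
  note hd = D_compact_dom[OF h]
  have hb: "h n \<in> Db" for n
    using hd[of n] unfolding h_def by (intro Db_restr Db_diff psib vb)
  have v0: "(\<lambda>n. graph_norm M a (v n)) \<longlonglongrightarrow> 0" using v(2) by simp
  \<comment> \<open>The differences have compact support in \<open>\<Omega>\<close> and are
    restrictions of differences of the \<open>v n\<close>, so \<open>form_le_neumann\<close> makes
    \<open>h\<close> Cauchy because \<open>v\<close> is.\<close>
  have hdiff: "graph_norm M a (\<lambda>x. h m x - h n x) \<le> graph_norm M a (\<lambda>x. v m x - v n x)" for m n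
  proof -
    have e: "(\<lambda>x. h m x - h n x) = restr (\<lambda>x. v n x - v m x)"
      by (auto simp: h_def restr_def algebra_simps)
    have mem: "(\<lambda>x. h m x - h n x) \<in> D_compact M a \<Omega>"
      using D_compact_add[OF h[of m] D_compact_scale[OF h[of n], of "-1"]] by simp
    have vv: "(\<lambda>x. v n x - v m x) \<in> Db" by (rule Db_diff[OF vb vb])
    have "fval a (\<lambda>x. h m x - h n x) (\<lambda>x. h m x - h n x) \<le> neumann_quad M a \<Omega> (\<lambda>x. v n x - v m x)"
      by (rule form_le_neumann[OF mem Db_diff[OF hb hb] vv]) (intro AE_I2 fun_cong[OF e])
    also have "\<dots> \<le> fval a (\<lambda>x. v n x - v m x) (\<lambda>x. v n x - v m x)"
      by (rule neumann_bounds[OF Db_D[OF vv]])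
    finally have 1: "fval a (\<lambda>x. h m x - h n x) (\<lambda>x. h m x - h n x)
        \<le> fval a (\<lambda>x. v n x - v m x) (\<lambda>x. v n x - v m x)" .
    have "l2_norm M (\<lambda>x. h m x - h n x) \<le> l2_norm M (\<lambda>x. v n x - v m x)"
      unfolding e by (rule restr_norm_le[OF dom_L2[OF Db_D[OF vv]]])
    then have "(l2_norm M (\<lambda>x. h m x - h n x))\<^sup>2 \<le> (l2_norm M (\<lambda>x. v n x - v m x))\<^sup>2"
      by (intro power_mono l2_norm_nonneg)
    then have "graph_norm M a (\<lambda>x. h m x - h n x) \<le> graph_norm M a (\<lambda>x. v n x - v m x)"
      unfolding graph_norm_def using 1 by (intro real_sqrt_le_mono) simp
    also have "\<dots> = graph_norm M a (\<lambda>x. v m x - v n x)"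
      unfolding graph_norm_qnorm by (intro G.qnorm_minus_commute Db_D vb)
    finally show ?thesis by simp
  qed
  have "G.Cauchyq v"
    using G.limit_Cauchyq[of v "\<lambda>_. 0"] Db_D[OF vb] v(2) E.zero by (simp add: graph_norm_qnorm)
  then have cau: "G.Cauchyq h"
    by (rule G.Cauchyq_dominated) (use hdiff in \<open>simp add: graph_norm_qnorm\<close>)
  have hl: "(\<lambda>n. l2_norm M (\<lambda>x. h n x - restr \<psi> x)) \<longlonglongrightarrow> 0"
  proof (rule Lim_null_comparison[OF _ v0], intro always_eventually allI)
    fix n
    have "(\<lambda>x. h n x - restr \<psi> x) = restr (\<lambda>x. (-1) * v n x)"
      by (auto simp: h_def restr_def algebra_simps)
    then have "l2_norm M (\<lambda>x. h n x - restr \<psi> x) \<le> l2_norm M (\<lambda>x. (-1) * v n x)"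
      using restr_norm_le[OF L2.scale[OF dom_L2[OF Db_D[OF vb]]], of "-1" n] by simp
    also have "\<dots> = l2_norm M (v n)"
      using L2.qnorm_scale[OF dom_L2[OF Db_D[OF vb]], of "-1" n] by (simp add: l2_norm_qnorm)
    also have "\<dots> \<le> graph_norm M a (v n)" by (rule l2_le_graph[OF Db_D[OF vb]])
    finally show "norm (l2_norm M (\<lambda>x. h n x - restr \<psi> x)) \<le> graph_norm M a (v n)"
      by (simp add: l2_norm_nonneg)
  qed
  note lim = closed_limit[OF hd cau restr_L2[OF dom_L2[OF psid]] hl]
  show "restr \<psi> \<in> DD" unfolding DD_iff using lim h by blast
  have "qnorm (fval a) (h n) \<le> sqrt (neumann_quad M a \<Omega> \<psi>) + graph_norm M a (v n)" for n
  proof -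
    have d: "(\<lambda>x. \<psi> x - v n x) \<in> Db" by (rule Db_diff[OF psib vb])
    have "fval a (h n) (h n) \<le> neumann_quad M a \<Omega> (\<lambda>x. \<psi> x - v n x)"
      by (rule form_le_neumann[OF h hb d]) (simp add: h_def)
    then have "qnorm (fval a) (h n) \<le> sqrt (neumann_quad M a \<Omega> (\<lambda>x. \<psi> x - v n x))"
      by (simp add: qnorm_def)
    also have "\<dots> \<le> sqrt (neumann_quad M a \<Omega> \<psi>) + qnorm (fval a) (\<lambda>x. \<psi> x - v n x - \<psi> x)"
      by (rule neumann_le_add[OF Db_D[OF d] psid])
    also have "qnorm (fval a) (\<lambda>x. \<psi> x - v n x - \<psi> x) = qnorm (fval a) (v n)"
      using E.qnorm_scale[OF Db_D[OF vb], of "-1" n] by simp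
    also have "\<dots> \<le> graph_norm M a (v n)" by (rule fval_le_graph[OF Db_D[OF vb]])
    finally show ?thesis by simp
  qed
  moreover have "(\<lambda>n. qnorm (fval a) (h n)) \<longlonglongrightarrow> qnorm (fval a) (restr \<psi>)"
    by (intro E.tendsto_qnorm hd lim(1) graph_limit_fval lim(2))
  moreover have "(\<lambda>n. sqrt (neumann_quad M a \<Omega> \<psi>) + graph_norm M a (v n)) \<longlonglongrightarrow> sqrt (neumann_quad M a \<Omega> \<psi>) + 0"
    by (intro tendsto_intros v0)
  ultimately show "qnorm (fval a) (restr \<psi>) \<le> sqrt (neumann_quad M a \<Omega> \<psi>)"
    using LIMSEQ_le[of "\<lambda>n. qnorm (fval a) (h n)"] by fastforce
qed

text \<open>Density of \<open>Cc\<close> extends \<open>restr_compactly_supported\<close>, which is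
  applied to differences for the Cauchy property. For the reverse inequality, every cutoff w
  satisfies E_w(u) = E_w(restr u) \<le> E(restr u) along the approximants, and the limit is taken
  before the supremum over cutoffs.\<close>

lemma restr_DD:
  assumes cap: "rel_cap M a \<Omega> (frontier \<Omega>) = 0" and psi: "\<psi> \<in> fdom a"
  shows "restr \<psi> \<in> DD" "fval a (restr \<psi>) (restr \<psi>) = neumann_quad M a \<Omega> \<psi>"
proof -
  obtain u where u: "\<And>n. u n \<in> fdom a" "\<And>n. u n \<in> Cc" "(\<lambda>n. graph_norm M a (\<lambda>x. u n x - \<psi> x)) \<longlonglongrightarrow> 0"
    by (rule Cc_dense[OF psi]) blast
  note uc = Cc_compactly_supported[OF u(1,2)]
  note ub = Cc_Db[OF u(1,2)]
  note r = restr_compactly_supported[OF cap uc]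
  note rd = DD_dom[OF r(1)]
  have rle: "graph_norm M a (\<lambda>x. restr (u m) x - restr (u n) x) \<le> graph_norm M a (\<lambda>x. u m x - u n x)" for m n
  proof -
    have d: "(\<lambda>x. u m x - u n x) \<in> fdom a" by (rule E.diff[OF u(1) u(1)])
    have "qnorm (fval a) (restr (\<lambda>x. u m x - u n x)) \<le> sqrt (neumann_quad M a \<Omega> (\<lambda>x. u m x - u n x))"
      by (rule restr_compactly_supported(2)[OF cap compactly_supported_diff[OF uc uc]])
    then have 1: "fval a (restr (\<lambda>x. u m x - u n x)) (restr (\<lambda>x. u m x - u n x))
        \<le> fval a (\<lambda>x. u m x - u n x) (\<lambda>x. u m x - u n x)"
      using neumann_bounds(2)[OF d, of \<Omega>] unfolding qnorm_def real_sqrt_le_iff by linarith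
    have "(l2_norm M (restr (\<lambda>x. u m x - u n x)))\<^sup>2 \<le> (l2_norm M (\<lambda>x. u m x - u n x))\<^sup>2"
      by (intro power_mono l2_norm_nonneg restr_norm_le dom_L2 d)
    then show ?thesis
      unfolding graph_norm_def restr_diff[symmetric] using 1 by (intro real_sqrt_le_mono) simp
  qed
  have cau: "G.Cauchyq (\<lambda>n. restr (u n))"
    by (rule G.Cauchyq_dominated[OF G.limit_Cauchyq[OF u(1) psi u(3)[unfolded graph_norm_qnorm]]])
      (use rle in \<open>simp add: graph_norm_qnorm\<close>)
  have hl: "(\<lambda>n. l2_norm M (\<lambda>x. restr (u n) x - restr \<psi> x)) \<longlonglongrightarrow> 0"
  proof (rule Lim_null_comparison[OF _ graph_limit_l2[OF u(1) psi u(3)]], intro always_eventually allI)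
    fix n
    show "norm (l2_norm M (\<lambda>x. restr (u n) x - restr \<psi> x)) \<le> l2_norm M (\<lambda>x. u n x - \<psi> x)"
      using restr_norm_le[OF dom_L2[OF E.diff[OF u(1) psi]], of n]
      by (simp add: l2_norm_nonneg restr_diff)
  qed
  note lim = closed_limit[OF rd cau restr_L2[OF dom_L2[OF psi]] hl]
  show "restr \<psi> \<in> DD" by (rule DD_closed[OF lim(1) r(1) lim(2)])
  note fl = graph_limit_fval[OF rd lim]
  have "qnorm (fval a) (restr (u n)) \<le> sqrt (neumann_quad M a \<Omega> \<psi>) + qnorm (fval a) (\<lambda>x. u n x - \<psi> x)" for n
    using r(2)[of n] neumann_le_add[OF u(1) psi, of \<Omega> n] by linarith
  moreover have "(\<lambda>n. qnorm (fval a) (restr (u n))) \<longlonglongrightarrow> qnorm (fval a) (restr \<psi>)"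
    by (intro E.tendsto_qnorm rd lim(1) fl)
  moreover have "(\<lambda>n. sqrt (neumann_quad M a \<Omega> \<psi>) + qnorm (fval a) (\<lambda>x. u n x - \<psi> x))
      \<longlonglongrightarrow> sqrt (neumann_quad M a \<Omega> \<psi>) + 0"
    by (intro tendsto_intros graph_limit_fval u psi)
  ultimately have "qnorm (fval a) (restr \<psi>) \<le> sqrt (neumann_quad M a \<Omega> \<psi>)"
    using LIMSEQ_le[of "\<lambda>n. qnorm (fval a) (restr (u n))"] by fastforce
  then have 1: "fval a (restr \<psi>) (restr \<psi>) \<le> neumann_quad M a \<Omega> \<psi>" by (simp add: qnorm_def)
  have 2: "neumann_quad M a \<Omega> \<psi> \<le> fval a (restr \<psi>) (restr \<psi>)"
  proof (rule neumann_least)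
    fix w assume w: "w \<in> cutoffs M a \<Omega>"
    have rb: "restr (u n) \<in> Db" for n by (rule Db_restr[OF ub rd])
    have "truncated_form a w (u n) \<le> fval a (restr (u n)) (restr (u n))" for n
      using truncated_eq[OF w ub rb, of n n] cutoff_bounds(2)[OF cutoffs_cutoff[OF w] rb, of n]
      by (auto simp: restr_def)
    moreover have "(\<lambda>n. fval a (restr (u n)) (restr (u n))) \<longlonglongrightarrow> fval a (restr \<psi>) (restr \<psi>)"
      by (intro E.tendsto_q rd lim(1) fl)
    ultimately show "truncated_form_ext M a w \<psi> \<le> fval a (restr \<psi>) (restr \<psi>)"
      using LIMSEQ_le[OF truncated_form_ext_limit[OF cutoffs_cutoff[OF w] psi ub u(3)]] by blast
  qed
  show "fval a (restr \<psi>) (restr \<psi>) = neumann_quad M a \<Omega> \<psi>" using 1 2 by simp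
qed

end

section \<open>Identification of the relaxed Neumann form\<close>

lemma form_extends_refl: "form_extends r r"
  by (simp add: form_extends_def)

context lc_dirichlet
begin

text \<open>The candidate for the relaxation of the Neumann form when the capacity vanishes.\<close>

definition form_r :: "'a form" where
  "form_r = \<lparr>fdom = {f \<in> L2 M. restr f \<in> DD}, fval = (\<lambda>f g. fval a (restr f) (restr g))\<rparr>"

lemma fdom_r: "f \<in> fdom form_r \<longleftrightarrow> f \<in> L2 M \<and> restr f \<in> DD"
  and fval_r: "fval form_r f g = fval a (restr f) (restr g)"
  by (simp_all add: form_r_def)

lemma DD_eq: "DD = fdom (form_D M a \<Omega>)"
  by (simp add: DD_def)

lemma form_r_positive: "positive_form M (L2 M) form_r"
  unfolding positive_form_def
proof (intro conjI ballI allI impI)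
  have z: "(\<lambda>_. 0) \<in> DD" by (simp add: DD_eq D.E.zero)
  show "fdom form_r \<subseteq> L2 M" by (auto simp: fdom_r)
  show "(\<lambda>_. 0) \<in> fdom form_r" by (simp add: fdom_r L2.zero restr_zero z)
  fix f g h :: "'a \<Rightarrow> real" and c :: real
  assume f: "f \<in> fdom form_r"
  then have rf: "restr f \<in> DD" and fL: "f \<in> L2 M" by (auto simp: fdom_r)
  show "(\<lambda>x. c * f x) \<in> fdom form_r"
    using rf fL by (simp add: fdom_r restr_scale L2.scale DD_eq D.E.scale)
  show "0 \<le> fval form_r f f" by (simp add: fval_r E.q_nonneg DD_dom rf)
  {
    assume g: "g \<in> borel_measurable M" and eq: "AE x in M. f x = g x"
    have "AE x in M. restr f x = restr g x" using eq by eventually_elim (simp add: restr_def)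
    note e = rf restr_measurable[OF g] this
    have "restr g \<in> DD" using D.dom_cong[OF e(1)[unfolded DD_eq] e(2,3)] by (simp add: DD_eq)
    moreover have "g \<in> L2 M"
      by (rule L2_dominated(1)[OF fL g, of 1]) (use eq in \<open>auto elim: eventually_mono\<close>)
    ultimately show "g \<in> fdom form_r" by (simp add: fdom_r)
    assume h: "h \<in> fdom form_r"
    then have rh: "restr h \<in> fdom a" by (simp add: fdom_r DD_dom)
    show "fval form_r f h = fval form_r g h"
      unfolding fval_r
      by (rule fval_cong[OF DD_dom[OF e(1)] e(2,3) rh L2_measurable[OF dom_L2[OF rh]]]) simp
  }
  assume g: "g \<in> fdom form_r"
  then have rg: "restr g \<in> DD" and gL: "g \<in> L2 M" by (auto simp: fdom_r)
  show "(\<lambda>x. f x + g x) \<in> fdom form_r"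
    using rf rg fL gL by (simp add: fdom_r restr_add L2.add DD_eq D.E.add)
  show "fval form_r (\<lambda>x. c * f x) g = c * fval form_r f g"
    by (simp add: fval_r restr_scale E.q_scale DD_dom rf rg)
  show "fval form_r f g = fval form_r g f"
    unfolding fval_r by (intro E.q_sym DD_dom rf rg)
  assume h: "h \<in> fdom form_r"
  then show "fval form_r (\<lambda>x. f x + g x) h = fval form_r f h + fval form_r g h"
    by (simp add: fval_r fdom_r restr_add E.q_add DD_dom rf rg)
qed

text \<open>Off \<open>\<Omega>\<close> only the \<open>L2\<close> norm is controlled, so the limit
  function comes from \<open>Riesz_Fischer\<close>. The graph limit of the restrictions exists by
  closedness of \<open>a\<close> and is the restriction of that function.\<close>

lemma form_r_closed: "closed_form M (L2 M) form_r"
  unfolding closed_form_def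
proof (intro conjI form_r_positive allI impI)
  fix u :: "nat \<Rightarrow> 'a \<Rightarrow> real"
  assume *: "(\<forall>n. u n \<in> fdom form_r)
    \<and> (\<forall>e>0. \<exists>N. \<forall>m\<ge>N. \<forall>n\<ge>N. graph_norm M form_r (\<lambda>x. u m x - u n x) < e)"
  then have cau: "\<And>e. 0 < e \<Longrightarrow> \<exists>N. \<forall>m\<ge>N. \<forall>n\<ge>N. graph_norm M form_r (\<lambda>x. u m x - u n x) < e"
    and uL: "\<And>n. u n \<in> L2 M" and ru: "\<And>n. restr (u n) \<in> DD" by (auto simp: fdom_r)
  note rd = DD_dom[OF ru]
  have gn: "graph_norm M form_r f = sqrt (fval a (restr f) (restr f) + (l2_norm M f)\<^sup>2)" for f
    by (simp add: graph_norm_def fval_r)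
  have le1: "graph_norm M a (\<lambda>x. restr (u m) x - restr (u n) x) \<le> graph_norm M form_r (\<lambda>x. u m x - u n x)" for m n
  proof -
    have "(l2_norm M (restr (\<lambda>x. u m x - u n x)))\<^sup>2 \<le> (l2_norm M (\<lambda>x. u m x - u n x))\<^sup>2"
      by (intro power_mono l2_norm_nonneg restr_norm_le L2.diff uL)
    then show ?thesis unfolding gn graph_norm_def[of M a] restr_diff[symmetric]
      by (intro real_sqrt_le_mono) simp
  qed
  have le2: "l2_norm M (\<lambda>x. u m x - u n x) \<le> graph_norm M form_r (\<lambda>x. u m x - u n x)" for m n
    unfolding gn by (rule real_le_rsqrt) (simp add: restr_diff E.q_nonneg E.diff rd)
  have "L2.Cauchyq M u"
    unfolding L2.Cauchyq_def l2_norm_qnorm[symmetric] using cau le2 by (meson order_le_less_trans)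
  then obtain f where f: "f \<in> L2 M" and lf: "(\<lambda>n. l2_norm M (\<lambda>x. u n x - f x)) \<longlonglongrightarrow> 0"
    using Riesz_Fischer[of u M, OF uL] by blast
  have "G.Cauchyq (\<lambda>n. restr (u n))"
    unfolding G.Cauchyq_def graph_norm_qnorm[symmetric] using cau le1 by (meson order_le_less_trans)
  moreover have "(\<lambda>n. l2_norm M (\<lambda>x. restr (u n) x - restr f x)) \<longlonglongrightarrow> 0"
  proof (rule Lim_null_comparison[OF _ lf], intro always_eventually allI)
    fix n
    show "norm (l2_norm M (\<lambda>x. restr (u n) x - restr f x)) \<le> l2_norm M (\<lambda>x. u n x - f x)"
      using restr_norm_le[OF L2.diff[OF uL f], of n] by (simp add: l2_norm_nonneg restr_diff)
  qed
  ultimately have lim: "restr f \<in> fdom a" "(\<lambda>n. graph_norm M a (\<lambda>x. restr (u n) x - restr f x)) \<longlonglongrightarrow> 0"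
    using closed_limit[OF rd _ restr_L2[OF f]] by auto
  have "restr f \<in> DD" by (rule DD_closed[OF lim(1) ru lim(2)])
  then have fr: "f \<in> fdom form_r" using f by (simp add: fdom_r)
  have "(\<lambda>n. sqrt ((qnorm (fval a) (\<lambda>x. restr (u n) x - restr f x))\<^sup>2 + (l2_norm M (\<lambda>x. u n x - f x))\<^sup>2))
      \<longlonglongrightarrow> sqrt (0\<^sup>2 + 0\<^sup>2)"
    by (intro tendsto_intros graph_limit_fval rd lim lf)
  then have "(\<lambda>n. graph_norm M form_r (\<lambda>x. u n x - f x)) \<longlonglongrightarrow> 0"
    by (simp add: gn restr_diff E.qnorm_sq E.diff rd lim)
  then show "\<exists>f\<in>fdom form_r. (\<lambda>n. graph_norm M form_r (\<lambda>x. u n x - f x)) \<longlonglongrightarrow> 0"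
    using fr by blast
qed

lemma relaxation_dom:
  assumes "is_relaxation M (L2 M) (form_N M a \<Omega>) b"
  shows "closed_form M (L2 M) b" "fdom a \<subseteq> fdom b"
  using assms unfolding is_relaxation_def is_closure_def is_largest_closable_def form_extends_def form_le_def
  by (auto simp: form_N_def)

text \<open>\<open>form_r\<close> is closed and equals the Neumann form on \<open>fdom a\<close>, so
  by maximality it lies below \<open>s\<close>. Equality on \<open>fdom s\<close> is the work: it
  turns \<open>form_r\<close> into a closed extension of \<open>s\<close>, and \<open>b\<close> is
  the smallest one. An extension suffices for comparing operators.\<close>

lemma relaxation_form_r:
  assumes cap: "rel_cap M a \<Omega> (frontier \<Omega>) = 0"
    and rel: "is_relaxation M (L2 M) (form_N M a \<Omega>) b"
  shows "form_extends form_r b"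
proof -
  obtain s where s: "closable_form M (L2 M) s" "form_le s (form_N M a \<Omega>)"
    "\<And>r. closable_form M (L2 M) r \<Longrightarrow> form_le r (form_N M a \<Omega>) \<Longrightarrow> form_le r s"
    and b: "closed_form M (L2 M) b" "form_extends b s"
    "\<And>c. closed_form M (L2 M) c \<Longrightarrow> form_extends c s \<Longrightarrow> form_extends c b"
    using rel unfolding is_relaxation_def is_largest_closable_def is_closure_def by blast
  interpret B: closed_L2_form M "L2 M" b by unfold_locales (use b in auto)
  interpret R: closed_L2_form M "L2 M" form_r by unfold_locales (use form_r_closed in auto)
  have pos: "positive_form M (L2 M) s" using s(1) by (simp add: closable_form_def)
  interpret S: semi_inner "fdom s" "fval s"
    by unfold_locales (use pos in \<open>auto simp: positive_form_def\<close>)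
  note N = restr_DD[OF cap]
  have rN: "fval form_r f f = fval (form_N M a \<Omega>) f f" if f: "f \<in> fdom a" for f
  proof -
    have rf: "restr f \<in> fdom a" using N(1)[OF f] DD_dom by blast
    \<comment> \<open>\<open>form_N\<close> is defined by polarization, so its diagonal value at
      \<open>f\<close> is one quarter of the difference of the quadratic values at
      \<open>f + f\<close> and at 0.\<close>
    have "neumann_quad M a \<Omega> (\<lambda>x. f x + f x) = fval a (restr (\<lambda>x. f x + f x)) (restr (\<lambda>x. f x + f x))"
      by (rule N(2)[OF E.add[OF f f], symmetric])
    also have "\<dots> = 4 * fval a (restr f) (restr f)" unfolding restr_add by (simp only: E.q_add_sq[OF rf rf])
    finally have 1: "neumann_quad M a \<Omega> (\<lambda>x. f x + f x) = 4 * fval a (restr f) (restr f)" .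
    have "neumann_quad M a \<Omega> (\<lambda>_. 0) = fval a (restr (\<lambda>_. 0)) (restr (\<lambda>_. 0))"
      by (rule N(2)[OF E.zero, symmetric])
    then have 2: "neumann_quad M a \<Omega> (\<lambda>_. 0) = 0" by (simp add: restr_zero E.q_zero E.zero)
    show ?thesis using 1 2 by (simp add: form_N_def fval_r)
  qed
  have dN: "fdom (form_N M a \<Omega>) = fdom a" by (simp add: form_N_def)
  have a_r: "f \<in> fdom form_r" if "f \<in> fdom a" for f
    using N(1)[OF that] dom_L2[OF that] by (simp add: fdom_r)
  have "closable_form M (L2 M) form_r"
    using form_r_positive form_r_closed form_extends_refl by (auto simp: closable_form_def)
  moreover have "form_le form_r (form_N M a \<Omega>)" using a_r rN by (auto simp: form_le_def dN)
  ultimately have rs: "form_le form_r s" by (rule s(3))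
  have sr: "fdom s \<subseteq> fdom form_r" using rs by (simp add: form_le_def)
  have sb: "fdom s \<subseteq> fdom b" "\<And>f g. f \<in> fdom s \<Longrightarrow> g \<in> fdom s \<Longrightarrow> fval b f g = fval s f g"
    using b(2) by (auto simp: form_extends_def)
  have as: "fdom a \<subseteq> fdom s" using s(2) by (simp add: form_le_def dN)
  have b_le_r: "fval b f f \<le> fval form_r f f" if f: "f \<in> fdom a" for f
  proof -
    have "fval b f f = fval s f f" using sb(2) as f by blast
    also have "\<dots> \<le> fval (form_N M a \<Omega>) f f" using s(2) f by (simp add: form_le_def dN)
    finally show ?thesis using rN[OF f] by simp
  qed
  have quad: "fval form_r f f = fval s f f" if f: "f \<in> fdom s" for f
  proof (rule antisym)
    show "fval form_r f f \<le> fval s f f" using rs f by (simp add: form_le_def)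
    have rf: "restr f \<in> DD" and fL: "f \<in> L2 M" using sr f by (auto simp: fdom_r)
    define g where "g = (\<lambda>x. f x - restr f x)"
    have gL: "g \<in> L2 M" unfolding g_def by (intro L2.diff fL restr_L2)
    have "\<exists>h\<in>fdom a. l2_norm M (\<lambda>x. g x - h x) < e" if "0 < e" for e
      using dense gL that unfolding densely_defined_def by blast
    from L2.approximating_sequence[of "fdom a" M, folded l2_norm_qnorm, OF this _ gL]
    obtain h where h: "\<And>n. h n \<in> fdom a" "(\<lambda>n. l2_norm M (\<lambda>x. h n x - g x)) \<longlonglongrightarrow> 0"
      using dom_L2 by blast
    \<comment> \<open>Approximants in \<open>fdom a\<close> that agree with \<open>f\<close> on
      \<open>\<Omega>\<close> and vary only outside. Their differences have zero
      \<open>form_r\<close> energy, hence zero energy for \<open>b\<close>, so \<open>L2\<close>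
      convergence is already convergence in the graph norm of \<open>b\<close>.\<close>
    define p where "p n = (\<lambda>x. restr f x + (h n x - restr (h n) x))" for n
    have pd: "p n \<in> fdom a" for n
      unfolding p_def by (intro E.add E.diff h DD_dom[OF rf] DD_dom[OF N(1)])
    have rp: "restr (p n) = restr f" for n
      by (simp add: p_def restr_add restr_diff restr_restr)
    have pb: "p n \<in> fdom b" for n using pd as sb by blast
    have "l2_norm M (\<lambda>x. p n x - f x) \<le> l2_norm M (\<lambda>x. h n x - g x)" for n
    proof (rule l2_norm_mono_AE)
      show "(\<lambda>x. h n x - g x) \<in> L2 M" by (intro L2.diff gL dom_L2 h)
      show "(\<lambda>x. p n x - f x) \<in> borel_measurable M" by (intro L2_measurable L2.diff dom_L2 pd fL)
      show "AE x in M. \<bar>p n x - f x\<bar> \<le> \<bar>h n x - g x\<bar>"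
        by (intro AE_I2) (auto simp: p_def g_def restr_def indicator_def)
    qed
    then have ll: "(\<lambda>n. l2_norm M (\<lambda>x. p n x - f x)) \<longlonglongrightarrow> 0"
      by (intro Lim_null_comparison[OF _ h(2)]) (simp add: l2_norm_nonneg)
    have "B.G.Cauchyq p"
      unfolding B.G.Cauchyq_def
    proof (intro allI impI)
      fix e :: real assume "0 < e"
      then obtain N where N: "\<And>m n. N \<le> m \<Longrightarrow> N \<le> n \<Longrightarrow> l2_norm M (\<lambda>x. p m x - p n x) < e"
        using L2.limit_Cauchyq[OF dom_L2[OF pd] fL ll[unfolded l2_norm_qnorm]]
        unfolding L2.Cauchyq_def l2_norm_qnorm by blast
      have "qnorm (graph_inner M b 1) (\<lambda>x. p m x - p n x) \<le> l2_norm M (\<lambda>x. p m x - p n x)" for m n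
      proof -
        have "fval b (\<lambda>x. p m x - p n x) (\<lambda>x. p m x - p n x)
            \<le> fval form_r (\<lambda>x. p m x - p n x) (\<lambda>x. p m x - p n x)"
          by (rule b_le_r[OF E.diff[OF pd pd]])
        also have "\<dots> = 0" by (simp add: fval_r restr_diff rp E.q_zero E.zero)
        finally show ?thesis unfolding qnorm_def l2_norm_def graph_inner_def by simp
      qed
      then show "\<exists>N. \<forall>m\<ge>N. \<forall>n\<ge>N. qnorm (graph_inner M b 1) (\<lambda>x. p m x - p n x) < e"
        using N by (meson order_le_less_trans)
    qed
    note lim = B.closed_limit[OF pb this fL ll]
    have "(\<lambda>n. fval b (p n) (p n)) \<longlonglongrightarrow> fval b f f"
      by (intro B.E.tendsto_q B.graph_limit_fval pb lim)
    moreover have "fval b (p n) (p n) \<le> fval form_r f f" for n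
      using b_le_r[OF pd, of n] by (simp add: fval_r rp)
    ultimately have "fval b f f \<le> fval form_r f f" by (intro LIMSEQ_le_const2) auto
    then show "fval s f f \<le> fval form_r f f" using sb(2)[OF f f] by simp
  qed
  have "fval form_r f g = fval s f g" if f: "f \<in> fdom s" and g: "g \<in> fdom s" for f g
    using R.E.q_polar[OF subsetD[OF sr f] subsetD[OF sr g]] S.q_polar[OF f g]
      quad[OF f] quad[OF g] quad[OF S.add[OF f g]] by simp
  then have "form_extends form_r s" using sr by (simp add: form_extends_def)
  then show ?thesis by (rule b(3)[OF form_r_closed])
qed

text \<open>A test function \<open>h\<close> of \<open>b\<close> acts only through
  \<open>restr h\<close>, which is a test function of the Dirichlet form, and \<open>g\<close> does
  not see \<open>h\<close> off \<open>\<Omega>\<close>.\<close>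

lemma operator_inclusion:
  assumes cap: "rel_cap M a \<Omega> (frontier \<Omega>) = 0"
    and rel: "is_relaxation M (L2 M) (form_N M a \<Omega>) b"
  shows "form_operator M (L2_on M \<Omega>) (form_D M a \<Omega>) \<subseteq> form_operator M (L2 M) b"
proof
  fix v assume v: "v \<in> form_operator M (L2_on M \<Omega>) (form_D M a \<Omega>)"
  obtain f g where v_eq: "v = (f, g)" by (cases v)
  have f: "f \<in> DD" and g: "g \<in> L2_on M \<Omega>" and eq: "\<And>h. h \<in> DD \<Longrightarrow> fval a f h = l2_inner M g h"
    using v unfolding v_eq form_operator_def DD_eq by (auto simp: fval_form_D)
  have gL: "g \<in> L2 M" using g L2_on_L2 by blast
  note ext = relaxation_form_r[OF cap rel]
  have fb: "f \<in> fdom b" using relaxation_dom(2)[OF rel] DD_dom[OF f] by blast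
  have "fval b f h = l2_inner M g h" if h: "h \<in> fdom b" for h
  proof -
    have hr: "h \<in> L2 M" "restr h \<in> DD" using ext h by (auto simp: form_extends_def fdom_r)
    have "fval b f h = fval form_r f h" using ext fb h by (simp add: form_extends_def)
    also have "\<dots> = fval a (restr f) (restr h)" by (rule fval_r)
    also have "\<dots> = fval a f (restr h)"
    proof (rule fval_cong[symmetric])
      show "f \<in> fdom a" "restr h \<in> fdom a" by (intro DD_dom f hr)+
      show "restr f \<in> borel_measurable M" by (intro restr_measurable L2_measurable dom_L2 DD_dom f)
      show "restr h \<in> borel_measurable M" by (intro L2_measurable dom_L2 DD_dom hr)
      show "AE x in M. f x = restr f x" by (intro L2_on_AE DD_L2_on f)
    qed simp
    also have "\<dots> = l2_inner M g (restr h)" by (rule eq[OF hr(2)])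
    also have "\<dots> = l2_inner M g h" by (rule L2_on_inner[OF g hr(1), symmetric])
    finally show ?thesis .
  qed
  then show "v \<in> form_operator M (L2 M) b" using fb gL by (simp add: v_eq form_operator_def)
qed

end

section \<open>Uniqueness of the semigroup\<close>

text \<open>Differentiability of orbits is used from the right only, so the bound is propagated
  along the largest interval [0,c] on which \<open>m r \<le> m 0 + e * r\<close>: continuity reaches
  \<open>c\<close> itself, and the condition from the right moves beyond it.\<close>

lemma right_derivative_nonpos_imp_le:
  fixes m :: "real \<Rightarrow> real"
  assumes cont: "continuous_on {0..} m" and t: "0 \<le> t"
    and right: "\<And>s e. 0 \<le> s \<Longrightarrow> 0 < e \<Longrightarrow> eventually (\<lambda>h. m (s + h) \<le> m s + e * h) (at_right 0)"
  shows "m t \<le> m 0"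
proof (rule field_le_epsilon)
  fix e' :: real assume e': "0 < e'"
  \<comment> \<open>The added 1 covers \<open>t = 0\<close>; the accumulated error
    \<open>e * t\<close> is at most \<open>e'\<close>.\<close>
  define e where "e = e' / (t + 1)"
  have e: "0 < e" using e' t by (simp add: e_def)
  define A where "A = {s \<in> {0..t}. \<forall>r\<in>{0..s}. m r \<le> m 0 + e * r}"
  have A0: "0 \<in> A" using t by (auto simp: A_def)
  have bdd: "bdd_above A" by (rule bdd_aboveI[of _ t]) (auto simp: A_def)
  define c where "c = Sup A"
  have c0: "0 \<le> c" unfolding c_def by (rule cSup_upper[OF A0 bdd])
  have ct: "c \<le> t" unfolding c_def using A0 by (intro cSup_least) (auto simp: A_def)
  have below: "m r \<le> m 0 + e * r" if r: "0 \<le> r" "r < c" for r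
  proof -
    obtain s where "s \<in> A" "r < s" using less_cSupD[of A r] r A0 unfolding c_def by blast
    then show ?thesis using r by (auto simp: A_def)
  qed
  have at_c: "m c \<le> m 0 + e * c"
  proof (cases "c = 0")
    case False
    then have c: "0 < c" using c0 by simp
    have "((\<lambda>r. m r - e * r) \<longlongrightarrow> m c - e * c) (at c within {0..})"
      using cont c0 by (intro tendsto_intros) (auto simp: continuous_on_def)
    then have lim: "((\<lambda>r. m r - e * r) \<longlongrightarrow> m c - e * c) (at c within {0..<c})"
      by (rule tendsto_within_subset) auto
    have nt: "at c within {0..<c} \<noteq> bot"
      using c by (simp add: at_within_eq_bot_iff closure_atLeastLessThan)
    have "m c - e * c \<le> m 0"
      by (rule tendsto_upperbound[OF lim _ nt])
        (use below in \<open>auto simp: eventually_at_filter algebra_simps intro!: always_eventually\<close>)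
    then show ?thesis by simp
  qed simp
  have "c = t"
  proof (rule ccontr)
    assume "c \<noteq> t"
    then have lt: "c < t" using ct by simp
    obtain d where d: "0 < d" "\<And>h. 0 < h \<Longrightarrow> h < d \<Longrightarrow> m (c + h) \<le> m c + e * h"
      using right[OF c0 e] by (auto simp: eventually_at_right_field)
    define s where "s = min t (c + d / 2)"
    have "s \<in> A"
      unfolding A_def
    proof (intro CollectI conjI ballI)
      show "s \<in> {0..t}" using c0 t d(1) by (auto simp: s_def)
      fix r assume r: "r \<in> {0..s}"
      consider "r < c" | "r = c" | "c < r" by linarith
      then show "m r \<le> m 0 + e * r"
      proof cases
        case 3
        have "m (c + (r - c)) \<le> m c + e * (r - c)"
          by (rule d(2)) (use 3 r d(1) in \<open>auto simp: s_def\<close>)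
        then show ?thesis using at_c by (simp add: right_diff_distrib)
      qed (use r below at_c in auto)
    qed
    then have "s \<le> c" unfolding c_def by (rule cSup_upper[OF _ bdd])
    then show False using lt d(1) by (auto simp: s_def)
  qed
  then have "m t \<le> m 0 + e * t" using at_c by simp
  also have "e * t \<le> e'" using e' t by (simp add: e_def field_simps)
  finally show "m t \<le> m 0 + e'" by simp
qed

text \<open>Covers both \<open>L2 M\<close> and \<open>L2_on M \<Omega>\<close>. Closedness of
  \<open>H\<close> keeps the limit of the centres of the nested balls in \<open>H\<close>.\<close>

locale L2_semigroup =
  fixes M :: "'a measure" and H :: "('a \<Rightarrow> real) set" and S :: "real \<Rightarrow> ('a \<Rightarrow> real) \<Rightarrow> 'a \<Rightarrow> real"
  assumes sg: "C0_semigroup M H S" and H_L2: "H \<subseteq> L2 M"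
    and H_zero: "(\<lambda>_. 0) \<in> H"
    and H_diff: "f \<in> H \<Longrightarrow> g \<in> H \<Longrightarrow> (\<lambda>x. f x - g x) \<in> H"
    and H_scale: "f \<in> H \<Longrightarrow> (\<lambda>x. c * f x) \<in> H"
    and H_closed: "(\<And>n. u n \<in> H) \<Longrightarrow> f \<in> L2 M \<Longrightarrow> (\<lambda>n. l2_norm M (\<lambda>x. u n x - f x)) \<longlonglongrightarrow> 0 \<Longrightarrow> f \<in> H"
begin

lemma H_L2D: "f \<in> H \<Longrightarrow> f \<in> L2 M"
  using H_L2 by auto

lemma H_add: "f \<in> H \<Longrightarrow> g \<in> H \<Longrightarrow> (\<lambda>x. f x + g x) \<in> H"
  using H_diff[of f "\<lambda>x. (-1) * g x"] H_scale[of g "-1"] by simp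

lemma S_H: "0 \<le> t \<Longrightarrow> f \<in> H \<Longrightarrow> S t f \<in> H"
  using sg by (simp add: C0_semigroup_def)

lemma S_L2: "0 \<le> t \<Longrightarrow> f \<in> H \<Longrightarrow> S t f \<in> L2 M"
  by (intro H_L2D S_H)

lemma S_add: "0 \<le> t \<Longrightarrow> f \<in> H \<Longrightarrow> g \<in> H \<Longrightarrow> AE x in M. S t (\<lambda>y. f y + g y) x = S t f x + S t g x"
  using sg by (simp add: C0_semigroup_def)

lemma S_scale: "0 \<le> t \<Longrightarrow> f \<in> H \<Longrightarrow> AE x in M. S t (\<lambda>y. c * f y) x = c * S t f x"
  using sg by (simp add: C0_semigroup_def)

lemma S_diff: 
  assumes t: "0 \<le> t" and f: "f \<in> H" and g: "g \<in> H"
  shows "AE x in M. S t (\<lambda>y. f y - g y) x = S t f x - S t g x"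
  using S_add[OF t f H_scale[OF g, of "-1"]] S_scale[OF t g, of "-1"]
  by eventually_elim simp

lemma S_zero: "f \<in> H \<Longrightarrow> AE x in M. S 0 f x = f x"
  using sg by (simp add: C0_semigroup_def)

lemma S_sum: "0 \<le> s \<Longrightarrow> 0 \<le> t \<Longrightarrow> f \<in> H \<Longrightarrow> AE x in M. S (s + t) f x = S s (S t f) x"
  using sg by (simp add: C0_semigroup_def)

lemma S_norm_diff:
  assumes "0 \<le> t" "f \<in> H" "g \<in> H"
  shows "l2_norm M (\<lambda>x. S t f x - S t g x) = l2_norm M (S t (\<lambda>x. f x - g x))"
proof (rule l2_norm_cong_AE)
  show "AE x in M. S t f x - S t g x = S t (\<lambda>x. f x - g x) x"
    using S_diff[OF assms] by eventually_elim simp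
qed (intro L2_measurable L2.diff S_L2 H_diff assms)+

lemma S_bound:
  assumes "0 \<le> t"
  obtains C where "0 \<le> C" "\<And>f. f \<in> H \<Longrightarrow> l2_norm M (S t f) \<le> C * l2_norm M f"
proof -
  obtain C where C: "\<forall>f\<in>H. l2_norm M (S t f) \<le> C * l2_norm M f"
    using sg assms by (auto simp: C0_semigroup_def)
  have "l2_norm M (S t f) \<le> max 0 C * l2_norm M f" if "f \<in> H" for f
    using C that mult_right_mono[of C "max 0 C" "l2_norm M f"] l2_norm_nonneg[of M f] by force
  then show thesis by (intro that[of "max 0 C"]) auto
qed

lemma S_right_limit:
  assumes f: "f \<in> H" and e: "0 < e"
  obtains d where "0 < d" "\<And>t. 0 \<le> t \<Longrightarrow> t < d \<Longrightarrow> l2_norm M (\<lambda>x. S t f x - f x) < e"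
proof -
  have "((\<lambda>t. l2_norm M (\<lambda>x. S t f x - f x)) \<longlongrightarrow> 0) (at_right 0)"
    using sg f by (simp add: C0_semigroup_def)
  then have "eventually (\<lambda>t. l2_norm M (\<lambda>x. S t f x - f x) < e) (at_right 0)"
    using e order_tendstoD(2) by blast
  then obtain d where d: "0 < d" "\<And>t. 0 < t \<Longrightarrow> t < d \<Longrightarrow> l2_norm M (\<lambda>x. S t f x - f x) < e"
    by (auto simp: eventually_at_right_field)
  have "l2_norm M (\<lambda>x. S 0 f x - f x) = l2_norm M (\<lambda>_. 0)"
    by (rule l2_norm_cong_AE[OF L2_measurable[OF L2.diff]])
      (use f S_zero[OF f] in \<open>auto intro: S_L2 H_L2D elim: eventually_mono\<close>)
  also have "\<dots> = 0" by (simp add: l2_norm_def l2_inner_def)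
  finally have "l2_norm M (\<lambda>x. S t f x - f x) < e" if "0 \<le> t" "t < d" for t
    using d(2)[of t] that e by (cases "t = 0") auto
  then show thesis using that d(1) by blast
qed

text \<open>Uniform boundedness near \<open>0\<close>: otherwise nested balls on which ever larger values are taken
  shrink to a vector violating right continuity.\<close>

lemma nested_ball_step:
  assumes contra: "\<And>d C. 0 < d \<Longrightarrow> \<exists>t f. 0 \<le> t \<and> t \<le> d \<and> f \<in> H \<and> C * l2_norm M f < l2_norm M (S t f)"
    and x: "x \<in> H" and r: "0 < r"
  obtains y s t where "y \<in> H" "0 < s" "s \<le> r / 2" "l2_norm M (\<lambda>v. y v - x v) + s \<le> r"
    "0 \<le> t" "t \<le> 1 / real (Suc n)"
    "\<And>z. z \<in> H \<Longrightarrow> l2_norm M (\<lambda>v. z v - y v) \<le> s \<Longrightarrow> real n \<le> l2_norm M (S t z)"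
proof -
  define N where "N = real n + 1"
  have N: "0 < N" by (simp add: N_def)
  obtain t f where t: "0 \<le> t" "t \<le> 1 / real (Suc n)" and f: "f \<in> H"
    and big: "4 * N / r * l2_norm M f < l2_norm M (S t f)"
    using contra[of "1 / real (Suc n)" "4 * N / r"] by auto
  obtain C where C: "0 \<le> C" "\<And>f. f \<in> H \<Longrightarrow> l2_norm M (S t f) \<le> C * l2_norm M f"
    using S_bound[OF t(1)] by blast
  have fpos: "0 < l2_norm M f"
  proof (rule ccontr)
    assume "\<not> ?thesis"
    then have "l2_norm M f = 0" using l2_norm_nonneg[of M f] by simp
    then show False using big C(2)[OF f] by simp
  qed
  \<comment> \<open>This multiple of \<open>f\<close> has norm r/2, and the factor
    \<open>4 * N / r\<close> in \<open>big\<close> makes its image larger than \<open>2 * N\<close>.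
    So one of \<open>x\<close> and \<open>x + e\<close> has an image of norm at least
    \<open>N\<close>.\<close>
  define k where "k = r / (2 * l2_norm M f)"
  have k: "0 < k" using r fpos by (simp add: k_def)
  define e where "e = (\<lambda>v. k * f v)"
  have eH: "e \<in> H" unfolding e_def by (rule H_scale[OF f])
  have en: "l2_norm M e = r / 2"
    using L2.qnorm_scale[OF H_L2D[OF f], of k] k fpos r by (simp add: e_def l2_norm_qnorm k_def)
  have "l2_norm M (S t e) = l2_norm M (\<lambda>v. k * S t f v)"
    unfolding e_def
    by (rule l2_norm_cong_AE[OF L2_measurable L2_measurable S_scale[OF t(1) f]])
      (intro S_L2 t H_scale f L2.scale)+
  also have "\<dots> = k * l2_norm M (S t f)"
    using L2.qnorm_scale[OF S_L2[OF t(1) f], of k] k by (simp add: l2_norm_qnorm)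
  also have "\<dots> > k * (4 * N / r * l2_norm M f)" by (rule mult_strict_left_mono[OF big k])
  also have "k * (4 * N / r * l2_norm M f) = 2 * N" using r fpos by (simp add: k_def)
  finally have Se: "2 * N < l2_norm M (S t e)" .
  have "\<exists>y\<in>H. l2_norm M (\<lambda>v. y v - x v) \<le> r / 2 \<and> N \<le> l2_norm M (S t y)"
  proof (cases "N \<le> l2_norm M (S t x)")
    case True
    then show ?thesis using x r by (intro bexI[of _ x]) (auto simp: l2_norm_def l2_inner_def)
  next
    case False
    have xe: "(\<lambda>v. x v + e v) \<in> H" by (rule H_add[OF x eH])
    have "l2_norm M (S t e) = l2_norm M (\<lambda>v. S t (\<lambda>v. x v + e v) v - S t x v)"
      using S_norm_diff[OF t(1) xe x] by simp
    also have "\<dots> \<le> l2_norm M (S t (\<lambda>v. x v + e v)) + l2_norm M (S t x)"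
      unfolding l2_norm_qnorm by (intro L2.qnorm_triangle_diff S_L2 t xe x)
    finally show ?thesis using Se False xe en by (intro bexI[of _ "\<lambda>v. x v + e v"]) auto
  qed
  then obtain y where y: "y \<in> H" "l2_norm M (\<lambda>v. y v - x v) \<le> r / 2" "N \<le> l2_norm M (S t y)" by blast
  \<comment> \<open>Within radius 1/(1+C) the image moves by at most 1, which is the difference
    between \<open>N\<close> and \<open>n\<close>.\<close>
  define s where "s = min (r / 2) (1 / (1 + C))"
  have s: "0 < s" "s \<le> r / 2" "s \<le> 1 / (1 + C)" using r C(1) by (auto simp: s_def)
  have Cs: "C * s \<le> 1"
  proof -
    have "C * s \<le> C * (1 / (1 + C))" using s C(1) by (intro mult_left_mono)
    also have "\<dots> \<le> 1" using C(1) by simp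
    finally show ?thesis .
  qed
  show thesis
  proof (rule that[OF y(1) s(1,2) _ t])
    show "l2_norm M (\<lambda>v. y v - x v) + s \<le> r" using y(2) s(2) by simp
    fix z assume z: "z \<in> H" "l2_norm M (\<lambda>v. z v - y v) \<le> s"
    have "l2_norm M (S t y) \<le> l2_norm M (S t z) + l2_norm M (\<lambda>v. S t z v - S t y v)"
      using L2.qnorm_le_add_diff[OF S_L2[OF t(1) y(1)] S_L2[OF t(1) z(1)]]
        L2.qnorm_minus_commute[OF S_L2[OF t(1) y(1)] S_L2[OF t(1) z(1)]] by (simp add: l2_norm_qnorm)
    also have "l2_norm M (\<lambda>v. S t z v - S t y v) \<le> C * l2_norm M (\<lambda>v. z v - y v)"
      unfolding S_norm_diff[OF t(1) z(1) y(1)] by (rule C(2)[OF H_diff[OF z(1) y(1)]])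
    also have "\<dots> \<le> C * s" using z(2) C(1) by (rule mult_left_mono)
    finally show "real n \<le> l2_norm M (S t z)" using y(3) Cs by (simp add: N_def)
  qed
qed

lemma uniformly_bounded_near_0:
  obtains d C where "0 < d" "\<And>t f. 0 \<le> t \<Longrightarrow> t \<le> d \<Longrightarrow> f \<in> H \<Longrightarrow> l2_norm M (S t f) \<le> C * l2_norm M f"
proof (rule ccontr)
  assume "\<not> thesis"
  then have contra: "\<And>d C. 0 < d \<Longrightarrow> \<exists>t f. 0 \<le> t \<and> t \<le> d \<and> f \<in> H \<and> C * l2_norm M f < l2_norm M (S t f)"
    using that by (meson not_le)
  define Q where "Q n xr ys \<longleftrightarrow> snd ys \<le> snd xr / 2 \<and> l2_norm M (\<lambda>v. fst ys v - fst xr v) + snd ys \<le> snd xr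
    \<and> (\<exists>t. 0 \<le> t \<and> t \<le> 1 / real (Suc n)
      \<and> (\<forall>z\<in>H. l2_norm M (\<lambda>v. z v - fst ys v) \<le> snd ys \<longrightarrow> real n \<le> l2_norm M (S t z)))"
    for n and xr ys :: "('a \<Rightarrow> real) \<times> real"
  have "\<exists>p. \<forall>n. (fst (p n) \<in> H \<and> 0 < snd (p n)) \<and> Q n (p n) (p (Suc n))"
  proof (rule dependent_nat_choice)
    show "\<exists>p :: ('a \<Rightarrow> real) \<times> real. fst p \<in> H \<and> 0 < snd p"
      by (rule exI[of _ "((\<lambda>_. 0), 1)"]) (simp add: H_zero)
    fix p :: "('a \<Rightarrow> real) \<times> real" and n assume p: "fst p \<in> H \<and> 0 < snd p"
    show "\<exists>q. (fst q \<in> H \<and> 0 < snd q) \<and> Q n p q"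
      by (rule nested_ball_step[OF contra, of "fst p" "snd p" n])
        (use p in \<open>auto simp: Q_def intro!: exI\<close>)
  qed
  then obtain p where p: "\<And>n. fst (p n) \<in> H" "\<And>n. 0 < snd (p n)" "\<And>n. Q n (p n) (p (Suc n))" by blast
  define x r where "x n = fst (p n)" and "r n = snd (p n)" for n
  have x: "x n \<in> H" and r: "0 < r n" for n using p by (auto simp: x_def r_def)
  have step: "r (Suc n) \<le> r n / 2" "l2_norm M (\<lambda>v. x (Suc n) v - x n v) + r (Suc n) \<le> r n" for n
    using p(3)[of n] by (auto simp: Q_def x_def r_def)
  have rr: "r n \<le> r 0 * (1/2) ^ n" for n
  proof (induction n)
    case (Suc n)
    then show ?case using step(1)[of n] by simp
  qed simp
  have dist: "l2_norm M (\<lambda>v. x m v - x n v) \<le> r n - r m" if "n \<le> m" for m n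
    using that
  proof (induction m rule: dec_induct)
    case base
    show ?case by (simp add: l2_norm_def l2_inner_def)
  next
    case (step m)
    have "l2_norm M (\<lambda>v. x (Suc m) v - x n v)
        \<le> l2_norm M (\<lambda>v. x (Suc m) v - x m v) + l2_norm M (\<lambda>v. x m v - x n v)"
      unfolding l2_norm_qnorm by (intro L2.qnorm_triangle3 H_L2D x)
    then show ?case using step.IH \<open>\<And>n. l2_norm M (\<lambda>v. x (Suc n) v - x n v) + r (Suc n) \<le> r n\<close>[of m]
      by linarith
  qed
  have "L2.Cauchyq M x"
  proof (rule L2.CauchyqI[OF H_L2D[OF x], of "\<lambda>n. (r 0 * (1/2) ^ n)\<^sup>2"])
    have "(\<lambda>n. (r 0 * (1/2) ^ n)\<^sup>2) \<longlonglongrightarrow> (r 0 * 0)\<^sup>2"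
      by (intro tendsto_intros LIMSEQ_realpow_zero) auto
    then show "(\<lambda>n. (r 0 * (1/2) ^ n)\<^sup>2) \<longlonglongrightarrow> 0" by simp
    fix m n :: nat assume "n \<le> m"
    from dist[OF this] have "l2_norm M (\<lambda>v. x m v - x n v) \<le> r 0 * (1/2) ^ n"
      using r[of m] rr[of n] by linarith
    then have "(l2_norm M (\<lambda>v. x m v - x n v))\<^sup>2 \<le> (r 0 * (1/2) ^ n)\<^sup>2"
      by (intro power_mono l2_norm_nonneg)
    then show "l2_inner M (\<lambda>v. x m v - x n v) (\<lambda>v. x m v - x n v) \<le> (r 0 * (1/2) ^ n)\<^sup>2"
      by (simp add: l2_norm_sq)
  qed
  then obtain f where fL: "f \<in> L2 M" and lf: "(\<lambda>n. l2_norm M (\<lambda>v. x n v - f v)) \<longlonglongrightarrow> 0"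
    using Riesz_Fischer[of x M] H_L2D[OF x] by blast
  have f: "f \<in> H" by (rule H_closed[OF x fL lf])
  have fx: "l2_norm M (\<lambda>v. f v - x n v) \<le> r n" for n
  proof -
    have "l2_norm M (\<lambda>v. f v - x n v) \<le> l2_norm M (\<lambda>v. x m v - f v) + r n" if "n \<le> m" for m
      using L2.qnorm_triangle3[OF fL H_L2D[OF x[of m]] H_L2D[OF x[of n]]]
        L2.qnorm_minus_commute[OF fL H_L2D[OF x], of m] dist[OF that] r[of m]
      by (simp add: l2_norm_qnorm)
    moreover have "(\<lambda>m. l2_norm M (\<lambda>v. x m v - f v) + r n) \<longlonglongrightarrow> 0 + r n" by (intro tendsto_intros lf)
    ultimately show ?thesis by (intro LIMSEQ_le_const[of _ "r n"]) auto
  qed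
  obtain d where d: "0 < d" "\<And>t. 0 \<le> t \<Longrightarrow> t < d \<Longrightarrow> l2_norm M (\<lambda>v. S t f v - f v) < 1"
    using S_right_limit[OF f, of 1] by auto
  obtain n1 :: nat where n1: "1 / real (Suc n1) < d" using d(1) nat_approx_posE by blast
  obtain n2 :: nat where n2: "l2_norm M f + 1 < real n2" using reals_Archimedean2 by blast
  \<comment> \<open>Late enough that the time \<open>t\<close> falls in the range of right
    continuity, where the image of \<open>f\<close> has norm below \<open>l2_norm M f + 1\<close>,
    and that \<open>n\<close> exceeds this number.\<close>
  define n where "n = max n1 n2"
  obtain t where t: "0 \<le> t" "t \<le> 1 / real (Suc n)"
    "\<And>z. z \<in> H \<Longrightarrow> l2_norm M (\<lambda>v. z v - x (Suc n) v) \<le> r (Suc n) \<Longrightarrow> real n \<le> l2_norm M (S t z)"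
    using p(3)[of n] by (auto simp: Q_def x_def r_def)
  have "1 / real (Suc n) \<le> 1 / real (Suc n1)" by (simp add: n_def field_simps)
  then have "t < d" using t(2) n1 by linarith
  then have "l2_norm M (\<lambda>v. S t f v - f v) < 1" using d(2) t(1) by blast
  moreover have "l2_norm M (S t f) \<le> l2_norm M f + l2_norm M (\<lambda>v. S t f v - f v)"
    unfolding l2_norm_qnorm by (intro L2.qnorm_le_add_diff S_L2 t f fL)
  moreover have "real n \<le> l2_norm M (S t f)" by (rule t(3)[OF f fx])
  moreover have "real n2 \<le> real n" by (simp add: n_def)
  ultimately show False using n2 by linarith
qed

text \<open>Times up to \<open>n * d\<close> are cut into steps of length at most \<open>d\<close>;
  one extra factor \<open>C\<close>, which is at least 1, starts the induction at
  \<open>n = 0\<close>.\<close>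

lemma locally_bounded:
  obtains C where "0 \<le> C" "\<And>t f. 0 \<le> t \<Longrightarrow> t \<le> T \<Longrightarrow> f \<in> H \<Longrightarrow> l2_norm M (S t f) \<le> C * l2_norm M f"
proof -
  obtain d C0 where d: "0 < d"
    and C0: "\<And>t f. 0 \<le> t \<Longrightarrow> t \<le> d \<Longrightarrow> f \<in> H \<Longrightarrow> l2_norm M (S t f) \<le> C0 * l2_norm M f"
    using uniformly_bounded_near_0 by blast
  define C where "C = max 1 C0"
  have C1: "1 \<le> C" by (simp add: C_def)
  have C: "l2_norm M (S t f) \<le> C * l2_norm M f" if "0 \<le> t" "t \<le> d" "f \<in> H" for t f
    using C0[OF that] mult_right_mono[of C0 C "l2_norm M f"] l2_norm_nonneg[of M f]
    by (simp add: C_def)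
  have pow: "l2_norm M (S t f) \<le> C ^ Suc n * l2_norm M f" if "0 \<le> t" "t \<le> real n * d" "f \<in> H" for n t f
    using that
  proof (induction n arbitrary: t)
    case 0
    then show ?case using C[of t f] d by simp
  next
    case (Suc n)
    define s where "s = min t d"
    have s: "0 \<le> s" "s \<le> d" "0 \<le> t - s" "t - s \<le> real n * d"
      using Suc.prems d by (auto simp: s_def min_def algebra_simps)
    have "l2_norm M (S t f) = l2_norm M (S s (S (t - s) f))"
      using S_sum[OF s(1,3) Suc.prems(3)]
      by (intro l2_norm_cong_AE L2_measurable S_L2 S_H s Suc.prems) simp
    also have "\<dots> \<le> C * l2_norm M (S (t - s) f)" by (intro C s S_H Suc.prems)
    also have "\<dots> \<le> C * (C ^ Suc n * l2_norm M f)"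
      using C1 by (intro mult_left_mono Suc.IH s Suc.prems) auto
    finally show ?case by (simp add: mult.assoc)
  qed
  obtain n :: nat where "T / d < real n" using reals_Archimedean2 by blast
  then have "T \<le> real n * d" using d by (simp add: field_simps)
  then show thesis using C1 by (intro that[of "C ^ Suc n"] pow) auto
qed

text \<open>For \<open>t < s\<close> the difference is, up to sign, \<open>S t\<close> applied to
  \<open>S (s - t) f - f\<close>. The operator varies with \<open>t\<close>, so left continuity
  rests on the uniform bound from \<open>locally_bounded\<close>.\<close>

lemma S_continuous:
  assumes f: "f \<in> H" and s: "0 \<le> s" and e: "0 < e"
  obtains d where "0 < d" "\<And>t. 0 \<le> t \<Longrightarrow> \<bar>t - s\<bar> < d \<Longrightarrow> l2_norm M (\<lambda>x. S t f x - S s f x) < e"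
proof -
  obtain C where C: "0 \<le> C" "\<And>t f. 0 \<le> t \<Longrightarrow> t \<le> s \<Longrightarrow> f \<in> H \<Longrightarrow> l2_norm M (S t f) \<le> C * l2_norm M f"
    using locally_bounded[of s] by blast
  obtain d where d: "0 < d" "\<And>t. 0 \<le> t \<Longrightarrow> t < d \<Longrightarrow> l2_norm M (\<lambda>x. S t f x - f x) < e / (C + 1)"
    by (rule S_right_limit[OF f, of "e / (C + 1)"]) (use e C in auto)
  have main: "l2_norm M (\<lambda>x. S (r + h) f x - S r f x) < e" if "0 \<le> r" "r \<le> s" "0 \<le> h" "h < d" for r h
  proof -
    have "l2_norm M (\<lambda>x. S (r + h) f x - S r f x) = l2_norm M (\<lambda>x. S r (S h f) x - S r f x)"
      using S_sum[OF that(1,3) f]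
      by (intro l2_norm_cong_AE L2_measurable L2.diff S_L2 S_H f)
        (use that in \<open>auto elim: eventually_mono\<close>)
    also have "\<dots> = l2_norm M (S r (\<lambda>x. S h f x - f x))"
      by (intro S_norm_diff S_H that f)
    also have "\<dots> \<le> C * l2_norm M (\<lambda>x. S h f x - f x)" by (intro C H_diff S_H that f)
    also have "\<dots> \<le> C * (e / (C + 1))" using d(2)[OF that(3,4)] C(1) by (intro mult_left_mono) auto
    also have "\<dots> < e" using C(1) e by (simp add: field_simps)
    finally show ?thesis .
  qed
  show thesis
  proof (rule that[OF d(1)])
    fix t assume t: "0 \<le> t" "\<bar>t - s\<bar> < d"
    show "l2_norm M (\<lambda>x. S t f x - S s f x) < e"
    proof (cases "s \<le> t")
      case True
      then show ?thesis using main[of s "t - s"] s t by simp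
    next
      case False
      then show ?thesis
        using main[of t "s - t"] t L2.qnorm_minus_commute[OF S_L2[OF t(1) f] S_L2[OF s f]]
        by (simp add: l2_norm_qnorm)
    qed
  qed
qed

text \<open>\<open>S s\<close> is bounded and commutes with the difference quotients at 0 up to null
  sets; the second claim reads the same quotients with the two times exchanged.\<close>

lemma generator_orbit:
  assumes fg: "(f, g) \<in> neg_generator M H S" and s: "0 \<le> s"
  shows "((\<lambda>h. l2_norm M (\<lambda>x. (S s f x - S (s + h) f x) / h - S s g x)) \<longlongrightarrow> 0) (at_right 0)"
    "(S s f, S s g) \<in> neg_generator M H S"
proof -
  have f: "f \<in> H" and g: "g \<in> H"
    and lim: "((\<lambda>t. l2_norm M (\<lambda>x. (f x - S t f x) / t - g x)) \<longlongrightarrow> 0) (at_right 0)"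
    using fg by (auto simp: neg_generator_def)
  obtain C where C: "0 \<le> C" "\<And>f. f \<in> H \<Longrightarrow> l2_norm M (S s f) \<le> C * l2_norm M f"
    using S_bound[OF s] by blast
  have Clim: "((\<lambda>t. C * l2_norm M (\<lambda>x. (f x - S t f x) / t - g x)) \<longlongrightarrow> 0) (at_right 0)"
    using tendsto_mult_right_zero[OF lim] .
  have pos: "eventually (\<lambda>h. 0 < h) (at_right (0::real))" by (simp add: eventually_at_right_less)
  have dH: "(\<lambda>x. (f x - S h f x) / h) \<in> H" if "0 < h" for h
    using H_scale[OF H_diff[OF f S_H[OF less_imp_le[OF that] f]], of "1 / h"] by simp
  have le: "l2_norm M (\<lambda>x. (S s f x - S (s + h) f x) / h - S s g x) \<le> C * l2_norm M (\<lambda>x. (f x - S h f x) / h - g x)"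
    if h: "0 < h" for h
  proof -
    note h0 = less_imp_le[OF h]
    have "AE x in M. S s (\<lambda>x. (f x - S h f x) / h - g x) x = S s (\<lambda>x. (f x - S h f x) / h) x - S s g x"
      by (rule S_diff[OF s dH[OF h] g])
    moreover have "AE x in M. S s (\<lambda>x. (f x - S h f x) / h) x = 1 / h * S s (\<lambda>x. f x - S h f x) x"
      using S_scale[OF s H_diff[OF f S_H[OF h0 f]], of "1 / h"] by simp
    moreover have "AE x in M. S s (\<lambda>x. f x - S h f x) x = S s f x - S s (S h f) x"
      by (rule S_diff[OF s f S_H[OF h0 f]])
    moreover have "AE x in M. S (s + h) f x = S s (S h f) x" by (rule S_sum[OF s h0 f])
    ultimately have "AE x in M. (S s f x - S (s + h) f x) / h - S s g x
        = S s (\<lambda>x. (f x - S h f x) / h - g x) x"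
      by eventually_elim simp
    moreover have "(\<lambda>x. (S s f x - S (s + h) f x) / h - S s g x) \<in> borel_measurable M"
    proof -
      note [measurable] = L2_measurable[OF S_L2[OF s f]] L2_measurable[OF S_L2[OF s g]]
        L2_measurable[OF S_L2[OF add_nonneg_nonneg[OF s h0] f]]
      show ?thesis by measurable
    qed
    ultimately have "l2_norm M (\<lambda>x. (S s f x - S (s + h) f x) / h - S s g x)
        = l2_norm M (S s (\<lambda>x. (f x - S h f x) / h - g x))"
      by (intro l2_norm_cong_AE L2_measurable[OF S_L2[OF s H_diff[OF dH[OF h] g]]])
    also have "\<dots> \<le> C * l2_norm M (\<lambda>x. (f x - S h f x) / h - g x)"
      by (rule C(2)[OF H_diff[OF dH[OF h] g]])
    finally show ?thesis .
  qed
  show 1: "((\<lambda>h. l2_norm M (\<lambda>x. (S s f x - S (s + h) f x) / h - S s g x)) \<longlongrightarrow> 0) (at_right 0)"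
    by (rule Lim_null_comparison[OF _ Clim])
      (use pos in \<open>eventually_elim, use le in \<open>simp add: l2_norm_nonneg\<close>\<close>)
  have eq: "l2_norm M (\<lambda>x. (S s f x - S h (S s f) x) / h - S s g x)
      = l2_norm M (\<lambda>x. (S s f x - S (s + h) f x) / h - S s g x)" if h: "0 < h" for h
  proof -
    note h0 = less_imp_le[OF h]
    note [measurable] = L2_measurable[OF S_L2[OF s f]] L2_measurable[OF S_L2[OF s g]]
      L2_measurable[OF S_L2[OF add_nonneg_nonneg[OF s h0] f]] L2_measurable[OF S_L2[OF h0 S_H[OF s f]]]
    have "AE x in M. S h (S s f) x = S (s + h) f x"
      using S_sum[OF h0 s f] by (simp add: add.commute eq_commute)
    then have "AE x in M. (S s f x - S h (S s f) x) / h - S s g x = (S s f x - S (s + h) f x) / h - S s g x"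
      by eventually_elim simp
    then show ?thesis by (intro l2_norm_cong_AE) measurable
  qed
  have "((\<lambda>h. l2_norm M (\<lambda>x. (S s f x - S h (S s f) x) / h - S s g x)) \<longlongrightarrow> 0) (at_right 0)"
    by (rule Lim_transform_eventually[OF 1]) (use pos in \<open>eventually_elim, use eq in simp\<close>)
  then show "(S s f, S s g) \<in> neg_generator M H S"
    using S_H[OF s f] S_H[OF s g] by (simp add: neg_generator_def)
qed

end

text \<open>Both orbits stay in the domain of the operator of \<open>b\<close>, the first by the
  inclusion of generators. For their difference \<open>z\<close> the squared norm has right
  derivative \<open>-2 * fval b (z s) (z s)\<close>, and it starts at 0.\<close>

lemma semigroups_agree_on_operator_domain:
  assumes S1: "L2_semigroup M H1 S1" and S2: "L2_semigroup M H2 S2"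
    and b: "positive_form M (L2 M) b" and gen: "neg_generator M H2 S2 = form_operator M H2 b"
    and incl: "neg_generator M H1 S1 \<subseteq> neg_generator M H2 S2"
    and f: "(f, g) \<in> neg_generator M H1 S1" and t: "0 \<le> t"
  shows "l2_norm M (\<lambda>x. S1 t f x - S2 t f x) = 0"
proof -
  interpret S1: L2_semigroup M H1 S1 by (rule S1)
  interpret S2: L2_semigroup M H2 S2 by (rule S2)
  interpret B: semi_inner "fdom b" "fval b"
    by unfold_locales (use b in \<open>auto simp: positive_form_def\<close>)
  have f2: "(f, g) \<in> neg_generator M H2 S2" using f incl by blast
  have fH: "f \<in> H1" "f \<in> H2" "g \<in> H1" "g \<in> H2" using f f2 by (auto simp: neg_generator_def)
  define z where "z s = (\<lambda>x. S1 s f x - S2 s f x)" for s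
  have zL: "z s \<in> L2 M" if "0 \<le> s" for s
    unfolding z_def by (intro L2.diff S1.S_L2 S2.S_L2 that fH)
  define m where "m s = (l2_norm M (z s))\<^sup>2" for s
  have zdiff: "\<bar>l2_norm M (z r) - l2_norm M (z s)\<bar>
      \<le> l2_norm M (\<lambda>x. S1 r f x - S1 s f x) + l2_norm M (\<lambda>x. S2 r f x - S2 s f x)"
    if "0 \<le> r" "0 \<le> s" for r s
  proof -
    have "l2_norm M (\<lambda>x. z r x - z s x) \<le> l2_norm M (\<lambda>x. S1 r f x - S1 s f x) + l2_norm M (\<lambda>x. S2 r f x - S2 s f x)"
    proof -
      have "(\<lambda>x. z r x - z s x) = (\<lambda>x. (S1 r f x - S1 s f x) - (S2 r f x - S2 s f x))"
        by (auto simp: z_def)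
      then show ?thesis
        using L2.qnorm_triangle_diff[OF
            L2.diff[OF S1.S_L2[OF that(1) fH(1)] S1.S_L2[OF that(2) fH(1)]]
            L2.diff[OF S2.S_L2[OF that(1) fH(2)] S2.S_L2[OF that(2) fH(2)]]]
        by (simp add: l2_norm_qnorm)
    qed
    then show ?thesis
      using L2.qnorm_le_add_diff[OF zL[OF that(1)] zL[OF that(2)]]
        L2.qnorm_le_add_diff[OF zL[OF that(2)] zL[OF that(1)]]
        L2.qnorm_minus_commute[OF zL[OF that(1)] zL[OF that(2)]]
      by (simp add: l2_norm_qnorm abs_le_iff)
  qed
  have "continuous_on {0..} (\<lambda>s. l2_norm M (z s))"
    unfolding continuous_on_iff
  proof (intro ballI allI impI)
    fix s e :: real assume s: "s \<in> {0..}" and e: "0 < e"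
    obtain d1 where d1: "0 < d1" "\<And>t. 0 \<le> t \<Longrightarrow> \<bar>t - s\<bar> < d1 \<Longrightarrow> l2_norm M (\<lambda>x. S1 t f x - S1 s f x) < e / 2"
      using S1.S_continuous[OF fH(1), of s "e / 2"] s e by auto
    obtain d2 where d2: "0 < d2" "\<And>t. 0 \<le> t \<Longrightarrow> \<bar>t - s\<bar> < d2 \<Longrightarrow> l2_norm M (\<lambda>x. S2 t f x - S2 s f x) < e / 2"
      using S2.S_continuous[OF fH(2), of s "e / 2"] s e by auto
    show "\<exists>d>0. \<forall>r\<in>{0..}. dist r s < d \<longrightarrow> dist (l2_norm M (z r)) (l2_norm M (z s)) < e"
    proof (intro exI[of _ "min d1 d2"] conjI ballI impI)
      fix r assume r: "r \<in> {0..}" "dist r s < min d1 d2"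
      then show "dist (l2_norm M (z r)) (l2_norm M (z s)) < e"
        using zdiff[of r s] d1(2)[of r] d2(2)[of r] s by (simp add: dist_real_def)
    qed (use d1 d2 in simp)
  qed
  then have cont: "continuous_on {0..} m" unfolding m_def by (intro continuous_intros)
  have right: "eventually (\<lambda>h. m (s + h) \<le> m s + e * h) (at_right 0)" if s: "0 \<le> s" and e: "0 < e" for s e
  proof -
    define G where "G = (\<lambda>x. S1 s g x - S2 s g x)"
    define D1 where "D1 h = (\<lambda>x. (S1 s f x - S1 (s + h) f x) / h - S1 s g x)" for h
    define D2 where "D2 h = (\<lambda>x. (S2 s f x - S2 (s + h) f x) / h - S2 s g x)" for h
    define n where "n h = l2_norm M (D1 h) + l2_norm M (D2 h)" for h
    have op: "(S1 s f, S1 s g) \<in> form_operator M H2 b" "(S2 s f, S2 s g) \<in> form_operator M H2 b"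
      using S1.generator_orbit(2)[OF f s] S2.generator_orbit(2)[OF f2 s] incl gen by auto
    have GL: "G \<in> L2 M" unfolding G_def by (intro L2.diff S1.S_L2 S2.S_L2 s fH)
    have zD: "z s \<in> fdom b" using op unfolding z_def by (auto simp: form_operator_def intro: B.diff)
    have "fval b (z s) (z s) = l2_inner M G (z s)"
    proof -
      have "fval b (z s) (z s) = fval b (S1 s f) (z s) - fval b (S2 s f) (z s)"
        using op zD unfolding z_def by (intro B.q_diff) (auto simp: form_operator_def)
      also have "\<dots> = l2_inner M (S1 s g) (z s) - l2_inner M (S2 s g) (z s)"
        using op zD by (auto simp: form_operator_def)
      also have "\<dots> = l2_inner M G (z s)"
        unfolding G_def by (intro L2.q_diff[symmetric] S1.S_L2 S2.S_L2 s fH zL)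
      finally show ?thesis .
    qed
    then have Gz: "0 \<le> l2_inner M G (z s)" using B.q_nonneg[OF zD] by simp
    have nlim: "(n \<longlongrightarrow> 0) (at_right 0)"
      using tendsto_add[OF S1.generator_orbit(1)[OF f s] S2.generator_orbit(1)[OF f2 s]]
      unfolding n_def D1_def D2_def by simp
    \<comment> \<open>The remainder in the expansion of \<open>m (s + h)\<close>, divided by
      \<open>h\<close>, once the pairing of \<open>G\<close> with \<open>z s\<close> has been
      dropped because of its sign.\<close>
    have "((\<lambda>h. 2 * l2_norm M (z s) * n h + h * (l2_norm M G + n h)\<^sup>2)
        \<longlongrightarrow> 2 * l2_norm M (z s) * 0 + 0 * (l2_norm M G + 0)\<^sup>2) (at_right 0)"
      by (intro tendsto_intros nlim)
    then have "eventually (\<lambda>h. 2 * l2_norm M (z s) * n h + h * (l2_norm M G + n h)\<^sup>2 < e) (at_right 0)"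
      using e by (intro order_tendstoD(2)) auto
    moreover have "eventually (\<lambda>h. 0 < h) (at_right (0::real))" by (simp add: eventually_at_right_less)
    ultimately show ?thesis
    proof eventually_elim
      case (elim h)
      note h = elim(2)
      have sh: "0 \<le> s + h" using s h by simp
      have D1L: "D1 h \<in> L2 M" unfolding D1_def
        using L2.diff[OF L2.scale[OF L2.diff[OF S1.S_L2[OF s fH(1)] S1.S_L2[OF sh fH(1)]], of "1 / h"] S1.S_L2[OF s fH(3)]]
        by simp
      have D2L: "D2 h \<in> L2 M" unfolding D2_def
        using L2.diff[OF L2.scale[OF L2.diff[OF S2.S_L2[OF s fH(2)] S2.S_L2[OF sh fH(2)]], of "1 / h"] S2.S_L2[OF s fH(4)]]
        by simp
      define D where "D = (\<lambda>x. D1 h x - D2 h x)"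
      have DL: "D \<in> L2 M" unfolding D_def by (rule L2.diff[OF D1L D2L])
      have Dn: "l2_norm M D \<le> n h"
        unfolding D_def n_def l2_norm_qnorm by (rule L2.qnorm_triangle_diff[OF D1L D2L])
      define W where "W = (\<lambda>x. G x + D x)"
      have WL: "W \<in> L2 M" unfolding W_def by (rule L2.add[OF GL DL])
      have Wn: "l2_norm M W \<le> l2_norm M G + n h"
        using L2.qnorm_triangle[OF GL DL] Dn by (simp add: W_def l2_norm_qnorm)
      \<comment> \<open>\<open>W\<close> is the difference quotient of \<open>z\<close> with
        reversed sign, written as its limit \<open>G\<close> plus the error
        \<open>D\<close>.\<close>
      have "z (s + h) = (\<lambda>x. z s x - h * W x)"
        using h by (auto simp: z_def W_def G_def D_def D1_def D2_def field_simps)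
      then have "m (s + h) = m s - 2 * h * l2_inner M (z s) W + h\<^sup>2 * (l2_norm M W)\<^sup>2"
        unfolding m_def l2_norm_sq
        by (simp add: L2.q_diff_sq zL s L2.scale WL L2.q_scale_right L2.q_scale
            power2_eq_square)
      also have "l2_inner M (z s) W = l2_inner M G (z s) + l2_inner M (z s) D"
        using L2.q_add_right[OF GL DL zL[OF s]] L2.q_sym[OF GL zL[OF s]] by (simp add: W_def)
      also have "m s - 2 * h * (l2_inner M G (z s) + l2_inner M (z s) D) + h\<^sup>2 * (l2_norm M W)\<^sup>2
          \<le> m s + 2 * h * (l2_norm M (z s) * n h) + h\<^sup>2 * (l2_norm M G + n h)\<^sup>2"
      proof -
        have "- (l2_inner M G (z s) + l2_inner M (z s) D) \<le> l2_norm M (z s) * l2_norm M D"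
          using L2.cauchy_schwarz[OF zL[OF s] DL] Gz by (simp add: l2_norm_qnorm abs_le_iff)
        also have "\<dots> \<le> l2_norm M (z s) * n h" by (intro mult_left_mono Dn l2_norm_nonneg)
        finally have 1: "2 * h * (- (l2_inner M G (z s) + l2_inner M (z s) D)) \<le> 2 * h * (l2_norm M (z s) * n h)"
          using h by (intro mult_left_mono) auto
        have 2: "h\<^sup>2 * (l2_norm M W)\<^sup>2 \<le> h\<^sup>2 * (l2_norm M G + n h)\<^sup>2"
          by (intro mult_left_mono power_mono Wn l2_norm_nonneg) simp
        show ?thesis using 1 2 by linarith
      qed
      also have "\<dots> = m s + h * (2 * l2_norm M (z s) * n h + h * (l2_norm M G + n h)\<^sup>2)"
        by (simp add: power2_eq_square algebra_simps)
      also have "\<dots> \<le> m s + h * e" using elim h by simp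
      finally show "m (s + h) \<le> m s + e * h" by (simp add: mult.commute)
    qed
  qed
  have "m t \<le> m 0" by (rule right_derivative_nonpos_imp_le[OF cont t right])
  moreover have "m 0 = 0"
  proof -
    have "AE x in M. z 0 x = 0"
      using S1.S_zero[OF fH(1)] S2.S_zero[OF fH(2)] by eventually_elim (simp add: z_def)
    then have "l2_norm M (z 0) = l2_norm M (\<lambda>_. 0)"
      by (intro l2_norm_cong_AE L2_measurable zL L2.zero) auto
    then show ?thesis by (simp add: m_def l2_norm_def l2_inner_def)
  qed
  ultimately have "(l2_norm M (z t))\<^sup>2 \<le> 0" by (simp add: m_def)
  then show ?thesis by (simp add: z_def)
qed

lemma L2_full_semigroup: "C0_semigroup M (L2 M) S \<Longrightarrow> L2_semigroup M (L2 M) S"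
  by unfold_locales (auto simp: L2.q_rules)

context lc_dirichlet
begin

lemma L2_on_semigroup:
  assumes "C0_semigroup M (L2_on M \<Omega>) S"
  shows "L2_semigroup M (L2_on M \<Omega>) S"
proof unfold_locales
  show "(\<lambda>_. 0) \<in> L2_on M \<Omega>" using restr_L2_on[OF L2.zero] by (simp add: restr_zero)
  fix u f assume u: "\<And>n. u n \<in> L2_on M \<Omega>" and f: "f \<in> L2 M"
    and lim: "(\<lambda>n. l2_norm M (\<lambda>x. u n x - f x)) \<longlonglongrightarrow> 0"
  have uL: "u n \<in> L2 M" for n using u L2_on_L2 by blast
  have lr: "(\<lambda>n. l2_norm M (\<lambda>x. u n x - restr f x)) \<longlonglongrightarrow> 0"
  proof (rule Lim_null_comparison[OF _ lim], intro always_eventually allI)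
    fix n
    have "l2_norm M (\<lambda>x. u n x - restr f x) = l2_norm M (restr (\<lambda>x. u n x - f x))"
      by (rule l2_norm_cong_AE)
        (use L2_on_AE[OF u[of n]] in \<open>auto intro!: L2_measurable restr_L2 L2.diff uL f simp: restr_diff elim: eventually_mono\<close>)
    then show "norm (l2_norm M (\<lambda>x. u n x - restr f x)) \<le> l2_norm M (\<lambda>x. u n x - f x)"
      using restr_norm_le[OF L2.diff[OF uL f], of n] by (simp add: l2_norm_nonneg)
  qed
  have "AE x in M. f x = restr f x" by (rule L2_limit_unique[OF uL f restr_L2[OF f] lim lr])
  then show "f \<in> L2_on M \<Omega>" using f by (simp add: L2_on_def restr_def)
qed (use assms L2_on_L2 in \<open>auto intro: L2_on_diff L2_on_scale\<close>)

text \<open>The resolvents of \<open>f\<close> lie in the operator domain, where agreement is known,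
  and tend to \<open>f\<close>; boundedness of both operators at the fixed time carries agreement
  over.\<close>

lemma semigroups_agree:
  assumes SD: "form_semigroup M (L2_on M \<Omega>) (form_D M a \<Omega>) SD"
    and b: "positive_form M (L2 M) b" and SN: "form_semigroup M (L2 M) b SN"
    and incl: "form_operator M (L2_on M \<Omega>) (form_D M a \<Omega>) \<subseteq> form_operator M (L2 M) b"
    and f: "f \<in> L2_on M \<Omega>" and t: "0 \<le> t"
  shows "AE x in M. SD t f x = SN t f x"
proof -
  interpret SGD: L2_semigroup M "L2_on M \<Omega>" SD
    using SD by (intro L2_on_semigroup) (simp add: form_semigroup_def)
  interpret SGN: L2_semigroup M "L2 M" SN
    using SN by (intro L2_full_semigroup) (simp add: form_semigroup_def)
  have genD: "neg_generator M (L2_on M \<Omega>) SD = form_operator M (L2_on M \<Omega>) (form_D M a \<Omega>)"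
    and genN: "neg_generator M (L2 M) SN = form_operator M (L2 M) b"
    using SD SN by (auto simp: form_semigroup_def)
  have fL: "f \<in> L2 M" using f L2_on_L2 by blast
  define u where "u n = D.res n f" for n
  obtain C1 where C1: "0 \<le> C1" "\<And>f. f \<in> L2_on M \<Omega> \<Longrightarrow> l2_norm M (SD t f) \<le> C1 * l2_norm M f"
    using SGD.S_bound[OF t] by blast
  obtain C2 where C2: "0 \<le> C2" "\<And>f. f \<in> L2 M \<Longrightarrow> l2_norm M (SN t f) \<le> C2 * l2_norm M f"
    using SGN.S_bound[OF t] by blast
  have u: "u n \<in> L2_on M \<Omega>" for n unfolding u_def by (rule D.dom_H[OF D.res_dom[OF fL]])
  have zero: "l2_norm M (\<lambda>x. SD t (u n) x - SN t (u n) x) = 0" for n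
  proof (rule semigroups_agree_on_operator_domain[OF SGD.L2_semigroup_axioms SGN.L2_semigroup_axioms b genN _ _ t])
    show "neg_generator M (L2_on M \<Omega>) SD \<subseteq> neg_generator M (L2 M) SN"
      unfolding genD genN by (rule incl)
    show "(u n, \<lambda>x. real (Suc n) * (f x - u n x)) \<in> neg_generator M (L2_on M \<Omega>) SD"
      unfolding genD u_def
      by (rule D.res_operator[OF f]) (intro L2_on_scale L2_on_diff f D.dom_H)
  qed
  have "l2_norm M (\<lambda>x. SD t f x - SN t f x) \<le> (C1 + C2) * l2_norm M (\<lambda>x. u n x - f x)" for n
  proof -
    note uL = subsetD[OF L2_on_L2 u, of n]
    have fu: "(\<lambda>x. f x - u n x) \<in> L2_on M \<Omega>" by (rule L2_on_diff[OF f u])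
    have "l2_norm M (\<lambda>x. SD t f x - SN t f x) \<le> l2_norm M (\<lambda>x. SD t f x - SD t (u n) x)
        + (l2_norm M (\<lambda>x. SD t (u n) x - SN t (u n) x) + l2_norm M (\<lambda>x. SN t (u n) x - SN t f x))"
      unfolding l2_norm_qnorm
      using L2.qnorm_triangle3[OF SGD.S_L2[OF t f] SGD.S_L2[OF t u] SGN.S_L2[OF t fL], of n]
        L2.qnorm_triangle3[OF SGD.S_L2[OF t u] SGN.S_L2[OF t uL] SGN.S_L2[OF t fL], of n]
      by linarith
    also have "l2_norm M (\<lambda>x. SD t f x - SD t (u n) x) \<le> C1 * l2_norm M (\<lambda>x. f x - u n x)"
      unfolding SGD.S_norm_diff[OF t f u] by (rule C1(2)[OF fu])
    also have "l2_norm M (\<lambda>x. SN t (u n) x - SN t f x) \<le> C2 * l2_norm M (\<lambda>x. u n x - f x)"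
      unfolding SGN.S_norm_diff[OF t uL fL] by (rule C2(2)[OF L2.diff[OF uL fL]])
    also have "l2_norm M (\<lambda>x. f x - u n x) = l2_norm M (\<lambda>x. u n x - f x)"
      using L2.qnorm_minus_commute[OF fL uL] by (simp add: l2_norm_qnorm)
    finally show ?thesis using zero[of n] by (simp add: distrib_right)
  qed
  moreover have "(\<lambda>n. (C1 + C2) * l2_norm M (\<lambda>x. u n x - f x)) \<longlonglongrightarrow> 0"
    unfolding u_def by (intro tendsto_mult_right_zero D.res_limit form_D_dense f)
  ultimately have "l2_norm M (\<lambda>x. SD t f x - SN t f x) \<le> 0"
    by (intro LIMSEQ_le_const[of _ 0]) auto
  then have "l2_inner M (\<lambda>x. SD t f x - SN t f x) (\<lambda>x. SD t f x - SN t f x) = 0"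
    using l2_norm_nonneg[of M "\<lambda>x. SD t f x - SN t f x"] by (simp add: l2_norm_def)
  from l2_inner_eq_0_AE[OF L2.diff[OF SGD.S_L2[OF t f] SGN.S_L2[OF t fL]] this]
  show ?thesis by simp
qed

end

theorem theorem3p7:
  fixes M :: "'a::metric_space measure"
    and \<Omega> :: "'a set"
    and \<E> \<E>N :: "'a form"
    and SD SN :: "real \<Rightarrow> ('a \<Rightarrow> real) \<Rightarrow> ('a \<Rightarrow> real)"
  assumes "locally_compact_space (euclidean :: 'a topology)"
    and "sigma_compact (UNIV :: 'a set)"
    and "radon_measure M"
    and "measure_supp M = UNIV"
    and "open \<Omega>"
    and "dirichlet_form M (L2 M) \<E>"
    and "regular_form M \<E>"
    and "strongly_local M \<E>"
    and "form_semigroup M (L2_on M \<Omega>) (form_D M \<E> \<Omega>) SD"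
    and "is_relaxation M (L2 M) (form_N M \<E> \<Omega>) \<E>N"
    and "form_semigroup M (L2 M) \<E>N SN"
  shows "rel_cap M \<E> \<Omega> (frontier \<Omega>) = 0 \<longleftrightarrow>
    (\<forall>f\<in>L2_on M \<Omega>. \<forall>t>0. AE x in M. SD t f x = SN t f x)"
proof -
  have borel: "sets M = sets borel" using assms(3) by (simp add: radon_measure_def)
  have space: "space M = UNIV" using sets_eq_imp_space_eq[OF borel] by simp
  interpret lc_dirichlet M \<E> \<Omega>
    by unfold_locales (use assms borel space in \<open>auto simp: dirichlet_form_def\<close>)
  note bc = relaxation_dom[OF assms(10)]
  have bp: "positive_form M (L2 M) \<E>N" using bc(1) by (simp add: closed_form_def)
  show ?thesis
  proof
    assume cap: "rel_cap M \<E> \<Omega> (frontier \<Omega>) = 0"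
    show "\<forall>f\<in>L2_on M \<Omega>. \<forall>t>0. AE x in M. SD t f x = SN t f x"
      using semigroups_agree[OF assms(9) bp assms(11) operator_inclusion[OF cap assms(10)]] by auto
  next
    assume eq: "\<forall>f\<in>L2_on M \<Omega>. \<forall>t>0. AE x in M. SD t f x = SN t f x"
    have "neg_generator M (L2_on M \<Omega>) SD \<subseteq> neg_generator M (L2 M) SN"
    proof clarify
      fix f g assume "(f, g) \<in> neg_generator M (L2_on M \<Omega>) SD"
      then have f: "f \<in> L2_on M \<Omega>" and g: "g \<in> L2_on M \<Omega>"
        and lim: "((\<lambda>t. l2_norm M (\<lambda>x. (f x - SD t f x) / t - g x)) \<longlongrightarrow> 0) (at_right 0)"
        by (auto simp: neg_generator_def)
      have fL: "f \<in> L2 M" and gL: "g \<in> L2 M" using f g L2_on_L2 by blast+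
      have SL: "SD t f \<in> L2 M" "SN t f \<in> L2 M" if "0 < t" for t
        using assms(9,11) that f fL L2_on_L2 unfolding form_semigroup_def C0_semigroup_def
        by (metis less_imp_le subsetD)+
      have "l2_norm M (\<lambda>x. (f x - SD t f x) / t - g x) = l2_norm M (\<lambda>x. (f x - SN t f x) / t - g x)"
        if t: "0 < t" for t
      proof (rule l2_norm_cong_AE)
        note [measurable] = L2_measurable[OF fL] L2_measurable[OF gL] L2_measurable[OF SL(1)[OF t]]
          L2_measurable[OF SL(2)[OF t]]
        show "(\<lambda>x. (f x - SD t f x) / t - g x) \<in> borel_measurable M"
          "(\<lambda>x. (f x - SN t f x) / t - g x) \<in> borel_measurable M" by measurable
        have "AE x in M. SD t f x = SN t f x" using eq f t by blast
        then show "AE x in M. (f x - SD t f x) / t - g x = (f x - SN t f x) / t - g x"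
          by eventually_elim simp
      qed
      then have "eventually (\<lambda>t. l2_norm M (\<lambda>x. (f x - SD t f x) / t - g x)
          = l2_norm M (\<lambda>x. (f x - SN t f x) / t - g x)) (at_right 0)"
        using eventually_at_right_less[of 0] by (rule eventually_mono[rotated])
      from Lim_transform_eventually[OF lim this] fL gL
      show "(f, g) \<in> neg_generator M (L2 M) SN" by (simp add: neg_generator_def)
    qed
    then have incl: "form_operator M (L2_on M \<Omega>) (form_D M \<E> \<Omega>) \<subseteq> form_operator M (L2 M) \<E>N"
      using assms(9,11) by (simp add: form_semigroup_def)
    \<comment> \<open>The relaxation lies below the Neumann form, so its domain contains that of
      \<open>\<E>\<close>, and the restriction result applies to every function there.\<close>
    show "rel_cap M \<E> \<Omega> (frontier \<Omega>) = 0"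
      using restr_in_DD_of_operator_inclusion[OF bp incl] bc(2) by (intro rel_cap_frontier_zero) blast
  qed
qed

end
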